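(* Let $k\geq 2$ be an integer. The Riemann Hypothesis is equivalent to the statement: for every $\epsilon>0$, $$S_k(X)=\frac{X^k}{k!}+\mathcal{O}_{k}\!\left(X^{k-1/2+\epsilon}\right)\quad\text{for } X\geq k.$$
   Context: $\Lambda$ denotes the von Mangoldt function. For an integer $k\geq 2$ and a positive integer $n$, $G_k(n)=\sum_{n_1+\dots+n_k=n}\Lambda(n_1)\cdots\Lambda(n_k)$, the sum over ordered $k$-tuples of positive integers. For $X>0$, $S_k(X)=\sum_{n\leq X}G_k(n)$. The implied constant may depend on $k$ and $\epsilon$. *)

theory Defs
  imports
    "HOL-Complex_Analysis.Complex_Analysis"
    "HOL-Number_Theory.Prime_Powers"
begin

text \<open>
  The Riemann zeta function is the analytic continuation to \<open>- {1}\<close> of the Dirichlet series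
  \<open>1 + 2 powr - s + 3 powr - s + ...\<close>, which converges for \<open>Re s > 1\<close>.
\<close>

definition zeta_continuation :: "(complex \<Rightarrow> complex) \<Rightarrow> bool" where
  "zeta_continuation f \<longleftrightarrow>
     f holomorphic_on (- {1}) \<and>
     (\<forall>s. Re s > 1 \<longrightarrow> (\<lambda>n. 1 / of_nat (Suc n) powr s) sums f s)"

lemma zeta_continuation_unique:
  assumes f: "zeta_continuation f" and g: "zeta_continuation g" and "s \<noteq> 1"
  shows "f s = g s"
proof -
  have "f s - g s = 0"
  proof (rule analytic_continuation_open[where s = "{s. Re s > 1}" and s' = "- {1}" and
        f = "\<lambda>s. f s - g s" and g = "\<lambda>_. 0"])
    have "(2::complex) \<in> {s. Re s > 1}"
      by simp
    then show "{s::complex. Re s > 1} \<noteq> {}"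
      by blast
    show "connected (- {1::complex})"
      by (rule connected_punctured_universe) simp
    show "(\<lambda>s. f s - g s) holomorphic_on - {1}"
      using f g by (auto simp: zeta_continuation_def intro!: holomorphic_intros)
    show "f z - g z = 0" if "z \<in> {s. Re s > 1}" for z
      using f g that unfolding zeta_continuation_def
      by (metis mem_Collect_eq right_minus_eq sums_unique2)
  qed (use \<open>s \<noteq> 1\<close> in \<open>auto simp: open_halfspace_Re_gt\<close>)
  then show ?thesis
    by simp
qed

text \<open>
  By the lemma above, the choice operator leaves only the value at the pole \<open>1\<close> unspecified.
\<close>

definition zeta :: "complex \<Rightarrow> complex" where
  "zeta = (SOME f. zeta_continuation f)"

text \<open>
  The point \<open>1\<close> is excluded because it is the pole, and \<open>-2, -4, -6, ...\<close> are the trivial zeros.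
\<close>

definition Riemann_Hypothesis :: bool where
  "Riemann_Hypothesis \<longleftrightarrow>
     (\<forall>s. zeta s = 0 \<and> s \<noteq> 1 \<and> (\<nexists>n::nat. n \<ge> 1 \<and> s = - 2 * of_nat n) \<longrightarrow> Re s = 1 / 2)"

definition pos_tuples :: "nat \<Rightarrow> nat \<Rightarrow> nat list set" where
  "pos_tuples k n = {ns. length ns = k \<and> (\<forall>m\<in>set ns. m \<ge> 1) \<and> sum_list ns = n}"

lemma finite_pos_tuples: "finite (pos_tuples k n)"
proof (rule finite_subset)
  show "pos_tuples k n \<subseteq> {ns. set ns \<subseteq> {..n} \<and> length ns = k}"
    by (auto simp: pos_tuples_def member_le_sum_list)
  show "finite {ns. set ns \<subseteq> {..n} \<and> length ns = k}"
    by (rule finite_lists_length_eq) simp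
qed

definition G :: "nat \<Rightarrow> nat \<Rightarrow> real" where
  "G k n = (\<Sum>ns\<in>pos_tuples k n. \<Prod>m\<leftarrow>ns. mangoldt m)"

definition S :: "nat \<Rightarrow> real \<Rightarrow> real" where
  "S k X = (\<Sum>n | n \<ge> 1 \<and> real n \<le> X. G k n)"

end

theory Submission
  imports Defs "HOL-Real_Asymp.Real_Asymp"
begin

text \<open>
  Let \<open>\<psi>\<close> be the summatory function of the von Mangoldt function. By the functional equation, RH says
  that \<open>zeta\<close> has no zeros in \<open>Re s > 1/2\<close>.

  If there are no such zeros, then \<open>log ((s - 1) zeta s)\<close> is holomorphic in the half plane, and the
  Borel-Caratheodory inequality bounds its derivative by \<open>O(|s|^\<eta>)\<close> to the right of the line
  \<open>Re s = 1/2 + \<eta>\<close>. Shifting the contour in Perron's formula to this line gives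
  \<open>\<psi>(N) = N + O(N^(1/2 + 3\<eta>))\<close>, from which the asymptotics of \<open>S k\<close> follow by induction on \<open>k\<close>
  and partial summation.

  Conversely, the power series with coefficients \<open>G k n\<close> is the \<open>k\<close>-th power of the one with
  coefficients \<open>\<Lambda>(n)\<close>. At \<open>exp (- d)\<close> the hypothesis determines it up to \<open>O(d^(-(k - 1/2 + \<epsilon>)))\<close>, and
  taking \<open>k\<close>-th roots of positive numbers gives \<open>\<Sum>n\<ge>1. (\<Lambda>(n) - 1) exp (- n d) = O(d^(-1/2 - \<epsilon>))\<close> as
  \<open>d\<close> tends to \<open>0\<close>. So the Mellin transform \<open>M s\<close> of this sum, which is
  \<open>Gamma s (- zeta' s / zeta s - zeta s)\<close> for \<open>Re s > 1\<close>, is holomorphic in \<open>Re s > 1/2 + \<epsilon>\<close>. Hence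
  \<open>zeta' = - (M / Gamma + zeta) zeta\<close> there; this is a linear differential equation with holomorphic
  coefficient, so a zero of \<open>zeta\<close> would make \<open>zeta\<close> vanish identically.
\<close>

section \<open>The summatory function of \<open>G k\<close>\<close>

text \<open>In the converse the root is taken only at real arguments, where \<open>mangoldt\<close>
  gives nonnegative sums: then \<open>x ^ k - y ^ k\<close> is in absolute value at least
  \<open>y ^ (k - 1)\<close> times \<open>x - y\<close>, and with \<open>y\<close> of size
  \<open>1 / d\<close> this division lowers the error exponent by exactly \<open>k - 1\<close>. At
  complex arguments a k-th power near 0 would give no such control. Subtracting 1 from the
  coefficients removes the pole at 1, so that the Mellin integral converges to the left of it. The
  differential equation stands in for the logarithmic derivative, whose poles are the very zeros in
  question.

  In the other direction the obstacle is the vertical integral: the logarithmic derivative may grow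
  like \<open>|s|^\<eta>\<close>, while the plain Perron kernel decays only like
  \<open>1 / |s|\<close>. Averaging over a unit interval buys a further decay
  \<open>|s|^(-2\<eta>)\<close> at the price \<open>N^(2\<eta>)\<close>; together with the abscissa
  \<open>1/2 + \<eta>\<close> this gives the exponent \<open>1/2 + 3\<eta>\<close>.

  The functional equation is proved first for real \<open>s\<close> between -1 and 0. There the
  constants of the Euler-Maclaurin formula become one more nonnegative integral, so that every
  interchange is an instance of Tonelli.\<close>

lemma G_0: "G 0 n = (if n = 0 then 1 else 0)"
proof -
  have "pos_tuples 0 n = (if n = 0 then {[]} else {})"
    by (auto simp: pos_tuples_def)
  then show ?thesis by (simp add: G_def)
qed

lemma pos_tuples_Suc:
  "pos_tuples (Suc k) n = (\<Union>i\<in>{1..n}. (#) i ` pos_tuples k (n - i))"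
proof (intro equalityI subsetI)
  fix ns assume "ns \<in> pos_tuples (Suc k) n"
  then obtain i ms where "ns = i # ms" "length ms = k" "i \<ge> 1" "\<forall>m\<in>set ms. m \<ge> 1" "i + sum_list ms = n"
    by (cases ns) (auto simp: pos_tuples_def)
  then show "ns \<in> (\<Union>i\<in>{1..n}. (#) i ` pos_tuples k (n - i))"
    by (auto simp: pos_tuples_def intro!: bexI[of _ i])
qed (auto simp: pos_tuples_def)

lemma G_Suc: "G (Suc k) n = (\<Sum>i\<le>n. mangoldt i * G k (n - i))"
proof -
  have "G (Suc k) n = (\<Sum>i=1..n. \<Sum>ns\<in>(#) i ` pos_tuples k (n - i). \<Prod>m\<leftarrow>ns. mangoldt m)"
    unfolding G_def pos_tuples_Suc
    by (subst sum.UNION_disjoint) (auto simp: finite_pos_tuples)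
  also have "\<dots> = (\<Sum>i=1..n. mangoldt i * G k (n - i))"
    by (intro sum.cong refl, subst sum.reindex) (auto simp: G_def sum_distrib_left inj_on_def)
  \<comment> \<open>The index 0 may be added because \<open>mangoldt 0 = 0\<close>; the full range
    makes the sum a Cauchy product.\<close>
  also have "\<dots> = (\<Sum>i\<le>n. mangoldt i * G k (n - i))"
    by (rule sum.mono_neutral_left) (auto simp: not_le not_less_eq_eq)
  finally show ?thesis .
qed

lemma G_nonneg: "G k n \<ge> 0"
  by (induction k arbitrary: n) (auto simp: G_0 G_Suc intro!: sum_nonneg mult_nonneg_nonneg mangoldt_nonneg)

lemma G_at_0: "k \<ge> 1 \<Longrightarrow> G k 0 = 0"
  by (cases k) (auto simp: G_Suc)

lemma mangoldt_le_self: "(mangoldt n :: real) \<le> n"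
proof (cases "n = 0")
  case False
  then have "mangoldt n \<le> ln (real n)" by (intro mangoldt_le) auto
  also have "\<dots> \<le> real n - 1" using False by (intro ln_le_minus_one) auto
  finally show ?thesis by simp
qed auto

lemma summable_nat_power:
  assumes "(0::real) \<le> q" "q < 1"
  shows "summable (\<lambda>n. real n * q ^ n)"
proof -
  have "summable (\<lambda>n. q * (of_nat n * q ^ (n - 1)))"
    using geometric_deriv_sums[of q] assms by (subst summable_Suc_iff[symmetric]) (auto intro!: summable_mult simp: sums_iff)
  then show ?thesis
    by (rule summable_cong[THEN iffD1, rotated]) (auto intro!: eventually_sequentiallyI[of 1] simp flip: power_Suc)
qed

lemma summable_mangoldt_power:
  assumes "(0::real) \<le> q" "q < 1"
  shows "summable (\<lambda>n. mangoldt n * q ^ n)"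
proof (rule summable_comparison_test'[where N = 0])
  show "summable (\<lambda>n. real n * q ^ n)" using assms by (rule summable_nat_power)
  show "norm (mangoldt n * q ^ n) \<le> real n * q ^ n" for n
    using assms by (auto simp: abs_mult mangoldt_le_self mult_right_mono)
qed

lemma G_power_series:
  assumes "(0::real) \<le> q" "q < 1"
  shows "(\<lambda>n. G k n * q ^ n) sums (\<Sum>n. mangoldt n * q ^ n) ^ k"
proof (induction k)
  case 0
  have "(\<lambda>n. G 0 n * q ^ n) = (\<lambda>n. if n = 0 then 1 else 0)" by (auto simp: G_0)
  then show ?case using sums_single[of 0 "\<lambda>_. 1::real"] by simp
next
  case (Suc k)
  have "(\<lambda>n. \<Sum>i\<le>n. (mangoldt i * q ^ i) * (G k (n - i) * q ^ (n - i))) sums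
      ((\<Sum>n. mangoldt n * q ^ n) * (\<Sum>n. G k n * q ^ n))"
    using summable_mangoldt_power[OF assms] sums_summable[OF Suc] assms
    by (intro Cauchy_product_sums) (auto simp: abs_mult G_nonneg)
  also have "(\<lambda>n. \<Sum>i\<le>n. (mangoldt i * q ^ i) * (G k (n - i) * q ^ (n - i))) = (\<lambda>n. G (Suc k) n * q ^ n)"
  proof
    fix n
    have "(mangoldt i * q ^ i) * (G k (n - i) * q ^ (n - i)) = mangoldt i * G k (n - i) * q ^ n" if "i \<le> n" for i
      using that by (simp add: algebra_simps flip: power_add)
    then show "(\<Sum>i\<le>n. (mangoldt i * q ^ i) * (G k (n - i) * q ^ (n - i))) = G (Suc k) n * q ^ n"
      unfolding G_Suc sum_distrib_right by (intro sum.cong) auto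
  qed
  finally show ?case using sums_unique[OF Suc] by simp
qed

section \<open>Partial sums, and the passage from one prime power to k of them\<close>

definition chebyshev_psi :: "nat \<Rightarrow> real" where
  "chebyshev_psi N = (\<Sum>n\<le>N. mangoldt n)"

definition G_sum :: "nat \<Rightarrow> nat \<Rightarrow> real" where
  "G_sum k N = (\<Sum>n\<le>N. G k n)"

lemma S_eq_G_sum:
  assumes "k \<ge> 1" "X \<ge> 0"
  shows "S k X = G_sum k (nat \<lfloor>X\<rfloor>)"
  unfolding S_def G_sum_def
  using assms by (intro sum.mono_neutral_left) (auto simp: le_nat_floor G_at_0 not_le le_nat_iff le_floor_iff Suc_le_eq intro!: Nat.gr0I)

lemma G_sum_Suc: "G_sum (Suc k) N = (\<Sum>i\<le>N. mangoldt i * G_sum k (N - i))"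
proof -
  have "G_sum (Suc k) N = (\<Sum>(n,i)\<in>(SIGMA n:{..N}. {..n}). mangoldt i * G k (n - i))"
    unfolding G_sum_def G_Suc by (simp add: sum.Sigma)
  also have "\<dots> = (\<Sum>(i,j)\<in>(SIGMA i:{..N}. {..N-i}). mangoldt i * G k j)"
    by (rule sum.reindex_bij_witness[where i = "\<lambda>(i,j). (i+j,i)" and j = "\<lambda>(n,i). (i,n-i)"]) auto
  also have "\<dots> = (\<Sum>i\<le>N. mangoldt i * G_sum k (N - i))"
    unfolding G_sum_def by (simp add: sum.Sigma sum_distrib_left)
  finally show ?thesis .
qed

lemma G_sum_1: "G_sum (Suc 0) N = chebyshev_psi N"
proof -
  have "G_sum 0 M = 1" for M
    unfolding G_sum_def by (induction M) (auto simp: G_0)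
  then show ?thesis by (simp add: G_sum_Suc chebyshev_psi_def)
qed

text \<open>The mean value inequality for \<open>x ^ Suc k\<close>, read off from the factorisation
  of the difference of powers: each of its \<open>Suc k\<close> terms lies between
  \<open>x ^ k\<close> and \<open>y ^ k\<close>.\<close>

lemma power_Suc_diff_bounds:
  assumes "0 \<le> x" "x \<le> (y::real)"
  shows "real (Suc k) * x ^ k * (y - x) \<le> y ^ Suc k - x ^ Suc k"
    and "y ^ Suc k - x ^ Suc k \<le> real (Suc k) * y ^ k * (y - x)"
proof -
  have eq: "y ^ Suc k - x ^ Suc k = (\<Sum>p\<le>k. x ^ p * y ^ (k - p)) * (y - x)"
    using diff_power_eq_sum[of x k y] by (simp add: lessThan_Suc_atMost algebra_simps)
  have "x ^ k = x ^ p * x ^ (k - p)" "y ^ k = y ^ p * y ^ (k - p)" if "p \<le> k" for p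
    using that by (simp_all flip: power_add)
  then have "x ^ k \<le> x ^ p * y ^ (k - p)" "x ^ p * y ^ (k - p) \<le> y ^ k" if "p \<le> k" for p
    using that assms by (auto intro!: mult_mono power_mono simp del: power_Suc)
  then have "(\<Sum>p\<le>k. x ^ k) \<le> (\<Sum>p\<le>k. x ^ p * y ^ (k - p))"
    "(\<Sum>p\<le>k. x ^ p * y ^ (k - p)) \<le> (\<Sum>p\<le>k. y ^ k)"
    by (intro sum_mono; simp)+
  then have "real (Suc k) * x ^ k \<le> (\<Sum>p\<le>k. x ^ p * y ^ (k - p))"
    "(\<Sum>p\<le>k. x ^ p * y ^ (k - p)) \<le> real (Suc k) * y ^ k"
    by simp_all
  then show "real (Suc k) * x ^ k * (y - x) \<le> y ^ Suc k - x ^ Suc k"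
    "y ^ Suc k - x ^ Suc k \<le> real (Suc k) * y ^ k * (y - x)"
    unfolding eq using assms by (auto intro!: mult_right_mono simp del: of_nat_Suc)
qed

text \<open>Comparison of the sum with the integral of \<open>x ^ k\<close>: by monotonicity the
  errors add up to at most one extreme term.\<close>

lemma sum_powers_approx:
  "\<bar>(\<Sum>m<N. real m ^ k) - real N ^ Suc k / Suc k\<bar> \<le> real N ^ k"
proof -
  have "real N ^ Suc k / Suc k - real N ^ k \<le> (\<Sum>m<N. real m ^ k) \<and> (\<Sum>m<N. real m ^ k) \<le> real N ^ Suc k / Suc k"
  proof (induction N)
    case (Suc N)
    have 1: "real (Suc k) * real N ^ k \<le> real (Suc N) ^ Suc k - real N ^ Suc k"
      "real (Suc N) ^ Suc k - real N ^ Suc k \<le> real (Suc k) * real (Suc N) ^ k"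
      using power_Suc_diff_bounds[of "real N" "real (Suc N)" k] by simp_all
    have "real N ^ k \<le> real (Suc N) ^ Suc k / Suc k - real N ^ Suc k / Suc k"
      "real (Suc N) ^ Suc k / Suc k - real N ^ Suc k / Suc k \<le> real (Suc N) ^ k"
      using 1 by (simp_all add: divide_simps mult.commute flip: diff_divide_distrib del: power_Suc of_nat_Suc)
    then show ?case using Suc unfolding sum.lessThan_Suc by linarith
  qed auto
  then show ?thesis
    by (smt (verit) zero_le_power of_nat_0_le_iff)
qed

text \<open>Summation by parts. The last weight and the decrements of \<open>b\<close> are
  nonnegative and telescope to \<open>b 0\<close>.\<close>

lemma abel_sum_bound:
  fixes a b :: "nat \<Rightarrow> real"
  assumes "\<And>j. j \<le> N \<Longrightarrow> \<bar>\<Sum>i\<le>j. a i\<bar> \<le> M" "\<And>i j. i \<le> j \<Longrightarrow> j \<le> N \<Longrightarrow> b j \<le> b i" "b N \<ge> 0"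
  shows "\<bar>\<Sum>i\<le>N. a i * b i\<bar> \<le> M * b 0"
proof -
  define A where "A j = (\<Sum>i\<le>j. a i)" for j
  have eq: "n \<le> N \<Longrightarrow> (\<Sum>i\<le>n. a i * b i) = A n * b n + (\<Sum>i<n. A i * (b i - b (Suc i)))" for n
    by (induction n) (auto simp: A_def algebra_simps)
  have "\<bar>\<Sum>i\<le>N. a i * b i\<bar> \<le> \<bar>A N * b N\<bar> + (\<Sum>i<N. \<bar>A i * (b i - b (Suc i))\<bar>)"
    unfolding eq[OF order.refl] by (rule order.trans[OF abs_triangle_ineq add_left_mono[OF sum_abs]])
  also have "\<dots> \<le> M * b N + (\<Sum>i<N. M * (b i - b (Suc i)))"
    using assms unfolding abs_mult A_def
    by (intro add_mono sum_mono mult_mono) (auto intro: order.trans[OF abs_ge_zero])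
  also have "\<dots> = M * b 0"
    by (simp only: sum_distrib_left[symmetric] sum_lessThan_telescope') (simp add: algebra_simps)
  finally show ?thesis .
qed

text \<open>In the convolution \<open>G_sum_Suc\<close>, replacing \<open>G_sum k\<close> by its
  main term \<open>b\<close> costs \<open>chebyshev_psi N = O(N)\<close> times the previous error.
  Replacing \<open>mangoldt\<close> by 1 costs, by partial summation against the decreasing
  \<open>b\<close>, at most \<open>N powr a\<close> times \<open>b 0\<close>. What is left is a sum
  of k-th powers, whose error \<open>N ^ k\<close> is smaller still.\<close>

lemma G_sum_asymp_of_psi:
  assumes a: "0 \<le> a" "a \<le> 1"
    and psi: "\<And>N. N \<ge> 1 \<Longrightarrow> \<bar>chebyshev_psi N - N\<bar> \<le> C * real N powr a"
    and k: "k \<ge> 1"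
  shows "\<exists>C. \<forall>N\<ge>1. \<bar>G_sum k N - real N ^ k / fact k\<bar> \<le> C * real N powr (real k - 1 + a)"
  using k
proof (induction k rule: dec_induct)
  case base
  then show ?case using psi by (auto simp: G_sum_1)
next
  case (step k)
  then obtain D where D: "\<And>N. N \<ge> 1 \<Longrightarrow> \<bar>G_sum k N - real N ^ k / fact k\<bar> \<le> D * real N powr (real k - 1 + a)"
    by auto
  have C0: "C \<ge> 0" using psi[of 1] by (simp add: order.trans[OF abs_ge_zero])
  have D0: "D \<ge> 0" using D[of 1] by (simp add: order.trans[OF abs_ge_zero])
  have "\<bar>G_sum (Suc k) N - real N ^ Suc k / fact (Suc k)\<bar> \<le> (D * (1 + C) + (C + 1) + 2) * real N powr (real k + a)" if N: "N \<ge> 1" for N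
  proof -
    define b where "b i = real (N - i) ^ k / fact k" for i
    define E where "E i = G_sum k (N - i) - b i" for i
    have Npow: "real N powr (real k + a) = real N ^ k * real N powr a"
      using N by (simp add: powr_add powr_realpow)
    have Na: "1 \<le> real N powr a" using N a by (intro ge_one_powr_ge_zero) auto
    have E: "\<bar>E i\<bar> \<le> D * real N powr (real k - 1 + a)" if "i \<le> N" for i
    proof (cases "i = N")
      \<comment> \<open>The bound by \<open>D\<close> is available only from 1 on; at the end point
        both terms of \<open>E\<close> vanish, since \<open>1 \<le> k\<close>.\<close>
      case True
      then show ?thesis using \<open>1 \<le> k\<close> D0 by (auto simp: E_def b_def G_sum_def G_at_0 power_0_left)
    next
      case False
      then have "\<bar>E i\<bar> \<le> D * real (N - i) powr (real k - 1 + a)"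
        unfolding E_def b_def using that by (intro D) auto
      also have "\<dots> \<le> D * real N powr (real k - 1 + a)"
        using a \<open>1 \<le> k\<close> that D0 by (intro mult_left_mono powr_mono2) auto
      finally show ?thesis .
    qed
    have psi_le: "chebyshev_psi N \<le> (1 + C) * real N"
    proof -
      have "real N powr a \<le> real N"
        using powr_mono[of a 1 "real N"] a N by simp
      then have "C * real N powr a \<le> C * real N" using C0 by (rule mult_left_mono)
      then show ?thesis using psi[OF N] by (simp add: algebra_simps abs_le_iff)
    qed
    have "\<bar>\<Sum>i\<le>N. mangoldt i * E i\<bar> \<le> (\<Sum>i\<le>N. mangoldt i * (D * real N powr (real k - 1 + a)))"
      using E by (intro order.trans[OF sum_abs] sum_mono) (auto simp: abs_mult mangoldt_nonneg intro!: mult_left_mono)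
    also have "\<dots> = chebyshev_psi N * (D * real N powr (real k - 1 + a))"
      by (simp add: chebyshev_psi_def sum_distrib_right)
    also have "\<dots> \<le> ((1 + C) * real N) * (D * real N powr (real k - 1 + a))"
      using psi_le D0 by (intro mult_right_mono) auto
    also have "\<dots> = D * (1 + C) * (real N powr 1 * real N powr (real k - 1 + a))" by simp
    also have "\<dots> = D * (1 + C) * real N powr (real k + a)" by (subst powr_add[symmetric]) simp
    finally have 1: "\<bar>\<Sum>i\<le>N. mangoldt i * E i\<bar> \<le> D * (1 + C) * real N powr (real k + a)" .
    have "\<bar>\<Sum>i\<le>N. (mangoldt i - 1) * b i\<bar> \<le> ((C + 1) * real N powr a) * b 0"
    proof (rule abel_sum_bound)
      fix j assume j: "j \<le> N"
      \<comment> \<open>The extra -1 is the index 0; it accounts for the 1 in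
        \<open>C + 1\<close>.\<close>
      have "(\<Sum>i\<le>j. mangoldt i - 1) = chebyshev_psi j - j - 1"
        by (simp add: sum_subtractf chebyshev_psi_def)
      moreover have "\<bar>chebyshev_psi j - j\<bar> \<le> C * real N powr a"
      proof (cases "j = 0")
        case False
        then have "\<bar>chebyshev_psi j - j\<bar> \<le> C * real j powr a" by (intro psi) auto
        also have "\<dots> \<le> C * real N powr a" using j C0 a by (intro mult_left_mono powr_mono2) auto
        finally show ?thesis .
      qed (use C0 in \<open>auto simp: chebyshev_psi_def\<close>)
      ultimately show "\<bar>\<Sum>i\<le>j. mangoldt i - 1\<bar> \<le> (C + 1) * real N powr a"
        using Na by (simp add: algebra_simps)
    qed (auto simp: b_def divide_right_mono power_mono)
    also have "\<dots> \<le> ((C + 1) * real N powr a) * real N ^ k"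
      using C0 by (intro mult_left_mono) (auto simp: b_def divide_simps fact_ge_1 mult_le_cancel_left1)
    finally have 2: "\<bar>\<Sum>i\<le>N. (mangoldt i - 1) * b i\<bar> \<le> (C + 1) * real N powr (real k + a)"
      unfolding Npow by (simp add: mult_ac)
    have "(\<Sum>i\<le>N. b i) = (\<Sum>m\<le>N. real m ^ k / fact k)"
      unfolding b_def by (rule sum.reindex_bij_witness[where i = "\<lambda>m. N - m" and j = "\<lambda>m. N - m"]) auto
    also have "\<dots> = ((\<Sum>m<N. real m ^ k) + real N ^ k) / fact k"
      by (simp add: sum_divide_distrib add_divide_distrib flip: lessThan_Suc_atMost)
    finally have "(\<Sum>i\<le>N. b i) - real N ^ Suc k / fact (Suc k) =
      (((\<Sum>m<N. real m ^ k) - real N ^ Suc k / real (Suc k)) + real N ^ k) / fact k"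
      unfolding fact_Suc by (simp add: diff_divide_distrib add_divide_distrib del: power_Suc of_nat_Suc)
    also have "\<bar>\<dots>\<bar> \<le> (2 * real N ^ k) / fact k"
      unfolding abs_divide using sum_powers_approx[where N = N and k = k]
      by (intro frac_le order.trans[OF abs_triangle_ineq]) auto
    also have "\<dots> \<le> (2 * real N ^ k) / 1" by (intro frac_le) (auto simp: fact_ge_1)
    also have "\<dots> \<le> 2 * real N powr (real k + a)"
      using Na mult_left_mono[OF Na, of "real N ^ k"] by (simp add: Npow)
    finally have 3: "\<bar>(\<Sum>i\<le>N. b i) - real N ^ Suc k / fact (Suc k)\<bar> \<le> 2 * real N powr (real k + a)" .
    have "G_sum (Suc k) N = (\<Sum>i\<le>N. mangoldt i * E i) + (\<Sum>i\<le>N. (mangoldt i - 1) * b i) + (\<Sum>i\<le>N. b i)"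
      unfolding G_sum_Suc E_def by (simp add: algebra_simps sum_subtractf flip: sum.distrib)
    then have "\<bar>G_sum (Suc k) N - real N ^ Suc k / fact (Suc k)\<bar> \<le>
       D * (1 + C) * real N powr (real k + a) + (C + 1) * real N powr (real k + a) + 2 * real N powr (real k + a)"
      using 1 2 3 by linarith
    then show ?thesis by (simp add: algebra_simps)
  qed
  then show ?case by (intro exI) auto
qed

section \<open>Continuation of the zeta function to \<open>Re s > -1\<close>\<close>

text \<open>
  The error of the trapezoidal rule for the integral of \<open>x powr - s\<close> over \<open>{n..n + 1}\<close>. It is
  \<open>O(n powr (- Re s - 2))\<close>, so that the series of these errors continues the Dirichlet series.
\<close>

definition em_term :: "nat \<Rightarrow> complex \<Rightarrow> complex" where
  "em_term n s = (of_nat n powr (-s) + of_nat (Suc n) powr (-s)) / 2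
     - (of_nat (Suc n) powr (1 - s) - of_nat n powr (1 - s)) / (1 - s)"

text \<open>Two integrations by parts. The weight \<open>(x - n) * (n + 1 - x)\<close> vanishes at
  both ends, its first derivative is 1 and -1 there and produces the two end values of the
  trapezoid, and its second derivative -2 produces the integral of \<open>x powr - s\<close>.
  \<open>F\<close> collects the boundary terms.\<close>

lemma has_integral_em_term:
  assumes n: "n \<ge> 1" and s: "s \<noteq> 1"
  shows "((\<lambda>x. of_real ((x - real n) * (real (Suc n) - x)) * (s * (s + 1)) * of_real x powr (-s - 2) / 2)
     has_integral em_term n s) {real n..real (Suc n)}"
proof -
  define N :: complex where "N = of_nat n"
  define F where "F z = ((z - N) * (N + 1 - z) * (-s * z powr (-s - 1)) - (2 * N + 1 - 2 * z) * z powr (-s)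
      - 2 * z powr (1 - s) / (1 - s)) / 2" for z
  have "(F has_field_derivative (z - N) * (N + 1 - z) * (s * (s + 1)) * z powr (-s - 2) / 2) (at z)"
    if "z \<notin> \<real>\<^sub>\<le>\<^sub>0" for z
  proof -
    have e: "-s - 1 - 1 = -s - 2" "1 - s - 1 = - s" by simp_all
    show ?thesis unfolding F_def using that s
      by (auto intro!: derivative_eq_intros simp: e) (simp add: field_simps)
  qed
  then have "((\<lambda>x. F (of_real x)) has_vector_derivative
      of_real ((x - real n) * (real (Suc n) - x)) * (s * (s + 1)) * of_real x powr (-s - 2) / 2)
      (at x within {real n..real (Suc n)})" if "x \<in> {real n..real (Suc n)}" for x
    using that n by (intro has_vector_derivative_real_field) (auto simp: N_def add_ac)
  then have "((\<lambda>x. of_real ((x - real n) * (real (Suc n) - x)) * (s * (s + 1)) * of_real x powr (-s - 2) / 2)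
     has_integral F (of_real (real (Suc n))) - F (of_real (real n))) {real n..real (Suc n)}"
    by (intro fundamental_theorem_of_calculus) auto
  also have "F (of_real (real (Suc n))) - F (of_real (real n)) = em_term n s"
  proof -
    have "F (of_real (real (Suc n))) = (of_nat (Suc n) powr (-s) - 2 * of_nat (Suc n) powr (1 - s) / (1 - s)) / 2"
      unfolding F_def N_def by (simp add: algebra_simps)
    moreover have "F (of_real (real n)) = (- (of_nat n powr (-s)) - 2 * of_nat n powr (1 - s) / (1 - s)) / 2"
      unfolding F_def N_def by (simp add: algebra_simps)
    moreover have "2 * a / (2 - s * 2) = a / (1 - s)" for a
      using s by (simp add: field_simps)
    ultimately show ?thesis
      by (simp add: em_term_def diff_divide_distrib add_divide_distrib del: of_nat_Suc)
  qed
  finally show ?thesis .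
qed

text \<open>The parameter \<open>r\<close> in place of \<open>Re s\<close> gives one bound for a
  whole disc or half plane; \<open>-2 \<le> r\<close> makes the power decreasing, so that its value
  at the left end dominates.\<close>

lemma norm_em_term_le:
  assumes n: "n \<ge> 1" and s: "s \<noteq> 1" and r: "-2 \<le> r" "r \<le> Re s"
  shows "norm (em_term n s) \<le> norm s * norm (s + 1) * real n powr (- r - 2)"
proof -
  have "norm (em_term n s) \<le> (norm s * norm (s + 1) * real n powr (- r - 2)) * measure lborel {real n..real (Suc n)}"
  proof (rule has_integral_bound_real[OF _ finite.emptyI])
    show "((\<lambda>x. of_real ((x - real n) * (real (Suc n) - x)) * (s * (s + 1)) * of_real x powr (-s - 2) / 2)
     has_integral em_term n s) {real n..real (Suc n)}"
      by (rule has_integral_em_term) fact+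
    fix x assume x: "x \<in> {real n..real (Suc n)} - {}"
    have 1: "norm (of_real x powr (-s - 2)) \<le> real n powr (-r - 2)"
    proof -
      have "norm (of_real x powr (-s - 2)) = x powr (- Re s - 2)"
        using x n by (subst norm_powr_real_powr) auto
      also have "\<dots> \<le> x powr (- r - 2)" using x n r by (intro powr_mono) auto
      also have "\<dots> \<le> real n powr (- r - 2)" using x n r by (intro powr_mono2') auto
      finally show ?thesis .
    qed
    have "\<bar>(x - real n) * (real (Suc n) - x)\<bar> \<le> 1 * 1"
      unfolding abs_mult using x by (intro mult_mono) auto
    then have 2: "norm (of_real ((x - real n) * (real (Suc n) - x)) :: complex) \<le> 1"
      by (simp only: norm_of_real)
    have "norm (of_real ((x - real n) * (real (Suc n) - x)) * (s * (s + 1)) * of_real x powr (-s - 2))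
       \<le> 1 * (norm s * norm (s + 1)) * real n powr (- r - 2)"
      unfolding norm_mult[of _ "_ powr _"] norm_mult[of "of_real _"] norm_mult[of s]
      using 1 2 by (intro mult_mono) auto
    then show "norm (of_real ((x - real n) * (real (Suc n) - x)) * (s * (s + 1)) * of_real x powr (-s - 2) / 2)
      \<le> norm s * norm (s + 1) * real n powr (- r - 2)"
      unfolding norm_divide by simp (smt (verit) norm_ge_zero)
  qed auto
  then show ?thesis by simp
qed

lemma summable_Suc_powr: "a < -1 \<Longrightarrow> summable (\<lambda>n. real (Suc n) powr a)"
  by (subst summable_Suc_iff) (simp add: summable_real_powr_iff)

text \<open>The Euler-Maclaurin formula: \<open>1 / (s - 1)\<close> is the integral of
  \<open>x powr - s\<close> over \<open>x \<ge> 1\<close>, and \<open>1 / 2\<close> is the half of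
  the term 1 that the trapezoids miss, as only one of them ends there.\<close>

definition zeta1 :: "complex \<Rightarrow> complex" where
  "zeta1 s = 1 / 2 + 1 / (s - 1) + (\<Sum>n. em_term (Suc n) s)"

lemma summable_em_term:
  assumes "s \<noteq> 1" "Re s > -1"
  shows "summable (\<lambda>n. em_term (Suc n) s)"
proof (rule summable_comparison_test'[where N = 0])
  show "summable (\<lambda>n. norm s * norm (s + 1) * real (Suc n) powr (- Re s - 2))"
    using assms by (intro summable_mult summable_Suc_powr) auto
  show "norm (em_term (Suc n) s) \<le> norm s * norm (s + 1) * real (Suc n) powr (- Re s - 2)" for n
    using assms by (intro norm_em_term_le) auto
qed

lemma holomorphic_zeta1: "zeta1 holomorphic_on {s. Re s > -1} - {1}"
proof -
  let ?A = "{s. Re s > -1} - {1 :: complex}"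
  have op: "open ?A" by (intro open_delete open_halfspace_Re_gt)
  define f' where "f' n = deriv (em_term (Suc n))" for n
  have f': "(em_term (Suc n) has_field_derivative f' n s) (at s)" if "s \<in> ?A" for n s
  proof -
    have "em_term (Suc n) holomorphic_on ?A"
      unfolding em_term_def[abs_def] by (auto intro!: holomorphic_intros)
    then show ?thesis
      unfolding f'_def by (rule holomorphic_derivI[OF _ op that])
  qed
  have "\<exists>g g'. \<forall>s\<in>?A. (\<lambda>n. em_term (Suc n) s) sums g s \<and> (\<lambda>n. f' n s) sums g' s \<and> (g has_field_derivative g' s) (at s)"
  proof (rule series_and_derivative_comparison_local[OF op f'])
    fix x assume x: "x \<in> ?A"
    \<comment> \<open>Half the distance to the line \<open>Re s = -1\<close>, so that the exponent
      of the majorant stays below -1 on the disc.\<close>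
    define d where "d = (Re x + 1) / 2"
    define K where "K = (norm x + d) * (norm x + d + 1)"
    show "\<exists>d h. 0 < d \<and> summable h \<and> (\<forall>\<^sub>F n in sequentially. \<forall>y\<in>ball x d \<inter> ?A. cmod (em_term (Suc n) y) \<le> h n)"
    proof (intro exI conjI always_eventually allI ballI)
      show d: "d > 0" using x by (auto simp: d_def)
      show "summable (\<lambda>n. K * real (Suc n) powr (- (Re x - d) - 2))"
        using x by (intro summable_mult summable_Suc_powr) (auto simp: d_def field_simps)
      fix n y assume y: "y \<in> ball x d \<inter> ?A"
      have ny: "norm y \<le> norm x + d"
        using y norm_triangle_ineq2[of y x] by (auto simp: dist_norm norm_minus_commute)
      have "norm (y + 1) \<le> norm x + d + 1" using norm_triangle_ineq[of y 1] ny by simp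
      then have K: "norm y * norm (y + 1) \<le> K" unfolding K_def using ny d by (intro mult_mono) auto
      have Re: "Re x - d \<le> Re y"
        using y abs_Re_le_cmod[of "x - y"] by (auto simp: dist_norm)
      have "cmod (em_term (Suc n) y) \<le> norm y * norm (y + 1) * real (Suc n) powr (- (Re x - d) - 2)"
        using y Re x by (intro norm_em_term_le) (auto simp: d_def field_simps)
      also have "\<dots> \<le> K * real (Suc n) powr (- (Re x - d) - 2)"
        using K by (intro mult_right_mono) auto
      finally show "cmod (em_term (Suc n) y) \<le> K * real (Suc n) powr (- (Re x - d) - 2)" .
    qed
  qed auto
  then obtain g g' where "\<forall>s\<in>?A. (\<lambda>n. em_term (Suc n) s) sums g s \<and> (\<lambda>n. f' n s) sums g' s \<and> (g has_field_derivative g' s) (at s)"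
    by blast
  then have g: "\<And>s. s \<in> ?A \<Longrightarrow> (\<lambda>n. em_term (Suc n) s) sums g s"
     "\<And>s. s \<in> ?A \<Longrightarrow> (g has_field_derivative g' s) (at s)"
    by blast+
  have "g holomorphic_on ?A" unfolding holomorphic_on_open[OF op] using g(2) by blast
  then have "(\<lambda>s. 1 / 2 + 1 / (s - 1) + g s) holomorphic_on ?A"
    by (auto intro!: holomorphic_intros)
  moreover have "1 / 2 + 1 / (s - 1) + g s = zeta1 s" if "s \<in> ?A" for s
    using g(1)[OF that] by (simp add: zeta1_def sums_iff)
  ultimately show ?thesis by (rule holomorphic_transform) simp
qed

lemma zeta1_Dirichlet:
  assumes s: "Re s > 1"
  shows "(\<lambda>n. 1 / of_nat (Suc n) powr s) sums zeta1 s"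
proof -
  have s1: "s \<noteq> 1" using s by auto
  have eq: "(\<Sum>n<N. 1 / of_nat (Suc n) powr s) = (\<Sum>n<N. em_term (Suc n) s) + 1 / 2
      - of_nat (Suc N) powr (-s) / 2 + (of_nat (Suc N) powr (1 - s) - 1) / (1 - s)" for N
    by (induction N) (simp add: em_term_def, use s1 in \<open>auto simp: em_term_def powr_minus diff_divide_distrib add_divide_distrib inverse_eq_divide simp del: of_nat_Suc\<close>)
  have lim0: "(\<lambda>N. of_nat (Suc N) powr a :: complex) \<longlonglongrightarrow> 0" if "Re a < 0" for a
  proof (rule Lim_null_comparison)
    show "(\<lambda>N. real (Suc N) powr Re a) \<longlonglongrightarrow> 0" using that by real_asymp
    have "norm (of_nat (Suc N) powr a :: complex) = real (Suc N) powr Re a" for N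
      by (subst norm_powr_real_powr) (auto simp del: of_nat_Suc)
    then show "\<forall>\<^sub>F N in sequentially. norm (of_nat (Suc N) powr a :: complex) \<le> real (Suc N) powr Re a"
      by simp
  qed
  have "(\<lambda>N. (\<Sum>n<N. em_term (Suc n) s) + 1 / 2
      - of_nat (Suc N) powr (-s) / 2 + (of_nat (Suc N) powr (1 - s) - 1) / (1 - s)) \<longlonglongrightarrow>
      (\<Sum>n. em_term (Suc n) s) + 1 / 2 - 0 / 2 + (0 - 1) / (1 - s)"
    using s s1 by (intro tendsto_intros lim0 summable_LIMSEQ summable_em_term) auto
  also have "(\<Sum>n. em_term (Suc n) s) + 1 / 2 - 0 / 2 + (0 - 1) / (1 - s) = zeta1 s"
    using s1 by (simp add: zeta1_def field_simps)
  finally show ?thesis unfolding sums_def eq .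
qed

text \<open>The functional equation says nothing at 0, because \<open>1 - s\<close> is then the
  pole. This value is what excludes 0 as a zero. The trapezoidal rule is exact on constants.\<close>

lemma zeta1_0: "zeta1 0 = -1 / 2"
proof -
  have "em_term (Suc n) 0 = 0" for n by (simp add: em_term_def del: of_nat_Suc) simp
  then show ?thesis by (simp add: zeta1_def)
qed

section \<open>Dirichlet series of the von Mangoldt function\<close>

text \<open>The absolutely convergent double series over pairs of positive integers is regrouped by
  the product of the pair. At \<open>n = 0\<close> the set of divisors is infinite, so that the
  inner sum has the default value 0.\<close>

lemma Dirichlet_convolution_sums:
  fixes a b :: "nat \<Rightarrow> complex"
  assumes a: "summable (\<lambda>n. norm (a n))" "a 0 = 0" and b: "summable (\<lambda>n. norm (b n))" "b 0 = 0"
  shows "(\<lambda>n. \<Sum>d | d dvd n. a d * b (n div d)) sums (suminf a * suminf b)"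
proof -
  let ?P = "{0<..} :: nat set"
  have on_pos: "(f has_sum c) ?P" if "(f has_sum c) UNIV" "f 0 = 0" for f :: "nat \<Rightarrow> 'a::{comm_monoid_add,topological_space}" and c
    using that(1) by (rule has_sum_cong_neutral[THEN iffD1, rotated -1]) (use that(2) in auto)
  have A: "(a has_sum suminf a) ?P" and B: "(b has_sum suminf b) ?P"
    using a b by (auto intro!: on_pos norm_summable_imp_has_sum summable_sums summable_norm_cancel)
  have nA: "((\<lambda>n. norm (a n)) has_sum (\<Sum>n. norm (a n))) ?P" and nB: "((\<lambda>n. norm (b n)) has_sum (\<Sum>n. norm (b n))) ?P"
    using a b by (auto intro!: on_pos norm_summable_imp_has_sum summable_sums)
  have "(\<lambda>p. norm (a (fst p) * b (snd p))) summable_on (?P \<times> ?P)"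
    by (rule summable_on_SigmaI[where g = "\<lambda>x. norm (a x) * (\<Sum>n. norm (b n))"])
       (auto simp: norm_mult intro!: has_sum_cmult_right nB summable_on_cmult_left has_sum_imp_summable[OF nA])
  then have "((\<lambda>p. a (fst p) * b (snd p)) has_sum (suminf a * suminf b)) (?P \<times> ?P)"
    by (intro has_sum_SigmaI[where g = "\<lambda>x. a x * suminf b"])
       (auto intro!: has_sum_cmult_right has_sum_cmult_left A B abs_summable_summable)
  also have "?this \<longleftrightarrow> ((\<lambda>p. a (snd p) * b (fst p div snd p)) has_sum (suminf a * suminf b)) (SIGMA n:?P. {d. d dvd n})"
    by (rule has_sum_reindex_bij_witness[where i = "\<lambda>(n,d). (d, n div d)" and j = "\<lambda>(d,m). (d*m,d)"])
       (auto simp: dvd_div_eq_0_iff intro!: Nat.gr0I)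
  finally have "((\<lambda>n. \<Sum>d | d dvd n. a d * b (n div d)) has_sum (suminf a * suminf b)) ?P"
    by (rule has_sum_SigmaD) (auto intro!: has_sum_finite)
  then have "((\<lambda>n. \<Sum>d | d dvd n. a d * b (n div d)) has_sum (suminf a * suminf b)) UNIV"
    by (rule has_sum_cong_neutral[THEN iffD1, rotated -1]) auto
  then show ?thesis by (rule has_sum_imp_sums)
qed

definition mangoldt_series :: "complex \<Rightarrow> complex" where
  "mangoldt_series s = (\<Sum>n. mangoldt n * of_nat n powr (-s))"

lemma norm_of_nat_powr: "norm (of_nat n powr s :: complex) = real n powr Re s"
  by (cases "n = 0") (simp_all add: norm_powr_real_powr)

lemma ln_powr_summable:
  assumes "\<sigma> > 1"
  shows "summable (\<lambda>n. ln (real n) * real n powr (-\<sigma>))"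
proof (rule summable_comparison_test'[where N = 1])
  define d where "d = (\<sigma> - 1) / 2"
  show "summable (\<lambda>n. real n powr (- (1 + d)) / d)"
    using assms by (intro summable_divide) (auto simp: summable_real_powr_iff d_def)
  fix n :: nat assume n: "n \<ge> 1"
  have "ln (real n) * real n powr (-\<sigma>) \<le> (real n powr d / d) * real n powr (-\<sigma>)"
    using n assms by (intro mult_right_mono ln_powr_bound) (auto simp: d_def)
  also have "\<dots> = real n powr (- (1 + d)) / d"
  proof -
    have "d + -\<sigma> = - (1 + d)" by (simp add: d_def field_simps)
    then have "real n powr d * real n powr (-\<sigma>) = real n powr (- (1 + d))"
      by (simp only: powr_add[symmetric])
    then show ?thesis by (simp only: times_divide_eq_left)
  qed
  finally show "norm (ln (real n) * real n powr (-\<sigma>)) \<le> real n powr (- (1 + d)) / d"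
    using n by simp
qed

lemma summable_norm_mangoldt:
  assumes "\<sigma> > 1"
  shows "summable (\<lambda>n. mangoldt n * real n powr (-\<sigma>))"
proof (rule summable_comparison_test'[where N = 1])
  show "summable (\<lambda>n. ln (real n) * real n powr (-\<sigma>))" using assms by (rule ln_powr_summable)
  show "norm (mangoldt n * real n powr (-\<sigma>)) \<le> ln (real n) * real n powr (-\<sigma>)" if "n \<ge> 1" for n
    using that mangoldt_le[of n] by (auto simp: abs_mult intro!: mult_right_mono)
qed

lemma mangoldt_series_sums:
  assumes "Re s > 1"
  shows "(\<lambda>n. mangoldt n * of_nat n powr (-s)) sums mangoldt_series s"
  unfolding mangoldt_series_def using summable_norm_mangoldt[OF assms]
  by (intro summable_sums summable_norm_cancel[where f = "\<lambda>n. mangoldt n * of_nat n powr (-s)"])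
     (simp add: norm_mult norm_of_nat_powr)

text \<open>Termwise differentiation gives the coefficients \<open>- ln n\<close>, and
  \<open>ln n\<close> is the sum of \<open>mangoldt d\<close> over the divisors \<open>d\<close> of
  \<open>n\<close>. In the product form no division by \<open>f\<close> occurs, so that nothing
  about its zeros has to be known.\<close>

lemma Dirichlet_logderiv:
  assumes f: "\<And>s. Re s > 1 \<Longrightarrow> (\<lambda>n. 1 / of_nat (Suc n) powr s) sums f s" and s: "Re s > 1"
  shows "(f has_field_derivative - (mangoldt_series s * f s)) (at s)"
proof -
  let ?l = "\<lambda>n. complex_of_real (ln (real (Suc n)))"
  let ?A = "{s::complex. Re s > 1}"
  have op: "open ?A" by (rule open_halfspace_Re_gt)
  have "\<exists>g g'. \<forall>s\<in>?A. (\<lambda>n. of_nat (Suc n) powr (-s)) sums g s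
     \<and> (\<lambda>n. - (?l n * of_nat (Suc n) powr (-s))) sums g' s \<and> (g has_field_derivative g' s) (at s)"
  proof (rule series_and_derivative_comparison_local[OF op])
    fix x :: complex assume x: "x \<in> ?A"
    define d where "d = (Re x - 1) / 2"
    show "\<exists>d h. 0 < d \<and> summable h \<and> (\<forall>\<^sub>F n in sequentially. \<forall>y\<in>ball x d \<inter> ?A. cmod (of_nat (Suc n) powr (-y)) \<le> h n)"
    proof (intro exI conjI always_eventually allI ballI)
      show d: "d > 0" using x by (auto simp: d_def)
      show "summable (\<lambda>n. real (Suc n) powr (- (1 + d)))"
        using d by (subst summable_Suc_iff) (auto simp: summable_real_powr_iff)
      fix n y assume y: "y \<in> ball x d \<inter> ?A"
      have "Re x - d \<le> Re y"
        using y abs_Re_le_cmod[of "x - y"] by (auto simp: dist_norm)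
      then have "real (Suc n) powr (- Re y) \<le> real (Suc n) powr (- (1 + d))"
        by (intro powr_mono) (auto simp: d_def field_simps)
      then show "cmod (of_nat (Suc n) powr (-y)) \<le> real (Suc n) powr (- (1 + d))"
        by (simp add: norm_of_nat_powr del: of_nat_Suc)
    qed
  next
    fix n :: nat and x :: complex
    have der: "((\<lambda>x. of_nat (Suc n) powr (-x)) has_field_derivative of_nat (Suc n) powr (-x) * Ln (of_nat (Suc n)) * (-1)) (at x)"
      using DERIV_chain2[OF has_field_derivative_powr_right[of "of_nat (Suc n)"] DERIV_minus[OF DERIV_ident]]
      by (simp add: mult_ac del: of_nat_Suc)
    have ln: "Ln (of_nat (Suc n)) = ?l n"
      using Ln_of_real[of "real (Suc n)"] by (simp del: of_nat_Suc)
    show "((\<lambda>x. of_nat (Suc n) powr (-x)) has_field_derivative - (?l n * of_nat (Suc n) powr (-x))) (at x)"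
      by (rule DERIV_cong[OF der]) (simp add: ln del: of_nat_Suc)
  qed
  then obtain g g' where *: "\<forall>s\<in>?A. (\<lambda>n. of_nat (Suc n) powr (-s)) sums g s
     \<and> (\<lambda>n. - (?l n * of_nat (Suc n) powr (-s))) sums g' s \<and> (g has_field_derivative g' s) (at s)"
    by blast
  have fg: "f s = g s" if "s \<in> ?A" for s
    using f[of s] *[rule_format, OF that] that by (auto simp: powr_minus inverse_eq_divide sums_iff simp del: of_nat_Suc)
  have "(g has_field_derivative g' s) (at s)" using * s by blast
  then have "(f has_field_derivative g' s) (at s)"
    by (rule has_field_derivative_transform_within_open[OF _ op]) (use s fg in auto)
  moreover have "g' s = - (mangoldt_series s * f s)"
  proof -
    let ?b = "\<lambda>n. of_nat n powr (-s) :: complex"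
    have b: "summable (\<lambda>n. norm (?b n))"
      using s by (simp add: norm_of_nat_powr summable_real_powr_iff)
    have "(\<lambda>n. ?b (Suc n)) sums f s" using * s fg by auto
    then have "?b sums f s" by (subst (asm) sums_Suc_iff) auto
    then have fs: "suminf ?b = f s" by (simp add: sums_iff)
    have "(\<lambda>n. \<Sum>d | d dvd n. (mangoldt d * ?b d) * ?b (n div d)) sums (mangoldt_series s * f s)"
      unfolding mangoldt_series_def fs[symmetric] using summable_norm_mangoldt[OF s]
      by (intro Dirichlet_convolution_sums b) (auto simp: norm_mult norm_of_nat_powr)
    also have "(\<lambda>n. \<Sum>d | d dvd n. (mangoldt d * ?b d) * ?b (n div d)) = (\<lambda>n. of_real (ln (real n)) * ?b n)"
    proof
      fix n :: nat
      show "(\<Sum>d | d dvd n. (mangoldt d * ?b d) * ?b (n div d)) = of_real (ln (real n)) * ?b n"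
      proof (cases "n = 0")
        case False
        have "?b d * ?b (n div d) = ?b n" if "d dvd n" for d
        proof -
          from that obtain m where [simp]: "n = d * m" by auto
          have "?b n = of_real (real d * real m) powr (-s)" by simp
          also have "\<dots> = of_real (real d) powr (-s) * of_real (real m) powr (-s)"
            unfolding of_real_mult by (rule powr_times_real) auto
          finally show ?thesis using False by simp
        qed
        then have "(\<Sum>d | d dvd n. (mangoldt d * ?b d) * ?b (n div d)) = (\<Sum>d | d dvd n. mangoldt d * ?b n)"
          by (intro sum.cong refl) (simp add: mult.assoc)
        also have "\<dots> = of_real (ln (real n)) * ?b n"
          using False mangoldt_sum[of n, where ?'a = complex] by (simp flip: sum_distrib_right)
        finally show ?thesis .
      qed auto
    qed
    finally have "(\<lambda>n. ?l n * ?b (Suc n)) sums (mangoldt_series s * f s)"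
      by (subst sums_Suc_iff) auto
    then have "(\<lambda>n. - (?l n * ?b (Suc n))) sums (- (mangoldt_series s * f s))"
      by (rule sums_minus)
    moreover have "(\<lambda>n. - (?l n * ?b (Suc n))) sums g' s"
      using * s by auto
    ultimately show ?thesis by (rule sums_unique2[symmetric])
  qed
  ultimately show ?thesis by simp
qed

text \<open>By the Leibniz rule the equation expresses each derivative of \<open>f\<close> at
  \<open>p\<close> through lower ones, so that all of them vanish by induction; the identity theorem
  does the rest.\<close>

lemma linear_ode_eq_0:
  assumes A: "open A" "connected A" and f: "f holomorphic_on A" and g: "g holomorphic_on A"
    and ode: "\<And>z. z \<in> A \<Longrightarrow> deriv f z = g z * f z"
    and p: "p \<in> A" "f p = 0" and z: "z \<in> A"
  shows "f z = 0"
proof (rule holomorphic_fun_eq_0_on_connected[OF f A _ p(1) z])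
  show "(deriv ^^ n) f p = 0" for n
  proof (induction n rule: less_induct)
    case (less n)
    show ?case
    proof (cases n)
      case (Suc m)
      have "(deriv ^^ n) f p = (deriv ^^ m) (deriv f) p"
        by (simp add: Suc funpow_swap1)
      also have "\<dots> = (deriv ^^ m) (\<lambda>z. g z * f z) p"
        by (rule higher_deriv_cong_ev)
           (use A p ode in \<open>auto simp: eventually_nhds intro!: exI[of _ A]\<close>)
      also have "\<dots> = (\<Sum>i = 0..m. of_nat (m choose i) * (deriv ^^ i) g p * (deriv ^^ (m - i)) f p)"
        by (rule higher_deriv_mult[OF g f A(1) p(1)])
      also have "\<dots> = 0"
        by (intro sum.neutral ballI) (simp add: less Suc)
      finally show ?thesis .
    qed (use p in auto)
  qed
qed

section \<open>The functional equation\<close>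

text \<open>Stated with values in \<open>ennreal\<close>, like the integrals that follow, so that
  integrals and series may be interchanged without integrability conditions.\<close>

lemma nn_integral_Gamma_scaled:
  assumes a: "a > 0" and x: "(x::real) > 0"
  shows "(\<integral>\<^sup>+t. ennreal (indicator {0<..} t * (t powr (a - 1) * exp (- (x * t)))) \<partial>lborel) = ennreal (Gamma a * x powr (-a))"
proof -
  let ?f = "\<lambda>t. indicator {0<..} t * (t powr (a - 1) * exp (- (x * t)))"
  have "ennreal (Gamma a) = (\<integral>\<^sup>+t. ennreal (indicator {0..} t * t powr (a - 1) / exp t) \<partial>lborel)"
    by (rule Gamma_conv_nn_integral_real[OF a])
  also have "\<dots> = ennreal \<bar>x\<bar> * (\<integral>\<^sup>+t. ennreal (indicator {0..} (0 + x * t) * (0 + x * t) powr (a - 1) / exp (0 + x * t)) \<partial>lborel)"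
    using x by (intro nn_integral_real_affine) auto
  also have "(\<integral>\<^sup>+t. ennreal (indicator {0..} (0 + x * t) * (0 + x * t) powr (a - 1) / exp (0 + x * t)) \<partial>lborel)
     = (\<integral>\<^sup>+t. ennreal (x powr (a - 1)) * ennreal (?f t) \<partial>lborel)"
  proof (intro nn_integral_cong)
    fix t :: real
    show "ennreal (indicator {0..} (0 + x * t) * (0 + x * t) powr (a - 1) / exp (0 + x * t)) = ennreal (x powr (a - 1)) * ennreal (?f t)"
    proof (cases "t > 0")
      case True
      have eq: "indicator {0..} (0 + x * t) * (0 + x * t) powr (a - 1) / exp (0 + x * t) = x powr (a - 1) * ?f t"
        using x True by (simp add: powr_mult exp_minus divide_inverse)
      show ?thesis unfolding eq by (rule ennreal_mult') simp
    next
      case False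
      then show ?thesis using x by (cases "t = 0") (auto simp: indicator_def zero_le_mult_iff)
    qed
  qed
  also have "\<dots> = ennreal (x powr (a - 1)) * (\<integral>\<^sup>+t. ennreal (?f t) \<partial>lborel)"
    by (rule nn_integral_cmult) simp
  also have "ennreal \<bar>x\<bar> * (ennreal (x powr (a - 1)) * (\<integral>\<^sup>+t. ennreal (?f t) \<partial>lborel))
    = ennreal (x powr a) * (\<integral>\<^sup>+t. ennreal (?f t) \<partial>lborel)"
    using x by (simp add: powr_mult_base mult.assoc[symmetric] flip: ennreal_mult)
  finally have eq: "ennreal (Gamma a) = ennreal (x powr a) * (\<integral>\<^sup>+t. ennreal (?f t) \<partial>lborel)" .
  have "ennreal (Gamma a * x powr (-a)) = ennreal (x powr (-a)) * ennreal (Gamma a)"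
    using a by (subst ennreal_mult[symmetric]) (auto simp: mult.commute)
  also have "\<dots> = (ennreal (x powr (-a)) * ennreal (x powr a)) * (\<integral>\<^sup>+t. ennreal (?f t) \<partial>lborel)"
    unfolding eq by (simp add: mult.assoc)
  also have "ennreal (x powr (-a)) * ennreal (x powr a) = 1"
    using x by (simp flip: ennreal_mult powr_add)
  finally show ?thesis by simp
qed

text \<open>The substitution \<open>v = u * t ^ 2\<close> in the Gamma integral at
  \<open>(s + 1) / 2\<close>.\<close>

lemma nn_integral_powr_exp_square:
  assumes s: "s > -1" and u: "(u::real) > 0"
  shows "(\<integral>\<^sup>+t. ennreal (indicator {0<..} t * (t powr s * exp (- (u * t\<^sup>2)))) \<partial>lborel)
    = ennreal (Gamma ((s + 1) / 2) * u powr (- ((s + 1) / 2)) / 2)"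
proof -
  define b where "b = (s + 1) / 2"
  have b: "b > 0" using s by (simp add: b_def)
  define f where "f v = v powr (b - 1) / exp v" for v :: real
  let ?g = "\<lambda>t. u * t\<^sup>2"
  have img: "?g ` {0..} = {0..}"
  proof (intro equalityI subsetI)
    fix v :: real assume "v \<in> {0..}"
    then have "v = ?g (sqrt (v / u))" using u by simp
    then show "v \<in> ?g ` {0..}" using \<open>v \<in> {0..}\<close> u by (intro image_eqI[where x = "sqrt (v / u)"]) auto
  qed (use u in auto)
  have inj: "inj_on ?g {0..}" using u by (auto simp: inj_on_def)
  have der: "(?g has_field_derivative 2 * u * x) (at x within {0..})" for x
    by (auto intro!: derivative_eq_intros)
  have "(f has_integral Gamma b) {0..}"
    unfolding f_def by (rule Gamma_integral_real[OF b])
  then have "f absolutely_integrable_on {0..} \<and> integral {0..} f = Gamma b"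
    by (auto simp: f_def intro!: nonnegative_absolutely_integrable_1 integral_unique)
  then have "(\<lambda>t. \<bar>2 * u * t\<bar> * f (?g t)) absolutely_integrable_on {0..} \<and>
       integral {0..} (\<lambda>t. \<bar>2 * u * t\<bar> * f (?g t)) = Gamma b"
    using has_absolute_integral_change_of_variables_1'[where S = "{0..}" and g = ?g and g' = "\<lambda>t. 2 * u * t" and f = f and b = "Gamma b"] img
      der inj by simp
  then have "((\<lambda>t. \<bar>2 * u * t\<bar> * f (?g t)) has_integral Gamma b) {0..}"
    by (simp add: absolutely_integrable_on_def has_integral_iff)
  then have "((\<lambda>t. (\<bar>2 * u * t\<bar> * f (?g t)) * (u powr (-b) / 2)) has_integral Gamma b * (u powr (-b) / 2)) {0..}"
    by (rule has_integral_mult_left)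
  then have "(\<integral>\<^sup>+t. ennreal (indicator {0..} t * ((\<bar>2 * u * t\<bar> * f (?g t)) * (u powr (-b) / 2))) \<partial>lborel) = ennreal (Gamma b * (u powr (-b) / 2))"
    by (intro nn_integral_has_integral_lebesgue) (auto simp: f_def)
  also have "(\<lambda>t. indicator {0..} t * ((\<bar>2 * u * t\<bar> * f (?g t)) * (u powr (-b) / 2)))
    = (\<lambda>t. indicator {0<..} t * (t powr s * exp (- (u * t\<^sup>2))))"
  proof
    fix t :: real
    have "(2 * u * t * f (?g t)) * (u powr (-b) / 2) = t powr s * exp (- (u * t\<^sup>2))" if t: "t > 0"
    proof -
      have "t\<^sup>2 powr (b - 1) = t powr (2 * (b - 1))"
      proof -
        have "t\<^sup>2 = t powr 2" using t by simp
        then show ?thesis by (simp only: powr_powr)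
      qed
      then have "f (?g t) = u powr (b - 1) * t powr (2 * b - 2) * exp (- (u * t\<^sup>2))"
        using t u by (simp add: f_def powr_mult exp_minus field_simps)
      then have "(2 * u * t * f (?g t)) * (u powr (-b) / 2) =
        (u * u powr (b - 1) * u powr (-b)) * (t * t powr (2 * b - 2)) * exp (- (u * t\<^sup>2))"
        by simp
      also have "u * u powr (b - 1) * u powr (-b) = 1"
        using u by (simp add: powr_mult_base flip: powr_add)
      also have "t * t powr (2 * b - 2) = t powr s"
      proof -
        have "1 + (2 * b - 2) = s" by (simp add: b_def field_simps)
        then show ?thesis using t by (simp add: powr_mult_base)
      qed
      finally show ?thesis by simp
    qed
    then show "indicator {0..} t * ((\<bar>2 * u * t\<bar> * f (?g t)) * (u powr (-b) / 2)) = indicator {0<..} t * (t powr s * exp (- (u * t\<^sup>2)))"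
      using u by (cases "t > 0") (auto simp: indicator_def)
  qed
  finally show ?thesis by (simp add: b_def)
qed

lemma Gamma_reflection_real: "Gamma x * Gamma (1 - x) = pi / sin (pi * x)" for x :: real
proof -
  have "complex_of_real (Gamma x * Gamma (1 - x)) = Gamma (of_real x) * Gamma (1 - of_real x)"
    by (simp flip: Gamma_complex_of_real)
  also have "\<dots> = of_real (pi / sin (pi * x))"
    unfolding Gamma_reflection_complex by (simp flip: sin_of_real)
  finally show ?thesis by (simp only: of_real_eq_iff)
qed

text \<open>The denominator is written as the integral of
  \<open>exp (- ((t ^ 2 + a ^ 2) * u))\<close> over \<open>u > 0\<close>. After the exchange both
  integrals are Gamma integrals, at \<open>b = (s + 1) / 2\<close> and at \<open>1 - b\<close>, and
  the reflection formula evaluates their product.\<close>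

lemma nn_integral_powr_div_square_plus:
  assumes s: "-1 < s" "s < 1" and a: "a > (0::real)"
  shows "(\<integral>\<^sup>+t. ennreal (indicator {0<..} t * (t powr s / (t\<^sup>2 + a\<^sup>2))) \<partial>lborel)
    = ennreal (pi * a powr (s - 1) / (2 * cos (pi * s / 2)))"
proof -
  let ?F = "\<lambda>t u. ennreal (indicator {0<..} t * t powr s) * ennreal (indicator {0<..} u * (u powr (1 - 1) * exp (- ((t\<^sup>2 + a\<^sup>2) * u))))"
  define b where "b = (s + 1) / 2"
  have b: "b > 0" "b < 1" using s by (auto simp: b_def)
  have "(\<integral>\<^sup>+t. ennreal (indicator {0<..} t * (t powr s / (t\<^sup>2 + a\<^sup>2))) \<partial>lborel)
    = (\<integral>\<^sup>+t. (\<integral>\<^sup>+u. ?F t u \<partial>lborel) \<partial>lborel)"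
  proof (intro nn_integral_cong)
    fix t :: real
    have pos: "t\<^sup>2 + a\<^sup>2 > 0" using a by (simp add: add_nonneg_pos)
    show "ennreal (indicator {0<..} t * (t powr s / (t\<^sup>2 + a\<^sup>2))) = (\<integral>\<^sup>+u. ?F t u \<partial>lborel)"
      using pos by (subst nn_integral_cmult, simp, subst nn_integral_Gamma_scaled)
        (auto simp: powr_minus divide_inverse simp flip: ennreal_mult)
  qed
  also have "\<dots> = (\<integral>\<^sup>+u. (\<integral>\<^sup>+t. ?F t u \<partial>lborel) \<partial>lborel)"
    by (rule lborel_pair.Fubini'[symmetric]) measurable
  also have "\<dots> = (\<integral>\<^sup>+u. ennreal (Gamma b / 2) * ennreal (indicator {0<..} u * (u powr ((1 - b) - 1) * exp (- (a\<^sup>2 * u)))) \<partial>lborel)"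
  proof (intro nn_integral_cong)
    fix u :: real
    show "(\<integral>\<^sup>+t. ?F t u \<partial>lborel)
      = ennreal (Gamma b / 2) * ennreal (indicator {0<..} u * (u powr ((1 - b) - 1) * exp (- (a\<^sup>2 * u))))"
    proof (cases "u > 0")
      case True
      have "(\<integral>\<^sup>+t. ?F t u \<partial>lborel)
        = (\<integral>\<^sup>+t. ennreal (exp (- (a\<^sup>2 * u))) * ennreal (indicator {0<..} t * (t powr s * exp (- (u * t\<^sup>2)))) \<partial>lborel)"
      proof (intro nn_integral_cong)
        fix t :: real
        have "exp (- ((t\<^sup>2 + a\<^sup>2) * u)) = exp (- (a\<^sup>2 * u)) * exp (- (u * t\<^sup>2))"
          by (simp add: algebra_simps flip: exp_add)
        then show "?F t u
          = ennreal (exp (- (a\<^sup>2 * u))) * ennreal (indicator {0<..} t * (t powr s * exp (- (u * t\<^sup>2))))"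
          using True by (simp add: mult_ac flip: ennreal_mult)
      qed
      also have "\<dots> = ennreal (exp (- (a\<^sup>2 * u))) * ennreal (Gamma b * u powr (-b) / 2)"
        unfolding b_def using True s by (subst nn_integral_cmult, simp, subst nn_integral_powr_exp_square) auto
      also have "\<dots> = ennreal (Gamma b / 2) * ennreal (indicator {0<..} u * (u powr ((1 - b) - 1) * exp (- (a\<^sup>2 * u))))"
        using True b by (subst (1 2) ennreal_mult[symmetric]) auto
      finally show ?thesis .
    qed auto
  qed
  also have "\<dots> = ennreal (Gamma b / 2) * ennreal (Gamma (1 - b) * a\<^sup>2 powr (-(1 - b)))"
    using a b by (subst nn_integral_cmult, simp, subst nn_integral_Gamma_scaled) auto
  also have "\<dots> = ennreal ((Gamma b * Gamma (1 - b)) * a\<^sup>2 powr (-(1 - b)) / 2)"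
    using b by (subst ennreal_mult[symmetric]) (auto simp: mult_ac)
  also have "Gamma b * Gamma (1 - b) = pi / sin (pi * b)" by (rule Gamma_reflection_real)
  also have "sin (pi * b) = cos (pi * s / 2)"
  proof -
    have "pi / 2 - pi * b = - (pi * s / 2)" by (simp add: b_def field_simps)
    then show ?thesis using sin_cos_eq[of "pi * b"] by (simp only: of_real_eq_id id_apply cos_minus)
  qed
  also have "a\<^sup>2 powr (-(1 - b)) = a powr (s - 1)"
  proof -
    have "2 * (- (1 - b)) = s - 1" by (simp add: b_def field_simps)
    moreover have "a\<^sup>2 = a powr 2" using a by simp
    ultimately show ?thesis by (simp only: powr_powr)
  qed
  finally show ?thesis by (simp add: mult.commute)
qed

text \<open>Logarithmic differentiation of
  \<open>rGamma z * rGamma (- z) = - z * sin (pi * z) / pi\<close>. The left side yields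
  \<open>Digamma (- z) - Digamma z\<close>, whose defining series are partial fractions; the right
  side yields \<open>1 / z + pi * cot (pi * z)\<close>.\<close>

lemma pi_cot_partial_fractions:
  fixes z :: complex
  assumes z: "z \<notin> \<int>"
  shows "(\<lambda>k. 2 * z / (z\<^sup>2 - (of_nat (Suc k))\<^sup>2)) sums (of_real pi * cot (of_real pi * z) - 1 / z)"
proof -
  have z0: "z \<noteq> 0" using z by auto
  have nz: "z \<notin> \<int>\<^sub>\<le>\<^sub>0" "- z \<notin> \<int>\<^sub>\<le>\<^sub>0" using z by (auto dest: nonpos_Ints_Int)
  have sin: "sin (of_real pi * z) \<noteq> 0"
    using z by (auto simp: sin_eq_0 mult.commute)
  have d1: "((\<lambda>z. rGamma z * rGamma (- z)) has_field_derivative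
     (rGamma z * rGamma (-z)) * (Digamma (-z) - Digamma z)) (at z)"
    using nz by (auto intro!: derivative_eq_intros has_field_derivative_rGamma_no_nonpos_int[THEN DERIV_chain2] simp: algebra_simps)
  have eq: "(\<lambda>z::complex. rGamma z * rGamma (- z)) = (\<lambda>z. - (z * sin (of_real pi * z)) / of_real pi)"
    by (simp add: rGamma_reflection_complex')
  have d2: "((\<lambda>z. - (z * sin (of_real pi * z)) / of_real pi) has_field_derivative
      (- (sin (of_real pi * z) + z * (of_real pi * cos (of_real pi * z))) / of_real pi)) (at z)"
    by (rule derivative_eq_intros refl | simp add: field_simps)+
  have "- (z * sin (of_real pi * z)) / of_real pi * (Digamma (-z) - Digamma z)
     = - (sin (of_real pi * z) + z * (of_real pi * cos (of_real pi * z))) / of_real pi"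
    using DERIV_unique[OF d1[unfolded eq] d2] fun_cong[OF eq, of z] by simp
  then have "- (z * sin (of_real pi * z) * (Digamma (-z) - Digamma z)) / of_real pi
     = - (sin (of_real pi * z) + z * (of_real pi * cos (of_real pi * z))) / of_real pi"
    by (simp only: mult_minus_left times_divide_eq_left)
  then have "z * sin (of_real pi * z) * (Digamma (-z) - Digamma z) = sin (of_real pi * z) + z * (of_real pi * cos (of_real pi * z))"
    by (simp only: divide_cancel_right neg_equal_iff_equal of_real_eq_0_iff pi_neq_zero simp_thms)
  then have dig: "Digamma (-z) - Digamma z = 1 / z + of_real pi * cot (of_real pi * z)"
    using z0 sin by (simp add: cot_def field_simps)
  have "(\<lambda>k. (inverse (of_nat (Suc k)) - inverse (-z + of_nat k)) - (inverse (of_nat (Suc k)) - inverse (z + of_nat k)))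
    sums ((Digamma (-z) + euler_mascheroni) - (Digamma z + euler_mascheroni))"
    using summable_Digamma[of z] summable_Digamma[of "-z"] z0
    by (intro sums_diff) (auto simp: Digamma_def summable_sums)
  then have "(\<lambda>k. inverse (z + of_nat k) - inverse (-z + of_nat k)) sums (1 / z + of_real pi * cot (of_real pi * z))"
    using dig by (simp add: algebra_simps)
  then have "(\<lambda>k. inverse (z + of_nat (Suc k)) - inverse (-z + of_nat (Suc k))) sums (1 / z + of_real pi * cot (of_real pi * z) - (inverse (z + of_nat 0) - inverse (-z + of_nat 0)))"
    by (subst sums_Suc_iff) auto
  also have "1 / z + of_real pi * cot (of_real pi * z) - (inverse (z + of_nat 0) - inverse (-z + of_nat 0)) = of_real pi * cot (of_real pi * z) - 1 / z"
    using z0 by (simp add: field_simps)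
  also have "(\<lambda>k. inverse (z + of_nat (Suc k)) - inverse (-z + of_nat (Suc k))) = (\<lambda>k. 2 * z / (z\<^sup>2 - (of_nat (Suc k))\<^sup>2))"
  proof
    fix k
    have "z + of_nat (Suc k) \<noteq> 0" "-z + of_nat (Suc k) \<noteq> 0"
      using z Ints_of_nat[of "Suc k"] by (metis Ints_minus add.inverse_inverse add_eq_0_iff)+
    moreover have "z\<^sup>2 - (of_nat (Suc k))\<^sup>2 = - ((z + of_nat (Suc k)) * (-z + of_nat (Suc k)))"
      by (simp add: power2_eq_square algebra_simps del: of_nat_Suc)
    ultimately show "inverse (z + of_nat (Suc k)) - inverse (-z + of_nat (Suc k)) = 2 * z / (z\<^sup>2 - (of_nat (Suc k))\<^sup>2)"
      by (simp add: divide_simps del: of_nat_Suc)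
  qed
  finally show ?thesis .
qed

text \<open>The quotient on the right is \<open>coth (t / 2) / 2\<close>. It is the cotangent series
  on the imaginary axis, at \<open>\<i> * t / (2 * pi)\<close>, where all the denominators have one
  sign.\<close>

lemma coth_partial_fractions:
  assumes t: "(t::real) > 0"
  shows "(\<lambda>k. 2 * t / (t\<^sup>2 + (2 * pi * real (Suc k))\<^sup>2)) sums ((1 + exp (-t)) / (2 * (1 - exp (-t))) - 1 / t)"
proof -
  define z where "z = \<i> * of_real (t / (2 * pi))"
  have z: "z \<notin> \<int>"
  proof
    assume "z \<in> \<int>"
    then obtain n :: int where "z = of_int n" by (auto elim: Ints_cases)
    then have "Im z = 0" by simp
    then show False using t by (simp add: z_def)
  qed
  have piz: "of_real pi * z = \<i> * of_real (t / 2)" by (simp add: z_def)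
  define E where "E = exp (t / 2)"
  have E: "E > 1" "exp (-t) = 1 / E\<^sup>2"
    using t by (simp_all add: E_def exp_minus inverse_eq_divide flip: exp_of_nat_mult)
  have e: "exp (\<i> * (\<i> * of_real (t/2))) = of_real (1 / E)" "exp (- (\<i> * (\<i> * of_real (t/2)))) = of_real E"
    unfolding mult.assoc[symmetric] by (simp_all add: E_def exp_minus inverse_eq_divide exp_of_real[symmetric])
  have "sin (\<i> * of_real (t/2)) = \<i> * of_real ((E - 1 / E) / 2)"
    unfolding sin_exp_eq e by (simp add: field_simps)
  moreover have "cos (\<i> * of_real (t/2)) = of_real ((E + 1 / E) / 2)"
    unfolding cos_exp_eq e by (simp add: field_simps)
  moreover have "((E + 1 / E) / 2) / ((E - 1 / E) / 2) = (1 + exp (-t)) / (1 - exp (-t))"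
  proof -
    have "E\<^sup>2 > 1" using E(1) by (simp add: one_less_power)
    then show ?thesis using E(1) unfolding E(2) by (simp add: divide_simps power2_eq_square)
  qed
  ultimately have cot: "cot (of_real pi * z) = - \<i> * of_real ((1 + exp (-t)) / (1 - exp (-t)))"
    unfolding cot_def piz by (metis (no_types, lifting) complex_i_mult_minus divide_divide_eq_left' divide_i mult_minus_left of_real_divide)
  have "(\<lambda>k. 2 * z / (z\<^sup>2 - (of_nat (Suc k))\<^sup>2) * (\<i> / (2 * pi))) sums ((of_real pi * cot (of_real pi * z) - 1 / z) * (\<i> / (2 * pi)))"
    by (intro sums_mult2 pi_cot_partial_fractions z)
  also have "(of_real pi * cot (of_real pi * z) - 1 / z) * (\<i> / (2 * pi)) = of_real ((1 + exp (-t)) / (2 * (1 - exp (-t))) - 1 / t)"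
  proof -
    have "exp (-t) \<noteq> 1" using t by simp
    then show ?thesis unfolding cot unfolding z_def using t by (simp add: field_simps)
  qed
  also have "(\<lambda>k. 2 * z / (z\<^sup>2 - (of_nat (Suc k))\<^sup>2) * (\<i> / (2 * pi))) = (\<lambda>k. of_real (2 * t / (t\<^sup>2 + (2 * pi * real (Suc k))\<^sup>2)))"
  proof
    fix k
    define n where "n = real (Suc k)"
    have pos: "t\<^sup>2 + (2 * pi * n)\<^sup>2 > 0" using t by (simp add: add_pos_nonneg)
    define D where "D = t\<^sup>2 + (2 * pi * n)\<^sup>2"
    have "D \<noteq> 0" using pos D_def by linarith
    have eq: "z\<^sup>2 - (of_nat (Suc k))\<^sup>2 = - of_real (D / (2 * pi)\<^sup>2)"
      by (simp add: D_def z_def n_def power_mult_distrib power_divide add_divide_distrib del: of_nat_Suc)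
    have "2 * z / (z\<^sup>2 - (of_nat (Suc k))\<^sup>2) * (\<i> / (2 * pi)) = of_real (2 * t / D)"
      unfolding eq using \<open>D \<noteq> 0\<close> by (simp add: z_def field_simps power2_eq_square)
    then show "2 * z / (z\<^sup>2 - (of_nat (Suc k))\<^sup>2) * (\<i> / (2 * pi)) = of_real (2 * t / (t\<^sup>2 + (2 * pi * real (Suc k))\<^sup>2))"
      by (simp only: D_def n_def)
  qed
  finally show ?thesis by (simp only: sums_of_real_iff)
qed

section \<open>From the trapezoidal errors to the functional equation on a real interval\<close>

lemma nn_integral_of_has_integral:
  fixes f :: "real \<Rightarrow> real"
  assumes "(f has_integral p) A" "\<And>x. x \<in> A \<Longrightarrow> f x \<ge> 0"
  shows "(\<integral>\<^sup>+x. ennreal (indicator A x * f x) \<partial>lborel) = ennreal p"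
proof -
  have "((\<lambda>x. max 0 (f x)) has_integral p) A"
    using assms(1) by (rule has_integral_eq[rotated]) (auto simp: max_def dest: assms(2))
  then have "(\<integral>\<^sup>+x. ennreal (indicator A x * max 0 (f x)) \<partial>lborel) = ennreal p"
    by (intro nn_integral_has_integral_lebesgue) auto
  also have "(\<lambda>x. indicator A x * max 0 (f x)) = (\<lambda>x. indicator A x * f x)"
    using assms(2) by (auto simp: indicator_def max_def fun_eq_iff dest: antisym)
  finally show ?thesis .
qed

lemma nn_integral_exp_parabola:
  assumes t: "(t::real) > 0"
  shows "(\<integral>\<^sup>+u. ennreal (indicator {0..1} u * (u * (1 - u) * exp (- (u * t)))) \<partial>lborel)
    = ennreal ((1 + exp (-t)) / t\<^sup>2 - 2 * (1 - exp (-t)) / t ^ 3)"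
proof -
  define i where "i = 1 / t"
  let ?A = "\<lambda>u. - exp (- (u * t)) * (u * (1 - u) * i + (1 - 2 * u) * i\<^sup>2 - 2 * i ^ 3)"
  have "((\<lambda>u. u * (1 - u) * exp (- (u * t))) has_integral (?A 1 - ?A 0)) {0..1}"
  proof (rule fundamental_theorem_of_calculus)
    fix u :: real assume "u \<in> {0..1}"
    have "(?A has_field_derivative u * (1 - u) * exp (- (u * t))) (at u within {0..1})"
      by (rule derivative_eq_intros refl)+ (use t in \<open>simp add: i_def field_simps power2_eq_square power3_eq_cube\<close>)
    then show "(?A has_vector_derivative u * (1 - u) * exp (- (u * t))) (at u within {0..1})"
      by (rule has_real_derivative_iff_has_vector_derivative[THEN iffD1])
  qed auto
  moreover have "?A 1 - ?A 0 = (1 + exp (-t)) / t\<^sup>2 - 2 * (1 - exp (-t)) / t ^ 3"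
    using t by (simp add: i_def field_simps power2_eq_square power3_eq_cube)
  ultimately show ?thesis
    by (intro nn_integral_of_has_integral) auto
qed

text \<open>
  For \<open>-1 < s < 0\<close> we have \<open>zeta s = s (s + 1) / 2 * (\<Sum>n. em_integral n s)\<close>, where the term \<open>n = 0\<close>
  equals \<open>1 / 2 + 1 / (s - 1)\<close>. All integrands are nonnegative. Multiplication by \<open>Gamma (s + 2)\<close>
  turns the sum into the integral of \<open>t powr (s - 1) * (coth (t / 2) / 2 - 1 / t)\<close>, up to a factor 2, and
  the partial fractions of \<open>coth\<close> turn this into the series for \<open>zeta (1 - s)\<close>.
\<close>

definition em_integral :: "nat \<Rightarrow> real \<Rightarrow> ennreal" where
  "em_integral n s = (\<integral>\<^sup>+x. ennreal (indicator {real n..real (Suc n)} x * ((x - real n) * (real (Suc n) - x) * x powr (-s - 2))) \<partial>lborel)"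

text \<open>\<open>Gamma (s + 2) * x powr (- s - 2)\<close> is the integral of
  \<open>t powr (s + 1) * exp (- (x * t))\<close>. After the exchange, the shift
  \<open>x = n + u\<close> splits off \<open>exp (-t) ^ n\<close>; the remaining integral over
  \<open>u\<close> does not depend on \<open>n\<close>, so that summation over \<open>n\<close> is a
  geometric series.\<close>

lemma Gamma_times_em_integral:
  assumes s: "-1 < s"
  shows "ennreal (Gamma (s + 2)) * em_integral n s =
    (\<integral>\<^sup>+t. ennreal (indicator {0<..} t * (t powr (s + 1) * exp (-t) ^ n)) *
       (\<integral>\<^sup>+u. ennreal (indicator {0..1} u * (u * (1 - u) * exp (- (u * t)))) \<partial>lborel) \<partial>lborel)"
proof -
  let ?c = "\<lambda>t. \<integral>\<^sup>+u. ennreal (indicator {0..1} u * (u * (1 - u) * exp (- (u * t)))) \<partial>lborel"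
  let ?e = "\<lambda>x t. ennreal (indicator {0<..} t * (t powr (s + 1) * exp (- (x * t))))"
  let ?q = "\<lambda>t. ennreal (indicator {0<..} t * (t powr (s + 1) * exp (-t) ^ n))"
  let ?p = "\<lambda>u t. ennreal (indicator {0..1} u * (u * (1 - u) * exp (- (u * t))))"
  let ?v = "\<lambda>x. ennreal (indicator {real n..real (Suc n)} x * ((x - real n) * (real (Suc n) - x) * x powr (-s - 2)))"
  let ?w = "\<lambda>x. indicator {real n..real (Suc n)} x * ((x - real n) * (real (Suc n) - x))"
  have "ennreal (Gamma (s + 2)) * em_integral n s = (\<integral>\<^sup>+x. ennreal (Gamma (s + 2)) * ?v x \<partial>lborel)"
    unfolding em_integral_def by (rule nn_integral_cmult[symmetric]) simp
  also have "\<dots> = (\<integral>\<^sup>+x. (\<integral>\<^sup>+t. ennreal (?w x) * ?e x t \<partial>lborel) \<partial>lborel)"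
  proof (intro nn_integral_cong)
    fix x :: real
    have w: "?w x \<ge> 0" by (auto simp: indicator_def)
    have G: "(\<integral>\<^sup>+t. ?e x t \<partial>lborel) = ennreal (Gamma (s + 2) * x powr (- s - 2))" if "x > 0"
    proof -
      have "s + 2 - 1 = s + 1" "- (s + 2) = - s - 2" by simp_all
      then show ?thesis using nn_integral_Gamma_scaled[of "s + 2" x] s that by (simp only:)
    qed
    have "(\<integral>\<^sup>+t. ennreal (?w x) * ?e x t \<partial>lborel)
      = ennreal (?w x) * (\<integral>\<^sup>+t. ?e x t \<partial>lborel)"
      by (rule nn_integral_cmult) simp
    also have "\<dots> = ennreal (Gamma (s + 2)) * ennreal (?w x * x powr (-s - 2))"
    proof (cases "x > 0")
      case True
      have "ennreal (?w x) * ennreal (Gamma (s + 2) * x powr (- s - 2)) = ennreal (?w x * (Gamma (s + 2) * x powr (- s - 2)))"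
        using w by (rule ennreal_mult'[symmetric])
      moreover have "ennreal (Gamma (s + 2)) * ennreal (?w x * x powr (- s - 2)) = ennreal (Gamma (s + 2) * (?w x * x powr (- s - 2)))"
        using s by (intro ennreal_mult'[symmetric]) simp
      ultimately show ?thesis unfolding G[OF True] by (simp only: mult.left_commute)
    next
      case False
      then have w0: "?w x = 0" by (cases "x = 0") (auto simp: indicator_def)
      show ?thesis unfolding w0 by simp
    qed
    finally show "ennreal (Gamma (s + 2)) * ?v x
      = (\<integral>\<^sup>+t. ennreal (?w x) * ?e x t \<partial>lborel)"
      by (simp add: mult.assoc)
  qed
  also have "\<dots> = (\<integral>\<^sup>+t. (\<integral>\<^sup>+x. ennreal (?w x) * ?e x t \<partial>lborel) \<partial>lborel)"
    by (rule lborel_pair.Fubini'[symmetric]) measurable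
  also have "\<dots> = (\<integral>\<^sup>+t. ?q t *
       ?c t \<partial>lborel)"
  proof (intro nn_integral_cong)
    fix t :: real
    have "(\<integral>\<^sup>+x. ennreal (?w x) * ?e x t \<partial>lborel)
      = ennreal \<bar>1\<bar> * (\<integral>\<^sup>+u. ennreal (?w (real n + 1 * u)) * ?e (real n + 1 * u) t \<partial>lborel)"
      by (rule nn_integral_real_affine) auto
    also have "(\<integral>\<^sup>+u. ennreal (?w (real n + 1 * u)) * ?e (real n + 1 * u) t \<partial>lborel)
      = (\<integral>\<^sup>+u. ?q t * ?p u t \<partial>lborel)"
    proof (intro nn_integral_cong)
      fix u :: real
      have "exp (- ((real n + 1 * u) * t)) = exp (-t) ^ n * exp (- (u * t))"
        by (simp add: algebra_simps flip: exp_add exp_of_nat_mult)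
      then show "ennreal (?w (real n + 1 * u)) * ?e (real n + 1 * u) t
        = ?q t * ?p u t"
        by (auto simp: indicator_def mult_ac simp flip: ennreal_mult)
    qed
    also have "\<dots> = ?q t * ?c t"
      by (rule nn_integral_cmult) simp
    finally show "(\<integral>\<^sup>+x. ennreal (?w x) * ?e x t \<partial>lborel)
      = ?q t *
       ?c t"
      by simp
  qed
  finally show ?thesis .
qed

lemma Gamma_times_suminf_em_integral:
  assumes s: "-1 < s" "s < 1"
  shows "(\<Sum>n. ennreal (Gamma (s + 2)) * em_integral n s) =
    (\<Sum>k. ennreal (2 * pi * (2 * pi * real (Suc k)) powr (s - 1) / cos (pi * s / 2)))"
proof -
  let ?r = "\<lambda>k t. t powr s / (t\<^sup>2 + (2 * pi * real (Suc k))\<^sup>2)"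
  let ?q = "\<lambda>n t. ennreal (indicator {0<..} t * (t powr (s + 1) * exp (-t) ^ n))"
  let ?c = "\<lambda>t. \<integral>\<^sup>+u. ennreal (indicator {0..1} u * (u * (1 - u) * exp (- (u * t)))) \<partial>lborel"
  have "(\<Sum>n. ennreal (Gamma (s + 2)) * em_integral n s) =
    (\<integral>\<^sup>+t. (\<Sum>n. ?q n t * ?c t) \<partial>lborel)"
    using s by (subst nn_integral_suminf) (auto simp: Gamma_times_em_integral)
  also have "\<dots> = (\<integral>\<^sup>+t. (\<Sum>k. ennreal 4 * ennreal (indicator {0<..} t * ?r k t)) \<partial>lborel)"
  proof (intro nn_integral_cong)
    fix t :: real
    show "(\<Sum>n. ?q n t * ?c t)
      = (\<Sum>k. ennreal 4 * ennreal (indicator {0<..} t * ?r k t))"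
    proof (cases "t > 0")
      case True
      define c where "c = (1 + exp (-t)) / t\<^sup>2 - 2 * (1 - exp (-t)) / t ^ 3"
      have e: "exp (-t) < 1" using True by simp
      \<comment> \<open>The factor \<open>t powr s * (2 / t)\<close> is what makes the hyperbolic
        cotangent agree with the geometric series times \<open>c\<close>.\<close>
      have "(\<lambda>k. 2 * t / (t\<^sup>2 + (2 * pi * real (Suc k))\<^sup>2) * (t powr s * (2 / t))) sums
        (((1 + exp (-t)) / (2 * (1 - exp (-t))) - 1 / t) * (t powr s * (2 / t)))"
        using True by (intro sums_mult2 coth_partial_fractions)
      also have "((1 + exp (-t)) / (2 * (1 - exp (-t))) - 1 / t) * (t powr s * (2 / t)) = (t * t powr s) / (1 - exp (-t)) * c"
        using True e unfolding c_def by (simp add: divide_simps power2_eq_square power3_eq_cube)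
      also have "t * t powr s = t powr (s + 1)" using True by (simp add: powr_mult_base add.commute)
      also have "(\<lambda>k. 2 * t / (t\<^sup>2 + (2 * pi * real (Suc k))\<^sup>2) * (t powr s * (2 / t))) = (\<lambda>k. 4 * ?r k t)"
        using True by auto
      finally have sums: "(\<lambda>k. 4 * ?r k t) sums (t powr (s + 1) / (1 - exp (-t)) * c)" .
      \<comment> \<open>The sign is read off from the series, whose terms are nonnegative, and not
        from the formula for \<open>c\<close>, where the leading terms cancel for small
        \<open>t\<close>.\<close>
      have c: "c \<ge> 0"
      proof -
        have "0 \<le> t powr (s + 1) / (1 - exp (-t)) * c"
          using sums_le[OF _ sums_zero sums] by simp
        moreover have "t powr (s + 1) / (1 - exp (-t)) > 0" using True e by simp
        ultimately show ?thesis using mult_pos_neg[of "t powr (s + 1) / (1 - exp (-t))" c] by fastforce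
      qed
      have "(\<lambda>n. t powr (s + 1) * exp (-t) ^ n * c) sums (t powr (s + 1) * (1 / (1 - exp (-t))) * c)"
        using e by (intro sums_mult sums_mult2 geometric_sums) auto
      then have "(\<Sum>n. ennreal (t powr (s + 1) * exp (-t) ^ n * c)) = ennreal (t powr (s + 1) / (1 - exp (-t)) * c)"
        using c by (intro suminf_ennreal_eq) auto
      also have "\<dots> = (\<Sum>k. ennreal (4 * ?r k t))"
        using sums by (intro suminf_ennreal_eq[symmetric]) auto
      finally show ?thesis
        unfolding nn_integral_exp_parabola[OF True] c_def[symmetric]
        using True c by (simp add: ennreal_mult[symmetric] ennreal_mult''[symmetric] del: ennreal_numeral)
    qed auto
  qed
  also have "\<dots> = (\<Sum>k. ennreal 4 * (\<integral>\<^sup>+t. ennreal (indicator {0<..} t * ?r k t) \<partial>lborel))"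
    by (subst nn_integral_suminf, measurable) (intro suminf_cong nn_integral_cmult, measurable)
  also have "\<dots> = (\<Sum>k. ennreal (2 * pi * (2 * pi * real (Suc k)) powr (s - 1) / cos (pi * s / 2)))"
  proof (intro suminf_cong)
    fix k
    have "ennreal 4 * ennreal (pi * (2 * pi * real (Suc k)) powr (s - 1) / (2 * cos (pi * s / 2)))
      = ennreal (4 * (pi * (2 * pi * real (Suc k)) powr (s - 1) / (2 * cos (pi * s / 2))))"
      by (rule ennreal_mult'[symmetric]) simp
    then show "ennreal 4 * (\<integral>\<^sup>+t. ennreal (indicator {0<..} t * ?r k t) \<partial>lborel)
      = ennreal (2 * pi * (2 * pi * real (Suc k)) powr (s - 1) / cos (pi * s / 2))"
      using s by (subst nn_integral_powr_div_square_plus) (auto simp: mult_ac)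
  qed
  finally show ?thesis .
qed

lemma em_integral_eq:
  assumes n: "n \<ge> 1" and s: "s \<noteq> 1"
  shows "\<exists>p\<ge>0. em_integral n s = ennreal p \<and> em_term n (of_real s) = of_real (s * (s + 1) / 2 * p)"
proof -
  define f where "f x = (x - real n) * (real (Suc n) - x) * x powr (-s - 2)" for x
  have "continuous_on {real n..real (Suc n)} f"
    unfolding f_def using n by (intro continuous_intros) auto
  then have int: "(f has_integral integral {real n..real (Suc n)} f) {real n..real (Suc n)}"
    by (intro integrable_integral integrable_continuous_real)
  define p where "p = integral {real n..real (Suc n)} f"
  have nonneg: "f x \<ge> 0" if "x \<in> {real n..real (Suc n)}" for x using that by (auto simp: f_def)
  have "p \<ge> 0" unfolding p_def by (rule integral_nonneg) (use int nonneg in auto)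
  moreover have "em_integral n s = ennreal p"
    unfolding em_integral_def using nn_integral_of_has_integral[OF int nonneg] by (simp add: f_def p_def)
  moreover have "((\<lambda>x. of_real (f x) * of_real (s * (s + 1) / 2)) has_integral (of_real p * of_real (s * (s + 1) / 2) :: complex)) {real n..real (Suc n)}"
    unfolding p_def by (intro has_integral_mult_left has_integral_of_real int)
  then have hi: "((\<lambda>x. of_real ((x - real n) * (real (Suc n) - x)) * (of_real s * (of_real s + 1)) * of_real x powr (-of_real s - 2) / 2)
     has_integral (of_real p * of_real (s * (s + 1) / 2) :: complex)) {real n..real (Suc n)}"
  proof (rule has_integral_eq[rotated])
    fix x assume x: "x \<in> {real n..real (Suc n)}"
    have "of_real x powr (- of_real s - 2) = (of_real (x powr (-s - 2)) :: complex)"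
      using x n powr_of_real[of x "-s - 2"] by simp
    then show "of_real (f x) * of_real (s * (s + 1) / 2) = of_real ((x - real n) * (real (Suc n) - x)) * (of_real s * (of_real s + 1)) * (of_real x powr (-of_real s - 2) :: complex) / 2"
      by (simp add: f_def del: of_nat_Suc)
  qed
  have "em_term n (of_real s) = of_real p * of_real (s * (s + 1) / 2)"
    by (rule has_integral_unique[OF has_integral_em_term hi]) (use n s in auto)
  ultimately show ?thesis by (intro exI[of _ p]) (auto simp: mult.commute)
qed

text \<open>This is where \<open>s < 0\<close> enters: it makes \<open>x powr (- s - 1)\<close>
  integrable at 0 and the antiderivative \<open>F\<close> continuous there. The constants of
  \<open>zeta1\<close> thereby become the first term of one nonnegative series.\<close>

lemma em_integral_0:
  assumes s: "-1 < s" "s < 0"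
  shows "\<exists>p\<ge>0. em_integral 0 s = ennreal p \<and> 1 / 2 + 1 / (s - 1) = s * (s + 1) / 2 * p"
proof -
  define F where "F x = (- 1 / s) * x powr (-s) - (1 / (1 - s)) * x powr (1 - s)" for x :: real
  have "((\<lambda>x. x * (1 - x) * x powr (-s - 2)) has_integral (F 1 - F 0)) {0..1}"
  proof (rule fundamental_theorem_of_calculus_interior)
    show "continuous_on {0..1} F"
      unfolding F_def using s by (intro continuous_intros continuous_on_powr') auto
    fix x :: real assume x: "x \<in> {0<..<1}"
    have "(F has_field_derivative x powr (-s - 1) - x powr (- s)) (at x)"
    proof (rule DERIV_cong)
      show "(F has_field_derivative (- 1 / s) * (-s * x powr (-s - 1)) - (1 / (1 - s)) * ((1 - s) * x powr (1 - s - 1))) (at x)"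
        unfolding F_def using x by (intro DERIV_diff DERIV_cmult has_real_derivative_powr) auto
    next
      have e: "1 - s - 1 = -s" by simp
      have "(- 1 / s) * (-s * a) - (1 / (1 - s)) * ((1 - s) * b) = a - b" for a b
        using s by simp
      then show "(- 1 / s) * (-s * x powr (-s - 1)) - (1 / (1 - s)) * ((1 - s) * x powr (1 - s - 1)) = x powr (-s - 1) - x powr (- s)"
        by (simp only: e)
    qed
    also have "x powr (-s - 1) = x * x powr (-s - 2)"
    proof -
      have "-s - 1 = 1 + (-s - 2)" by simp
      then show ?thesis using x by (simp only: powr_add) simp
    qed
    also have "x powr (- s) = x * x * x powr (- s - 2)"
      using x powr_add[of x 2 "-s - 2"] by (simp add: power2_eq_square)
    finally show "(F has_vector_derivative x * (1 - x) * x powr (-s - 2)) (at x)"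
      by (simp add: algebra_simps has_real_derivative_iff_has_vector_derivative)
  qed auto
  then have "em_integral 0 s = ennreal (F 1 - F 0)"
    using nn_integral_of_has_integral[of "\<lambda>x. x * (1 - x) * x powr (-s - 2)" "F 1 - F 0" "{0..1}"]
    by (simp add: em_integral_def)
  moreover have F: "F 1 - F 0 = - 1 / s - 1 / (1 - s)" by (simp add: F_def)
  moreover have "- 1 / s - 1 / (1 - s) \<ge> 0" using s by (simp add: field_simps)
  moreover have "1 / 2 + 1 / (s - 1) = s * (s + 1) / 2 * (- 1 / s - 1 / (1 - s))"
    using s by (simp add: divide_simps) (simp add: algebra_simps)
  ultimately show ?thesis by (metis (no_types))
qed

text \<open>The factor \<open>2 powr s * pi powr (s - 1) * Gamma (1 - s) * sin (pi * s / 2)\<close>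
  of Riemann's unsymmetric functional equation.\<close>

definition zeta_chi :: "complex \<Rightarrow> complex" where
  "zeta_chi s = of_real (2 * pi) powr s / of_real pi * Gamma (1 - s) * sin (of_real pi * s / 2)"

text \<open>The right side is the shape in which the integrals produce the factor. The two agree by
  \<open>Gamma (s + 2) = (s + 1) * s * Gamma s\<close>, the reflection formula and the double angle
  formula for the sine.\<close>

lemma zeta_chi_of_real:
  assumes s: "-1 < s" "s < 0"
  shows "zeta_chi (of_real s) = of_real (s * (s + 1) / 2 * (2 * pi * (2 * pi) powr (s - 1) / cos (pi * s / 2)) / Gamma (s + 2))"
proof -
  have nz: "s \<notin> \<int>\<^sub>\<le>\<^sub>0" "s + 1 \<notin> \<int>\<^sub>\<le>\<^sub>0"
    using s by (auto elim!: nonpos_Ints_cases)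
  have G2: "Gamma (s + 2) = (s + 1) * s * Gamma s"
    using Gamma_plus1[of s] Gamma_plus1[of "s + 1"] nz by (simp add: add_ac)
  have cos: "cos (pi * s / 2) > 0"
  proof (rule cos_gt_zero_pi)
    have "pi * (-1) < pi * s" "pi * s < pi * 1" using s by (intro mult_strict_left_mono; simp)+
    then show "- (pi / 2) < pi * s / 2" "pi * s / 2 < pi / 2" by simp_all
  qed
  have sin: "sin (pi * s / 2) \<noteq> 0"
  proof -
    have "pi * (-1) < pi * s" "pi * s < 0" using s by (intro mult_strict_left_mono mult_pos_neg; simp)+
    then show ?thesis using sin_gt_zero[of "- (pi * s / 2)"] by simp
  qed
  have "sin (pi * s) = 2 * sin (pi * s / 2) * cos (pi * s / 2)"
    using sin_double[of "pi * s / 2"] by simp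
  then have "Gamma s * Gamma (1 - s) = pi / (2 * sin (pi * s / 2) * cos (pi * s / 2))"
    using Gamma_reflection_real[of s] by simp
  then have G1: "Gamma (1 - s) * sin (pi * s / 2) = pi / (2 * cos (pi * s / 2) * Gamma s)"
    using sin cos nz Gamma_eq_zero_iff[of s] by (simp add: field_simps)
  have "zeta_chi (of_real s) = of_real ((2 * pi) powr s / pi * (Gamma (1 - s) * sin (pi * s / 2)))"
    using powr_of_real[of "2 * pi" s]
    by (simp add: zeta_chi_def sin_of_real[symmetric] flip: Gamma_complex_of_real)
  also have "(2 * pi) powr s = (2 * pi) * (2 * pi) powr (s - 1)"
    by (simp add: powr_mult_base)
  finally have "zeta_chi (of_real s) = of_real (2 * pi * (2 * pi) powr (s - 1) / pi * (pi / (2 * cos (pi * s / 2) * Gamma s)))"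
    unfolding G1 .
  moreover have "2 * pi * P / pi * (pi / (2 * c * g)) = s * (s + 1) / 2 * (2 * pi * P / c) / ((s + 1) * s * g)"
    if "c \<noteq> 0" "g \<noteq> 0" for P c g :: real
    using that s by (simp add: divide_simps)
  ultimately show ?thesis
    unfolding G2 using cos s nz Gamma_eq_zero_iff[of s] by simp
qed

text \<open>Both values are multiples of series with nonnegative terms: on the left the sum of
  \<open>em_integral n s\<close> over all \<open>n\<close>, on the right the Dirichlet series, which
  converges because \<open>1 - s > 1\<close>. The identity between the sums holds in
  \<open>ennreal\<close> and is pulled back to the reals, since both are finite.\<close>

lemma zeta1_functional_equation_real:
  assumes s: "-1 < s" "s < 0"
  shows "zeta1 (of_real s) = zeta_chi (of_real s) * zeta1 (1 - of_real s)"
proof -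
  let ?c = "s * (s + 1) / 2"
  have "\<exists>p\<ge>0. em_integral (Suc n) s = ennreal p \<and> em_term (Suc n) (of_real s) = of_real (?c * p)" for n
    using s by (intro em_integral_eq) auto
  then obtain q where q: "\<And>n. q n \<ge> 0" "\<And>n. em_integral (Suc n) s = ennreal (q n)"
     "\<And>n. em_term (Suc n) (of_real s) = of_real (?c * q n)" by metis
  obtain r where r: "r \<ge> 0" "em_integral 0 s = ennreal r" "1 / 2 + 1 / (s - 1) = ?c * r"
    using em_integral_0[OF s] by auto
  define p where "p n = (case n of 0 \<Rightarrow> r | Suc n \<Rightarrow> q n)" for n
  have p: "p n \<ge> 0" "em_integral n s = ennreal (p n)" for n
    using q r by (auto simp: p_def split: nat.splits)
  have "summable (\<lambda>n. em_term (Suc n) (of_real s))"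
    using s by (intro summable_em_term) auto
  then have "summable (\<lambda>n. ?c * q n)"
    unfolding q(3) by (simp only: summable_of_real_iff)
  then have sq: "summable q" using s by (subst (asm) summable_cmult_iff) auto
  then have sp: "summable p" by (subst summable_Suc_iff[symmetric]) (simp add: p_def)
  have "of_real (1 / 2 + 1 / (s - 1)) = (1 / 2 + 1 / (of_real s - 1) :: complex)" by simp
  moreover have "(\<Sum>n. em_term (Suc n) (of_real s)) = of_real (?c * (\<Sum>n. q n))"
    unfolding q(3) using sq by (simp only: suminf_of_real[symmetric] suminf_mult summable_mult)
  ultimately have "zeta1 (of_real s) = of_real (?c * r + ?c * (\<Sum>n. q n))"
    unfolding zeta1_def r(3)[symmetric] of_real_add by simp
  also have "?c * r + ?c * (\<Sum>n. q n) = ?c * (\<Sum>n. p n)"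
  proof -
    have "(\<Sum>n. p n) = r + (\<Sum>n. q n)"
      using suminf_split_head[OF sp] by (simp add: p_def[of 0] p_def[of "Suc n" for n])
    then show ?thesis by (simp only: distrib_left)
  qed
  finally have z1: "zeta1 (of_real s) = of_real (?c * (\<Sum>n. p n))" .

  define K where "K = 2 * pi * (2 * pi) powr (s - 1) / cos (pi * s / 2)"
  have K: "K \<ge> 0"
  proof -
    have "pi * (-1) < pi * s" "pi * s < pi * 1" using s by (intro mult_strict_left_mono; simp)+
    then have "cos (pi * s / 2) > 0" by (intro cos_gt_zero_pi) auto
    then show ?thesis by (simp add: K_def)
  qed
  define z where "z = (\<Sum>k. real (Suc k) powr (s - 1))"
  have sz: "(\<lambda>k. real (Suc k) powr (s - 1)) sums z"
    unfolding z_def using s by (intro summable_sums summable_Suc_powr) auto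
  have "(\<lambda>k. 1 / of_nat (Suc k) powr (1 - of_real s)) sums (of_real z :: complex)"
  proof -
    have "1 / of_nat (Suc k) powr (1 - of_real s) = (of_real (real (Suc k) powr (s - 1)) :: complex)" for k
      using powr_of_real[of "real (Suc k)" "s - 1"] powr_minus[of "of_nat (Suc k) :: complex" "1 - of_real s"]
      by (simp add: inverse_eq_divide del: of_nat_Suc)
    then show ?thesis using sums_of_real[OF sz, where ?'a = complex] by (simp only:)
  qed
  moreover have "(\<lambda>k. 1 / of_nat (Suc k) powr (1 - of_real s)) sums zeta1 (1 - of_real s)"
    using s by (intro zeta1_Dirichlet) auto
  ultimately have z: "zeta1 (1 - of_real s) = of_real z" by (rule sums_unique2[symmetric])

  have "ennreal (Gamma (s + 2) * (\<Sum>n. p n)) = (\<Sum>n. ennreal (Gamma (s + 2) * p n))"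
    using p(1) s sp by (intro suminf_ennreal_eq[symmetric] sums_mult summable_sums) auto
  also have "\<dots> = (\<Sum>n. ennreal (Gamma (s + 2)) * em_integral n s)"
    using s by (simp add: p(2) ennreal_mult')
  also have "\<dots> = (\<Sum>k. ennreal (2 * pi * (2 * pi * real (Suc k)) powr (s - 1) / cos (pi * s / 2)))"
    using s by (intro Gamma_times_suminf_em_integral) auto
  also have "\<dots> = (\<Sum>k. ennreal (K * real (Suc k) powr (s - 1)))"
    unfolding K_def by (simp add: powr_mult mult_ac del: of_nat_Suc)
  also have "\<dots> = ennreal (K * z)"
    using K by (intro suminf_ennreal_eq sums_mult sz) auto
  finally have "Gamma (s + 2) * (\<Sum>n. p n) = K * z"
    using K s p(1) sp suminf_nonneg[OF summable_Suc_powr[of "s - 1"]]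
    by (subst (asm) ennreal_inj) (auto intro!: mult_nonneg_nonneg suminf_nonneg Gamma_real_nonneg simp: z_def)
  then have "(\<Sum>n. p n) = K * z / Gamma (s + 2)"
  proof -
    have "Gamma (s + 2) > 0" using s by simp
    then show ?thesis using \<open>Gamma (s + 2) * (\<Sum>n. p n) = K * z\<close> by (simp add: field_simps)
  qed
  then show ?thesis
    unfolding z1 z zeta_chi_of_real[OF s] K_def[symmetric] by simp
qed

lemma holomorphic_zeta_chi: "zeta_chi holomorphic_on {s. Re s < 1}"
proof -
  have "1 - s \<notin> \<int>\<^sub>\<le>\<^sub>0" if "Re s < 1" for s :: complex
    using that by (auto elim!: nonpos_Ints_cases simp: complex_eq_iff)
  then show ?thesis
    unfolding zeta_chi_def[abs_def] by (auto intro!: holomorphic_intros)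
qed

lemma zeta1_functional_equation:
  assumes s: "-1 < Re s" "Re s < 0"
  shows "zeta1 s = zeta_chi s * zeta1 (1 - s)"
proof -
  let ?A = "{s. -1 < Re s} \<inter> {s. Re s < 0}"
  let ?U = "of_real ` {-1<..<0} :: complex set"
  have "zeta1 s - zeta_chi s * zeta1 (1 - s) = 0"
  proof (rule analytic_continuation[where S = ?A and U = ?U and \<xi> = "of_real (-1/2)" and f = "\<lambda>s. zeta1 s - zeta_chi s * zeta1 (1 - s)"])
    show "(\<lambda>s. zeta1 s - zeta_chi s * zeta1 (1 - s)) holomorphic_on ?A"
    proof (intro holomorphic_on_diff holomorphic_on_mult)
      show "zeta1 holomorphic_on ?A" by (rule holomorphic_on_subset[OF holomorphic_zeta1]) auto
      show "zeta_chi holomorphic_on ?A" by (rule holomorphic_on_subset[OF holomorphic_zeta_chi]) auto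
      have "zeta1 \<circ> (\<lambda>s. 1 - s) holomorphic_on ?A"
        by (rule holomorphic_on_compose_gen[OF _ holomorphic_zeta1]) (auto intro!: holomorphic_intros)
      then show "(\<lambda>s. zeta1 (1 - s)) holomorphic_on ?A" by (simp add: o_def)
    qed
    show "open ?A" by (intro open_Int open_halfspace_Re_gt open_halfspace_Re_lt)
    show "connected ?A"
      by (intro convex_connected convex_Int convex_halfspace_Re_gt convex_halfspace_Re_lt)
    show "of_real (-1/2) islimpt ?U"
      unfolding islimpt_approachable
    proof (intro allI impI)
      fix e :: real assume "e > 0"
      define d where "d = min (e / 2) (1 / 4)"
      have d: "d > 0" "d < e" "d < 1 / 2" using \<open>e > 0\<close> by (auto simp: d_def min_def)
      have "dist (of_real (-1/2 + d) :: complex) (of_real (-1/2)) < e"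
        unfolding dist_of_real using d by (simp add: dist_real_def)
      moreover have "of_real (-1/2 + d) \<in> ?U" using d by (intro imageI) auto
      moreover have "of_real (-1/2 + d) \<noteq> (of_real (-1/2) :: complex)" using d by (simp only: of_real_eq_iff)
      ultimately show "\<exists>x'\<in>?U. x' \<noteq> of_real (-1/2) \<and> dist x' (of_real (-1/2)) < e" by blast
    qed
    show "z \<in> ?U \<Longrightarrow> zeta1 z - zeta_chi z * zeta1 (1 - z) = 0" for z
      using zeta1_functional_equation_real by auto
  qed (use s in auto)
  then show ?thesis by simp
qed

section \<open>Continuation to the whole plane, and RH as a zero-free half plane\<close>

definition zeta_glued :: "complex \<Rightarrow> complex" where
  "zeta_glued s = (if Re s > -1 then zeta1 s else zeta_chi s * zeta1 (1 - s))"

lemma zeta_glued_left: "Re s < 0 \<Longrightarrow> zeta_glued s = zeta_chi s * zeta1 (1 - s)"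
  using zeta1_functional_equation[of s] by (auto simp: zeta_glued_def)

text \<open>Existence of what the choice operator in \<open>zeta\<close> selects. The two branches
  live on open sets that overlap in the strip \<open>-1 < Re s < 0\<close>, where the functional
  equation makes them agree.\<close>

lemma zeta_continuation_zeta_glued: "zeta_continuation zeta_glued"
  unfolding zeta_continuation_def
proof (intro conjI allI impI)
  show "(\<lambda>n. 1 / of_nat (Suc n) powr s) sums zeta_glued s" if "Re s > 1" for s
    using zeta1_Dirichlet[OF that] that by (simp add: zeta_glued_def)
  have right: "zeta_glued holomorphic_on {s. Re s > -1} - {1}"
    by (rule holomorphic_transform[OF holomorphic_zeta1]) (auto simp: zeta_glued_def)
  have "(\<lambda>s. zeta_chi s * zeta1 (1 - s)) holomorphic_on {s. Re s < 0}"
  proof (intro holomorphic_on_mult)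
    show "zeta_chi holomorphic_on {s. Re s < 0}" by (rule holomorphic_on_subset[OF holomorphic_zeta_chi]) auto
    have "zeta1 \<circ> (\<lambda>s. 1 - s) holomorphic_on {s. Re s < 0}"
      by (rule holomorphic_on_compose_gen[OF _ holomorphic_zeta1]) (auto intro!: holomorphic_intros)
    then show "(\<lambda>s. zeta1 (1 - s)) holomorphic_on {s. Re s < 0}" by (simp add: o_def)
  qed
  then have left: "zeta_glued holomorphic_on {s. Re s < 0}"
    by (rule holomorphic_transform) (auto simp: zeta_glued_left)
  have "zeta_glued holomorphic_on ({s. Re s > -1} - {1}) \<union> {s. Re s < 0}"
    by (intro holomorphic_on_Un right left open_delete open_halfspace_Re_gt open_halfspace_Re_lt)
  moreover have "({s. Re s > -1} - {1}) \<union> {s. Re s < 0} = - {1::complex}" by auto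
  ultimately show "zeta_glued holomorphic_on - {1}" by simp
qed

lemma zeta_continuation_zeta: "zeta_continuation zeta"
  unfolding zeta_def by (rule someI[of zeta_continuation zeta_glued, OF zeta_continuation_zeta_glued])

lemma zeta_eq_zeta1:
  assumes "Re s > -1" "s \<noteq> 1"
  shows "zeta s = zeta1 s"
  using zeta_continuation_unique[OF zeta_continuation_zeta zeta_continuation_zeta_glued assms(2)] assms(1)
  by (simp add: zeta_glued_def)

lemma holomorphic_zeta: "zeta holomorphic_on - {1}"
  using zeta_continuation_zeta by (simp add: zeta_continuation_def)

lemma zeta_Dirichlet: "Re s > 1 \<Longrightarrow> (\<lambda>n. 1 / of_nat (Suc n) powr s) sums zeta s"
  using zeta_continuation_zeta by (simp add: zeta_continuation_def)

lemma zeta_functional_equation: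
  assumes "Re s < 1" "s \<noteq> 0"
  shows "zeta s = zeta_chi s * zeta (1 - s)"
proof (rule analytic_continuation_open[where s = "{s. Re s < 0}" and s' = "{s. Re s < 1} - {0}" and f = zeta and g = "\<lambda>s. zeta_chi s * zeta (1 - s)"])
  show "{s::complex. Re s < 0} \<noteq> {}" by (auto intro: exI[of _ "-1"])
  show "connected ({s. Re s < 1} - {0::complex})"
    by (intro connected_open_delete open_halfspace_Re_lt convex_connected convex_halfspace_Re_lt) auto
  show "zeta holomorphic_on {s. Re s < 1} - {0}"
    by (rule holomorphic_on_subset[OF holomorphic_zeta]) auto
  show "(\<lambda>s. zeta_chi s * zeta (1 - s)) holomorphic_on {s. Re s < 1} - {0}"
  proof (intro holomorphic_on_mult)
    show "zeta_chi holomorphic_on {s. Re s < 1} - {0}" by (rule holomorphic_on_subset[OF holomorphic_zeta_chi]) auto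
    have "zeta \<circ> (\<lambda>s. 1 - s) holomorphic_on {s. Re s < 1} - {0}"
      by (rule holomorphic_on_compose_gen[OF _ holomorphic_zeta]) (auto intro!: holomorphic_intros)
    then show "(\<lambda>s. zeta (1 - s)) holomorphic_on {s. Re s < 1} - {0}" by (simp add: o_def)
  qed
  fix z :: complex assume "z \<in> {s. Re s < 0}"
  then have z: "Re z < 0" "z \<noteq> 1" "1 - z \<noteq> 1" "Re (1 - z) > -1" by auto
  have "zeta z = zeta_glued z"
    by (rule zeta_continuation_unique[OF zeta_continuation_zeta zeta_continuation_zeta_glued z(2)])
  then show "zeta z = zeta_chi z * zeta (1 - z)"
    using z by (simp add: zeta_glued_left zeta_eq_zeta1)
qed (use assms in \<open>auto intro!: open_delete open_halfspace_Re_lt\<close>)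

text \<open>A zero to the left of the critical line is reflected to \<open>1 - s\<close>, where
  \<open>zeta\<close> does not vanish, so \<open>zeta_chi s\<close> must. As \<open>Gamma\<close>
  has no zeros, the sine vanishes and \<open>s\<close> is an even integer, negative by its real
  part: a trivial zero.\<close>

theorem Riemann_Hypothesis_iff_no_zeros_right:
  "Riemann_Hypothesis \<longleftrightarrow> (\<forall>s. Re s > 1 / 2 \<longrightarrow> s \<noteq> 1 \<longrightarrow> zeta s \<noteq> 0)"
proof
  assume RH: Riemann_Hypothesis
  show "\<forall>s. Re s > 1 / 2 \<longrightarrow> s \<noteq> 1 \<longrightarrow> zeta s \<noteq> 0"
  proof (intro allI impI notI)
    fix s assume s: "Re s > 1 / 2" "s \<noteq> 1" "zeta s = 0"
    then have "\<nexists>n::nat. n \<ge> 1 \<and> s = - 2 * of_nat n" by auto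
    then show False using RH s unfolding Riemann_Hypothesis_def by fastforce
  qed
next
  assume nz: "\<forall>s. Re s > 1 / 2 \<longrightarrow> s \<noteq> 1 \<longrightarrow> zeta s \<noteq> 0"
  show Riemann_Hypothesis
    unfolding Riemann_Hypothesis_def
  proof (intro allI impI)
    fix s assume s: "zeta s = 0 \<and> s \<noteq> 1 \<and> (\<nexists>n::nat. n \<ge> 1 \<and> s = - 2 * of_nat n)"
    have "\<not> Re s < 1 / 2"
    proof
      assume Re: "Re s < 1 / 2"
      have s0: "s \<noteq> 0" using s zeta_eq_zeta1[of 0] zeta1_0 by auto
      have "1 - s \<notin> \<int>\<^sub>\<le>\<^sub>0"
        using Re by (auto elim!: nonpos_Ints_cases simp: complex_eq_iff)
      then have "Gamma (1 - s) \<noteq> 0" by (simp add: Gamma_eq_zero_iff)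
      moreover have "zeta (1 - s) \<noteq> 0" using nz Re s0 by auto
      moreover have "zeta_chi s * zeta (1 - s) = 0"
        using zeta_functional_equation[of s] s s0 Re by auto
      ultimately have "sin (of_real pi * s / 2) = 0" by (auto simp: zeta_chi_def)
      then obtain m :: int where "of_real pi * s / 2 = of_int m * of_real pi"
        by (auto simp: sin_eq_0)
      then have m: "s = 2 * of_int m" by (simp add: field_simps)
      then have "m < 0" using Re s0 by (auto simp: not_less)
      then have "s = - 2 * of_nat (nat (- m))" "nat (- m) \<ge> 1" using m by auto
      then show False using s by blast
    qed
    moreover have "\<not> Re s > 1 / 2" using nz s by auto
    ultimately show "Re s = 1 / 2" by linarith
  qed
qed

section \<open>From the asymptotics of \<open>S k\<close> to a zero-free half plane\<close>

text \<open>The maximum is attained at \<open>y = 2 * b\<close>; the bound is its value there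
  without the factor \<open>exp (- b)\<close>.\<close>

lemma powr_times_exp_bounded:
  fixes b y :: real
  assumes "b > 0" "y \<ge> 0"
  shows "y powr b * exp (- y / 2) \<le> exp (b * ln (2 * b))"
proof (cases "y = 0")
  case False
  with assms have y: "y > 0" by linarith
  have "ln (y / (2 * b)) \<le> y / (2 * b) - 1" using y assms by (intro ln_le_minus_one) auto
  then have "b * ln (y / (2 * b)) \<le> b * (y / (2 * b) - 1)" using assms by (intro mult_left_mono) auto
  then have "b * ln y \<le> y / 2 + b * ln (2 * b) - b" using y assms by (simp add: ln_div algebra_simps)
  then have "b * ln y - y / 2 \<le> b * ln (2 * b)" using assms by linarith
  then have "exp (b * ln y - y / 2) \<le> exp (b * ln (2 * b))" by simp
  moreover have "y powr b * exp (- y / 2) = exp (b * ln y + (- y / 2))"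
    unfolding exp_add using y by (simp add: powr_def)
  ultimately show ?thesis by simp
qed auto

lemma one_minus_exp_bounds:
  assumes "0 \<le> x" "x \<le> (1::real)"
  shows "x / 2 \<le> 1 - exp (-x)" "1 - exp (-x) \<le> x"
proof -
  show "1 - exp (-x) \<le> x" using exp_ge_add_one_self[of "-x"] by linarith
  have "(1 - x / 2) * (1 + x) \<ge> 1"
    using assms mult_left_mono[of x 1 x] by (simp add: algebra_simps)
  then have "1 \<le> (1 - x / 2) * exp x"
    using assms exp_ge_add_one_self[of x] mult_left_mono[of "1 + x" "exp x" "1 - x / 2"] by linarith
  then have "exp (-x) \<le> 1 - x / 2"
    by (simp add: exp_minus field_simps)
  then show "x / 2 \<le> 1 - exp (-x)" by linarith
qed

text \<open>One half of the exponential absorbs the power, the other half leaves a geometric series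
  of ratio \<open>exp (- (d / 2))\<close>, whose sum is at most \<open>4 / d\<close>. The factor
  \<open>exp 1\<close> bounds the \<open>exp d\<close> that comes from passing between
  \<open>Suc n\<close> and \<open>n\<close>.\<close>

lemma suminf_powr_exp_le:
  assumes b: "b > 0" and d: "0 < d" "d \<le> (1::real)"
  shows "summable (\<lambda>n. real (Suc n) powr b * exp (-d) ^ n)"
    and "(\<Sum>n. real (Suc n) powr b * exp (-d) ^ n) \<le> 4 * exp 1 * exp (b * ln (2 * b)) * d powr (-b - 1)"
proof -
  define K where "K = exp 1 * exp (b * ln (2 * b)) * d powr (-b)"
  have le: "real (Suc n) powr b * exp (-d) ^ n \<le> K * exp (-(d / 2)) ^ n" for n
  proof -
    define x where "x = real (Suc n)"
    have "(x * d) powr b * exp (- (x * d) / 2) \<le> exp (b * ln (2 * b))"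
      using b d by (intro powr_times_exp_bounded) (auto simp: x_def)
    then have "(x powr b * exp (- (x * d) / 2)) * d powr b \<le> exp (b * ln (2 * b))"
      using d by (simp only: powr_mult mult_ac)
    then have "x powr b * exp (- (x * d) / 2) \<le> exp (b * ln (2 * b)) / d powr b"
      using d by (subst pos_le_divide_eq) auto
    then have "x powr b * exp (- (x * d) / 2) \<le> exp (b * ln (2 * b)) * d powr (-b)"
      by (simp only: powr_minus_divide times_divide_eq_right mult_1_right)
    then have "(x powr b * exp (- (x * d) / 2)) * (exp (- (x * d) / 2) * exp d) \<le> (exp (b * ln (2 * b)) * d powr (-b)) * (exp (-(d / 2)) ^ n * exp 1)"
    proof (rule mult_mono)
      have "exp (-(x * d) / 2) \<le> exp (-(d / 2)) ^ n"
        using d by (simp add: x_def algebra_simps flip: exp_of_nat_mult)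
      then show "exp (-(x * d) / 2) * exp d \<le> exp (-(d / 2)) ^ n * exp 1"
        using d by (intro mult_mono) auto
    qed auto
    moreover have eq: "exp (- (x * d) / 2) * (exp (- (x * d) / 2) * exp d) = exp (-d) ^ n"
      by (simp add: x_def algebra_simps flip: exp_of_nat_mult exp_add)
    ultimately have "x powr b * exp (-d) ^ n \<le> (exp (b * ln (2 * b)) * d powr (-b)) * (exp (-(d / 2)) ^ n * exp 1)"
      by (simp only: eq mult.assoc)
    then show ?thesis by (simp only: K_def x_def mult_ac)
  qed
  have e: "exp (-(d / 2)) < 1" using d by simp
  have sg: "summable (\<lambda>n. K * exp (-(d / 2)) ^ n)"
    using e by (intro summable_mult summable_geometric) auto
  show summ: "summable (\<lambda>n. real (Suc n) powr b * exp (-d) ^ n)"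
    by (rule summable_comparison_test'[OF sg, of 0]) (use le in auto)
  have "(\<Sum>n. real (Suc n) powr b * exp (-d) ^ n) \<le> (\<Sum>n. K * exp (-(d / 2)) ^ n)"
    by (intro suminf_le le summ sg)
  also have "\<dots> = K * (1 / (1 - exp (-(d / 2))))"
    using e by (simp add: suminf_mult suminf_geometric summable_geometric)
  also have "\<dots> \<le> K * (1 / (d / 4))"
    using one_minus_exp_bounds(1)[of "d / 2"] d
    by (intro mult_left_mono divide_left_mono mult_pos_pos) (auto simp: K_def)
  also have "\<dots> = 4 * exp 1 * exp (b * ln (2 * b)) * d powr (-b - 1)"
    using d by (simp add: K_def powr_diff)
  finally show "(\<Sum>n. real (Suc n) powr b * exp (-d) ^ n) \<le> 4 * exp 1 * exp (b * ln (2 * b)) * d powr (-b - 1)" .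
qed

section \<open>Power series of the partial sums and extraction of the k-th root\<close>

lemma partial_sums_power_series:
  assumes "(\<lambda>n. a n * q ^ n) sums c" "\<And>n. a n \<ge> 0" "0 \<le> q" "q < (1::real)"
  shows "(\<lambda>n. (\<Sum>i\<le>n. a i) * q ^ n) sums (c / (1 - q))"
proof -
  have "(\<lambda>n. \<Sum>i\<le>n. (a i * q ^ i) * q ^ (n - i)) sums ((\<Sum>n. a n * q ^ n) * (\<Sum>n. q ^ n))"
    using assms sums_summable[OF assms(1)] by (intro Cauchy_product_sums) (auto simp: abs_mult)
  also have "(\<lambda>n. \<Sum>i\<le>n. (a i * q ^ i) * q ^ (n - i)) = (\<lambda>n. (\<Sum>i\<le>n. a i) * q ^ n)"
    unfolding sum_distrib_right by (intro ext sum.cong) (auto simp: mult.assoc simp flip: power_add)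
  finally show ?thesis using assms sums_unique[OF assms(1)] by (simp add: suminf_geometric)
qed

lemma sum_binomial_diagonal: "(\<Sum>i\<le>n. (i + k) choose k) = (n + Suc k) choose Suc k"
  by (induction n) auto

lemma negative_binomial_series:
  assumes "0 \<le> q" "q < (1::real)"
  shows "(\<lambda>n. real ((n + k) choose k) * q ^ n) sums (1 / (1 - q) ^ Suc k)"
proof (induction k)
  case 0
  then show ?case using assms by (simp add: geometric_sums)
next
  case (Suc k)
  have "(\<lambda>n. (\<Sum>i\<le>n. real ((i + k) choose k)) * q ^ n) sums (1 / (1 - q) ^ Suc k / (1 - q))"
    using Suc assms by (intro partial_sums_power_series) auto
  then show ?case
    unfolding of_nat_sum[symmetric] sum_binomial_diagonal
    by (simp only: divide_divide_eq_left power_Suc mult.commute)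
qed

text \<open>The power series with binomial coefficients is exactly
  \<open>1 / (1 - q) ^ Suc k\<close>, so they serve as the main term in place of
  \<open>n ^ k / fact k\<close>. Times \<open>fact k\<close> the coefficient is a product of
  \<open>k\<close> factors between \<open>n\<close> and \<open>n + k\<close>; the constant comes
  from \<open>n + k \<le> k * Suc n\<close>.\<close>

lemma binomial_approx:
  assumes k: "k \<ge> 1"
  shows "\<bar>real ((n + k) choose k) - real n ^ k / fact k\<bar> \<le> real k ^ Suc k * real (Suc n) powr (real k - 1)"
proof -
  obtain m where m: "k = Suc m" using k by (cases k) auto
  have eq: "fact k * real ((n + k) choose k) = (\<Prod>i<k. real (n + k - i))"
    by (simp add: binomial_gbinomial gbinomial_prod_rev atLeast0LessThan of_nat_diff)
  have "real n ^ k \<le> fact k * real ((n + k) choose k)"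
    unfolding eq using prod_mono[of "{..<k}" "\<lambda>_. real n" "\<lambda>i. real (n + k - i)"] by simp
  moreover have "fact k * real ((n + k) choose k) \<le> real (n + k) ^ k"
    unfolding eq using prod_mono[of "{..<k}" "\<lambda>i. real (n + k - i)" "\<lambda>_. real (n + k)"] by simp
  moreover have "real (n + k) ^ k - real n ^ k \<le> real k ^ Suc k * real (Suc n) ^ m"
  proof -
    have "real (n + k) ^ k - real n ^ k \<le> real k * real (n + k) ^ m * real k"
      using power_Suc_diff_bounds(2)[of "real n" "real (n + k)" m] by (simp add: m)
    also have "\<dots> \<le> real k * (real k * real (Suc n)) ^ m * real k"
    proof (intro mult_right_mono mult_left_mono power_mono)
      have "n + k \<le> k * Suc n" using k by (simp add: m)
      then show "real (n + k) \<le> real k * real (Suc n)" by (metis of_nat_le_iff of_nat_mult)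
    qed auto
    also have "\<dots> = real k ^ Suc k * real (Suc n) ^ m" by (simp add: m power_mult_distrib)
    finally show ?thesis .
  qed
  ultimately have "\<bar>fact k * real ((n + k) choose k) - real n ^ k\<bar> \<le> real k ^ Suc k * real (Suc n) ^ m"
    by linarith
  moreover have "real ((n + k) choose k) - real n ^ k / fact k = (fact k * real ((n + k) choose k) - real n ^ k) / fact k"
    by (simp add: field_simps)
  ultimately have "\<bar>real ((n + k) choose k) - real n ^ k / fact k\<bar> \<le> real k ^ Suc k * real (Suc n) ^ m / fact k"
    by (simp add: abs_divide divide_right_mono)
  also have "\<dots> \<le> real k ^ Suc k * real (Suc n) ^ m / 1"
    by (intro divide_left_mono) (auto simp: fact_ge_1)
  moreover have "real k - 1 = real m" by (simp add: m)
  ultimately show ?thesis by (simp add: powr_realpow)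
qed

text \<open>This is the extraction of the root. For nonnegative numbers the cofactor of
  \<open>x - y\<close> has no cancellation, and one of its terms is \<open>y ^ m\<close>.\<close>

lemma abs_diff_times_power_le:
  assumes "x \<ge> 0" "y \<ge> (0::real)"
  shows "\<bar>x - y\<bar> * y ^ m \<le> \<bar>x ^ Suc m - y ^ Suc m\<bar>"
proof -
  have eq: "x ^ Suc m - y ^ Suc m = (x - y) * (\<Sum>p<Suc m. x ^ p * y ^ (m - p))"
    using diff_power_eq_sum[of x m y] by simp
  have "y ^ m = (\<Sum>p\<in>{0}. x ^ p * y ^ (m - p))" by simp
  also have "\<dots> \<le> (\<Sum>p<Suc m. x ^ p * y ^ (m - p))"
    using assms by (intro sum_mono2) auto
  finally have "y ^ m \<le> \<bar>\<Sum>p<Suc m. x ^ p * y ^ (m - p)\<bar>" by linarith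
  then show ?thesis unfolding eq abs_mult by (intro mult_left_mono) auto
qed

definition mangoldt_laplace :: "real \<Rightarrow> real" where
  "mangoldt_laplace d = (\<Sum>n. mangoldt n * exp (-d) ^ n)"

lemma mangoldt_laplace_asymp:
  assumes k: "k \<ge> 1" and a: "a > 0"
    and G: "\<And>N. N \<ge> k \<Longrightarrow> \<bar>G_sum k N - real N ^ k / fact k\<bar> \<le> C * real N powr (real k - 1 + a)"
  shows "\<exists>K. \<forall>d. 0 < d \<and> d \<le> 1 \<longrightarrow> \<bar>mangoldt_laplace d - 1 / (1 - exp (-d))\<bar> \<le> K * d powr (-a)"
proof -
  define b where "b = real k - 1 + a"
  have b: "b > 0" using k a by (simp add: b_def)
  define e where "e n = G_sum k n - real ((n + k) choose k)" for n
  \<comment> \<open>The last summand covers the indices below \<open>k\<close>, about which the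
    hypothesis says nothing.\<close>
  define C1 where "C1 = \<bar>C\<bar> + real k ^ Suc k + (\<Sum>n<k. \<bar>e n\<bar>)"
  have C1: "C1 \<ge> 0" by (auto simp: C1_def intro!: add_nonneg_nonneg sum_nonneg)
  have e: "\<bar>e n\<bar> \<le> C1 * real (Suc n) powr b" for n
  proof (cases "n < k")
    case True
    have "\<bar>e n\<bar> = (\<Sum>n\<in>{n}. \<bar>e n\<bar>)" by simp
    also have "\<dots> \<le> (\<Sum>n<k. \<bar>e n\<bar>)" using True by (intro sum_mono2) auto
    also have "\<dots> \<le> C1" by (auto simp: C1_def)
    also have "\<dots> \<le> C1 * real (Suc n) powr b"
      using C1 b ge_one_powr_ge_zero[of "real (Suc n)" b] by (simp add: mult_le_cancel_left1 not_less del: of_nat_Suc)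
    finally show ?thesis .
  next
    case False
    have "\<bar>e n\<bar> \<le> \<bar>C\<bar> * real n powr b + real k ^ Suc k * real (Suc n) powr (real k - 1)"
      using G[of n] binomial_approx[OF k, of n] False abs_ge_self[of C]
        mult_right_mono[of C "\<bar>C\<bar>" "real n powr b"] unfolding e_def b_def by fastforce
    also have "\<dots> \<le> \<bar>C\<bar> * real (Suc n) powr b + real k ^ Suc k * real (Suc n) powr b"
      using b a by (intro add_mono mult_left_mono powr_mono2 powr_mono) (auto simp: b_def)
    also have "\<dots> \<le> C1 * real (Suc n) powr b"
      unfolding C1_def by (simp add: distrib_right sum_nonneg)
    finally show ?thesis .
  qed
  define K where "K = C1 * (4 * exp 1 * exp (b * ln (2 * b)))"
  have "\<bar>mangoldt_laplace d - 1 / (1 - exp (-d))\<bar> \<le> K * d powr (-a)" if d: "0 < d" "d \<le> 1" for d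
  proof -
    define q where "q = exp (-d)"
    have q: "0 \<le> q" "q < 1" using d by (auto simp: q_def)
    define D where "D = 1 / (1 - q)"
    have D: "D \<ge> 1 / d" "D > 0"
      using one_minus_exp_bounds(2)[of d] d q by (auto simp: D_def q_def intro!: divide_left_mono mult_pos_pos)
    have "(\<lambda>n. G_sum k n * q ^ n) sums (mangoldt_laplace d ^ k / (1 - q))"
      unfolding G_sum_def mangoldt_laplace_def q_def[symmetric]
      using q by (intro partial_sums_power_series G_power_series G_nonneg)
    moreover have "(\<lambda>n. real ((n + k) choose k) * q ^ n) sums (1 / (1 - q) ^ Suc k)"
      using q by (intro negative_binomial_series)
    ultimately have "(\<lambda>n. G_sum k n * q ^ n - real ((n + k) choose k) * q ^ n) sums (mangoldt_laplace d ^ k / (1 - q) - 1 / (1 - q) ^ Suc k)"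
      by (rule sums_diff)
    moreover have "mangoldt_laplace d ^ k / (1 - q) - 1 / (1 - q) ^ Suc k = (mangoldt_laplace d ^ k - D ^ k) * D"
    proof -
      have "P / u - 1 / u ^ Suc k = (P - (1 / u) ^ k) * (1 / u)" for P u :: real
        by (simp add: diff_divide_distrib power_one_over mult.commute)
      then show ?thesis by (simp only: D_def)
    qed
    ultimately have sums: "(\<lambda>n. e n * q ^ n) sums ((mangoldt_laplace d ^ k - D ^ k) * D)"
      by (simp add: e_def left_diff_distrib)
    have "\<bar>(mangoldt_laplace d ^ k - D ^ k) * D\<bar> \<le> (\<Sum>n. C1 * (real (Suc n) powr b * q ^ n))"
    proof -
      have le: "\<bar>e n * q ^ n\<bar> \<le> C1 * (real (Suc n) powr b * q ^ n)" for n
        using mult_right_mono[OF e[of n], of "q ^ n"] q by (simp add: abs_mult mult.assoc)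
      have "summable (\<lambda>n. C1 * (real (Suc n) powr b * q ^ n))"
        using suminf_powr_exp_le(1)[OF b d] by (intro summable_mult) (simp add: q_def)
      then show ?thesis
        using norm_suminf_le[of "\<lambda>n. e n * q ^ n", OF le[folded real_norm_def]] sums_unique[OF sums] by simp
    qed
    also have "\<dots> = C1 * (\<Sum>n. real (Suc n) powr b * q ^ n)"
      using suminf_powr_exp_le(1)[OF b d] by (intro suminf_mult) (simp add: q_def)
    also have "\<dots> \<le> C1 * (4 * exp 1 * exp (b * ln (2 * b)) * d powr (-b - 1))"
      using suminf_powr_exp_le(2)[OF b d] C1 by (intro mult_left_mono) (auto simp: q_def)
    also have "\<dots> = K * d powr (-b - 1)" by (simp add: K_def)
    finally have 1: "\<bar>mangoldt_laplace d ^ k - D ^ k\<bar> * D \<le> K * d powr (-b - 1)"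
      using D by (simp add: abs_mult)
    obtain m where m: "k = Suc m" using k by (cases k) auto
    have P: "mangoldt_laplace d \<ge> 0"
      unfolding mangoldt_laplace_def using d summable_mangoldt_power[of "exp (-d)"]
      by (intro suminf_nonneg) (auto simp: mangoldt_nonneg)
    \<comment> \<open>One factor \<open>D\<close> comes from the summation of the coefficients and
      \<open>k - 1\<close> from the root. Since \<open>D \<ge> 1 / d\<close>, dividing by them turns
      the exponent \<open>- b - 1 = - k - a\<close> into \<open>- a\<close>.\<close>
    have "\<bar>mangoldt_laplace d - D\<bar> * (1 / d) ^ k \<le> \<bar>mangoldt_laplace d - D\<bar> * D ^ k"
      using D d by (intro mult_left_mono power_mono) auto
    also have "\<dots> = (\<bar>mangoldt_laplace d - D\<bar> * D ^ m) * D" by (simp add: m)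
    also have "\<dots> \<le> \<bar>mangoldt_laplace d ^ k - D ^ k\<bar> * D"
      unfolding m using D P by (intro mult_right_mono abs_diff_times_power_le) auto
    also note 1
    finally have "\<bar>mangoldt_laplace d - D\<bar> \<le> K * d powr (-b - 1) * d ^ k"
      using d by (simp add: power_divide field_simps)
    also have "\<dots> = K * d powr (-a)"
    proof -
      have "d powr (-b - 1) * d powr (real k) = d powr (-a)"
        unfolding powr_add[symmetric] by (simp add: b_def)
      then show ?thesis using d by (simp add: powr_realpow)
    qed
    finally show ?thesis by (simp add: D_def q_def)
  qed
  then show ?thesis by blast
qed

text \<open>
  Near \<open>p\<close> we expand \<open>t powr (s - 1) = t powr (p - 1) * exp ((s - p) * ln t)\<close> into a power series in
  \<open>s - p\<close> and integrate termwise. So no continuity of \<open>h\<close> is needed.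
\<close>

lemma holomorphic_Mellin:
  fixes h :: "real \<Rightarrow> real"
  assumes [measurable]: "h \<in> borel_measurable borel"
    and int: "\<And>\<sigma>. \<sigma> > a \<Longrightarrow> integrable lborel (\<lambda>t. indicator {0<..} t * \<bar>h t\<bar> * t powr (\<sigma> - 1))"
  shows "(\<lambda>s. LINT t|lborel. of_real (indicator {0<..} t * h t) * of_real t powr (s - 1)) holomorphic_on {s. Re s > a}"
proof -
  let ?h = "\<lambda>t. complex_of_real (indicator {0<..} t * h t)"
  define M where "M s = (LINT t|lborel. ?h t * of_real t powr (s - 1 :: complex))" for s
  have op: "open {s::complex. Re s > a}" by (rule open_halfspace_Re_gt)
  have "M holomorphic_on {s. Re s > a}"
  proof (subst holomorphic_on_open[OF op], safe)
    fix p :: complex assume p: "Re p > a"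
    define r where "r = (Re p - a) / 2"
    have r: "r > 0" using p by (simp add: r_def)
    define f where "f w m t = (?h t * of_real t powr (p - 1)) * (((w - p) * of_real (ln t)) ^ m / fact m)" for w m t
    \<comment> \<open>A common majorant on the disc, from
      \<open>exp (R * \<bar>ln t\<bar>) \<le> t powr r + t powr (- r)\<close> for
      \<open>R < r\<close>. As \<open>r\<close> is half the distance to the boundary line, both
      shifted exponents are still covered by \<open>int\<close>.\<close>
    define g where "g t = indicator {0<..} t * \<bar>h t\<bar> * t powr ((Re p + r) - 1) + indicator {0<..} t * \<bar>h t\<bar> * t powr ((Re p - r) - 1)" for t
    have g: "integrable lborel g"
      unfolding g_def using p by (intro Bochner_Integration.integrable_add int) (auto simp: r_def field_simps)
    define c where "c m = (LINT t|lborel. (?h t * of_real t powr (p - 1)) * (of_real (ln t) ^ m / fact m) :: complex)" for m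
    have "M holomorphic_on ball p r"
    proof (rule power_series_holomorphic)
      fix w assume w: "w \<in> ball p r"
      define R where "R = norm (w - p)"
      have R: "R < r" "R \<ge> 0" using w by (auto simp: R_def dist_norm norm_minus_commute)
      have norm_f: "norm (f w m t) = indicator {0<..} t * \<bar>h t\<bar> * t powr (Re p - 1) * ((R * \<bar>ln t\<bar>) ^ m / fact m)" for m t
        by (cases "t > 0") (auto simp: f_def R_def norm_mult norm_divide norm_power norm_powr_real_powr power_mult_distrib)
      have sums_norm: "(\<lambda>m. norm (f w m t)) sums (indicator {0<..} t * \<bar>h t\<bar> * t powr (Re p - 1) * exp (R * \<bar>ln t\<bar>))" for t
        unfolding norm_f using exp_converges[of "R * \<bar>ln t\<bar>"] by (intro sums_mult) (simp add: divide_inverse mult.commute)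
      have exp_le: "indicator {0<..} t * \<bar>h t\<bar> * t powr (Re p - 1) * exp (R * \<bar>ln t\<bar>) \<le> g t" for t
      proof (cases "t > 0")
        case True
        have "exp (R * \<bar>ln t\<bar>) \<le> exp (r * \<bar>ln t\<bar>)" using R by (simp add: mult_right_mono)
        also have "\<dots> \<le> t powr r + t powr (-r)"
          using True by (cases "ln t \<ge> 0") (auto simp: powr_def)
        finally have "(\<bar>h t\<bar> * t powr (Re p - 1)) * exp (R * \<bar>ln t\<bar>) \<le> (\<bar>h t\<bar> * t powr (Re p - 1)) * (t powr r + t powr (-r))"
          by (intro mult_left_mono) auto
        also have "\<dots> = \<bar>h t\<bar> * (t powr (Re p - 1) * t powr r) + \<bar>h t\<bar> * (t powr (Re p - 1) * t powr (-r))"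
          by (simp add: algebra_simps)
        also have "\<dots> = \<bar>h t\<bar> * t powr ((Re p + r) - 1) + \<bar>h t\<bar> * t powr ((Re p - r) - 1)"
        proof -
          have "(Re p - 1) + r = (Re p + r) - 1" "(Re p - 1) + (-r) = (Re p - r) - 1" by simp_all
          then show ?thesis by (simp only: powr_add[symmetric])
        qed
        finally show ?thesis using True by (simp add: g_def mult.assoc)
      qed (simp add: g_def)
      have f_meas [measurable]: "f w m \<in> borel_measurable lborel" for m
        unfolding f_def by measurable
      have f_int: "integrable lborel (f w m)" for m
      proof (rule Bochner_Integration.integrable_bound[OF g f_meas])
        show "AE t in lborel. norm (f w m t) \<le> norm (g t)"
        proof (rule AE_I2)
          fix t
          have "norm (f w m t) = (\<Sum>m\<in>{m}. norm (f w m t))" by simp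
          also have "\<dots> \<le> (\<Sum>m. norm (f w m t))"
            by (intro sum_le_suminf sums_summable[OF sums_norm]) auto
          also have "\<dots> \<le> g t" using exp_le[of t] sums_unique[OF sums_norm[of t]] by simp
          finally show "norm (f w m t) \<le> norm (g t)" by simp
        qed
      qed
      have "(\<lambda>m. LINT t|lborel. f w m t) sums (LINT t|lborel. (\<Sum>m. f w m t))"
      proof (rule sums_integral[OF f_int])
        show "AE t in lborel. summable (\<lambda>m. norm (f w m t))"
          using sums_summable[OF sums_norm] by simp
        show "summable (\<lambda>m. LINT t|lborel. norm (f w m t))"
        proof (rule summableI_nonneg_bounded)
          fix n
          have "(\<Sum>m<n. LINT t|lborel. norm (f w m t)) = (LINT t|lborel. (\<Sum>m<n. norm (f w m t)))"
            using f_int by (intro Bochner_Integration.integral_sum[symmetric]) auto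
          also have "\<dots> \<le> (LINT t|lborel. g t)"
          proof (rule integral_mono[OF _ g])
            fix t
            have "(\<Sum>m<n. norm (f w m t)) \<le> (\<Sum>m. norm (f w m t))"
              by (intro sum_le_suminf sums_summable[OF sums_norm]) auto
            also have "\<dots> \<le> g t" using exp_le[of t] sums_unique[OF sums_norm[of t]] by simp
            finally show "(\<Sum>m<n. norm (f w m t)) \<le> g t" .
          qed (use f_int in auto)
          finally show "(\<Sum>m<n. LINT t|lborel. norm (f w m t)) \<le> (LINT t|lborel. g t)" .
        qed auto
      qed
      also have "(\<lambda>m. LINT t|lborel. f w m t) = (\<lambda>m. c m * (w - p) ^ m)"
      proof
        fix m
        have "(LINT t|lborel. f w m t) = (LINT t|lborel. (?h t * of_real t powr (p - 1)) * (of_real (ln t) ^ m / fact m) * (w - p) ^ m)"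
          by (intro Bochner_Integration.integral_cong) (auto simp: f_def power_mult_distrib)
        also have "\<dots> = c m * (w - p) ^ m" unfolding c_def by simp
        finally show "(LINT t|lborel. f w m t) = c m * (w - p) ^ m" .
      qed
      also have "(LINT t|lborel. (\<Sum>m. f w m t)) = M w"
        unfolding M_def
      proof (intro Bochner_Integration.integral_cong refl)
        fix t
        have "(\<lambda>m. f w m t) sums ((?h t * of_real t powr (p - 1)) * exp ((w - p) * of_real (ln t)))"
          unfolding f_def using exp_converges[of "(w - p) * of_real (ln t)"]
          by (intro sums_mult) (simp add: scaleR_conv_of_real divide_inverse mult.commute)
        then have "(\<Sum>m. f w m t) = (?h t * of_real t powr (p - 1)) * exp ((w - p) * of_real (ln t))"
          by (simp add: sums_iff)
        also have "\<dots> = ?h t * of_real t powr (w - 1)"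
        proof (cases "t > 0")
          case True
          then have "of_real t powr (p - 1) * exp ((w - p) * of_real (ln t)) = of_real t powr (w - 1)"
            by (simp add: powr_def Ln_of_real flip: exp_add) (simp add: algebra_simps)
          then show ?thesis by (simp add: mult.assoc)
        qed auto
        finally show "(\<Sum>m. f w m t) = ?h t * of_real t powr (w - 1)" .
      qed
      finally show "(\<lambda>m. c m * (w - p) ^ m) sums M w" .
    qed
    then show "\<exists>f'. (M has_field_derivative f') (at p)"
      using r by (meson centre_in_ball holomorphic_on_open open_ball)
  qed
  then show ?thesis by (simp add: M_def[abs_def])
qed

section \<open>The Mellin transform of the error series and the zero-free half plane\<close>

definition mangoldt_error :: "real \<Rightarrow> real" where
  "mangoldt_error t = (\<Sum>n. (mangoldt (Suc n) - 1) * exp (-t) ^ Suc n)"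

lemma abs_mangoldt_minus_1_le: "\<bar>mangoldt (Suc n) - 1 :: real\<bar> \<le> real (Suc n)"
  using mangoldt_le_self[of "Suc n"] mangoldt_nonneg[of "Suc n"] by linarith

lemma summable_Suc_power: "0 \<le> q \<Longrightarrow> q < 1 \<Longrightarrow> summable (\<lambda>n. real (Suc n) * q ^ Suc n)"
  using summable_nat_power[of q] by (subst summable_Suc_iff)

lemma summable_mangoldt_error:
  assumes "t > 0"
  shows "summable (\<lambda>n. (mangoldt (Suc n) - 1) * exp (-t) ^ Suc n :: real)"
  by (rule summable_comparison_test'[OF summable_Suc_power[of "exp (-t)"], of 0])
     (use assms in \<open>auto simp: abs_mult abs_mangoldt_minus_1_le simp del: of_nat_Suc power_Suc intro!: mult_right_mono\<close>)

text \<open>The \<open>+ 1\<close> is the constant term of the geometric series, which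
  \<open>mangoldt_error\<close> omits.\<close>

lemma mangoldt_error_eq:
  assumes "t > 0"
  shows "mangoldt_error t = mangoldt_laplace t - 1 / (1 - exp (-t)) + 1"
proof -
  have q: "0 \<le> exp (-t)" "exp (-t) < 1" using assms by auto
  have "(\<lambda>n. mangoldt n * exp (-t) ^ n - exp (-t) ^ n) sums (mangoldt_laplace t - 1 / (1 - exp (-t)))"
    unfolding mangoldt_laplace_def using q
    by (intro sums_diff summable_sums summable_mangoldt_power geometric_sums) auto
  then have "(\<lambda>n. mangoldt (Suc n) * exp (-t) ^ Suc n - exp (-t) ^ Suc n) sums (mangoldt_laplace t - 1 / (1 - exp (-t)) - (mangoldt 0 * exp (-t) ^ 0 - exp (-t) ^ 0))"
    by (subst sums_Suc_iff) simp
  then show ?thesis by (simp add: mangoldt_error_def left_diff_distrib sums_iff)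
qed

text \<open>The series starts with the exponent 1, so half of the exponential gives the decay; the
  other half is largest at \<open>t = 1\<close> and still makes the series converge.\<close>

lemma mangoldt_error_large:
  assumes "t \<ge> 1"
  shows "\<bar>mangoldt_error t\<bar> \<le> (\<Sum>n. real (Suc n) * exp (-(1/2)) ^ Suc n) * exp (- t / 2)"
proof -
  have s1: "summable (\<lambda>n. real (Suc n) * exp (-(1/2)) ^ Suc n)"
    by (rule summable_Suc_power) auto
  have le: "norm ((mangoldt (Suc n) - 1) * exp (-t) ^ Suc n :: real) \<le> real (Suc n) * exp (-(1/2)) ^ Suc n * exp (- t / 2)" for n
  proof -
    have "exp (-t) ^ Suc n = exp (-(t/2)) ^ Suc n * exp (-(t/2)) ^ Suc n"
    proof -
      have "exp (-t) = exp (-(t/2)) * exp (-(t/2))" by (simp flip: exp_add)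
      then show ?thesis by (simp only: power_mult_distrib)
    qed
    also have "\<dots> \<le> exp (-(1/2)) ^ Suc n * exp (-(t/2)) ^ 1"
      using assms by (intro mult_mono power_mono power_decreasing) auto
    finally have "\<bar>mangoldt (Suc n) - 1\<bar> * exp (-t) ^ Suc n \<le> real (Suc n) * (exp (-(1/2)) ^ Suc n * exp (-(t/2)) ^ 1)"
      using abs_mangoldt_minus_1_le[of n] by (intro mult_mono) auto
    then show ?thesis by (simp add: abs_mult mult.assoc del: power_Suc of_nat_Suc)
  qed
  have "norm (mangoldt_error t) \<le> (\<Sum>n. real (Suc n) * exp (-(1/2)) ^ Suc n * exp (- t / 2))"
    unfolding mangoldt_error_def by (rule norm_suminf_le[OF le]) (intro summable_mult2 s1)
  also have "\<dots> = (\<Sum>n. real (Suc n) * exp (-(1/2)) ^ Suc n) * exp (- t / 2)"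
    by (rule suminf_mult2[OF s1, symmetric])
  finally show ?thesis by simp
qed

lemma measurable_mangoldt_error [measurable]: "mangoldt_error \<in> borel_measurable borel"
  unfolding mangoldt_error_def[abs_def] by measurable

lemma integrable_mangoldt_error:
  assumes a: "0 < a" and K: "\<And>d. 0 < d \<Longrightarrow> d \<le> 1 \<Longrightarrow> \<bar>mangoldt_laplace d - 1 / (1 - exp (-d))\<bar> \<le> K * d powr (-a)"
    and \<sigma>: "\<sigma> > a"
  shows "integrable lborel (\<lambda>t. indicator {0<..} t * \<bar>mangoldt_error t\<bar> * t powr (\<sigma> - 1))"
proof -
  let ?e = "\<lambda>t. \<bar>mangoldt_error t\<bar>"
  define E where "E = (\<Sum>n. real (Suc n) * exp (-(1/2)) ^ Suc n)"
  have s1: "summable (\<lambda>n. real (Suc n) * exp (-(1/2)) ^ Suc n)"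
    by (rule summable_Suc_power) auto
  have E: "E \<ge> 0" unfolding E_def by (intro suminf_nonneg s1) auto
  \<comment> \<open>\<open>g1\<close> dominates on \<open>{0<..1}\<close>, with \<open>K + 1\<close>
    because of the \<open>+ 1\<close> in \<open>mangoldt_error_eq\<close>; \<open>g2\<close>
    dominates beyond 1.\<close>
  define g1 where "g1 t = (K + 1) * (indicator {0..1} t * t powr (\<sigma> - a - 1))" for t
  define g2 where "g2 t = E * (indicator {0<..} t * (t powr (\<sigma> - 1) * exp (- (1 / 2 * t))))" for t
  have "((\<lambda>t. t powr (\<sigma> - a - 1)) has_integral (1 powr (\<sigma> - a - 1 + 1) / (\<sigma> - a - 1 + 1))) {0..1}"
    using \<sigma> by (intro has_integral_powr_from_0) auto
  then have "(\<integral>\<^sup>+t. ennreal (indicator {0..1} t * t powr (\<sigma> - a - 1)) \<partial>lborel) = ennreal (1 powr (\<sigma> - a - 1 + 1) / (\<sigma> - a - 1 + 1))"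
    by (intro nn_integral_of_has_integral) auto
  then have "integrable lborel (\<lambda>t. indicator {0..1} t * t powr (\<sigma> - a - 1) :: real)"
    by (intro integrableI_nonneg) auto
  then have g1: "integrable lborel g1" unfolding g1_def by simp
  have "integrable lborel (\<lambda>t. indicator {0<..} t * (t powr (\<sigma> - 1) * exp (- (1 / 2 * t))) :: real)"
    using nn_integral_Gamma_scaled[of \<sigma> "1/2"] \<sigma> a by (intro integrableI_nonneg) auto
  then have g2: "integrable lborel g2" unfolding g2_def by simp
  have K0: "K \<ge> 0" using K[of 1] by (simp add: order.trans[OF abs_ge_zero])
  show ?thesis
  proof (rule Bochner_Integration.integrable_bound[OF Bochner_Integration.integrable_add[OF g1 g2]])
    show "AE t in lborel. norm (indicator {0<..} t * ?e t * t powr (\<sigma> - 1)) \<le> norm (g1 t + g2 t)"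
    proof (rule AE_I2)
      fix t
      have nonneg: "g1 t \<ge> 0" "g2 t \<ge> 0" using E K0 by (auto simp: g1_def g2_def)
      have "indicator {0<..} t * ?e t * t powr (\<sigma> - 1) \<le> g1 t + g2 t"
      proof (cases "t > 0")
        case True
        show ?thesis
        proof (cases "t \<le> 1")
          case le: True
          have "1 \<le> t powr (-a)"
            using powr_mono2'[of "-a" t 1] True le a by simp
          then have "?e t \<le> (K + 1) * t powr (-a)"
            using K[OF True le] mangoldt_error_eq[OF True] by (simp add: distrib_right)
          then have "?e t * t powr (\<sigma> - 1) \<le> (K + 1) * t powr (-a) * t powr (\<sigma> - 1)"
            by (intro mult_right_mono) auto
          also have "\<dots> = (K + 1) * t powr (-a + (\<sigma> - 1))"
            by (simp only: powr_add mult.assoc)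
          also have "-a + (\<sigma> - 1) = \<sigma> - a - 1" by simp
          finally have "?e t * t powr (\<sigma> - 1) \<le> g1 t"
            using True le by (simp add: g1_def)
          then show ?thesis using nonneg True by simp
        next
          case False
          then have "?e t * t powr (\<sigma> - 1) \<le> E * exp (- t / 2) * t powr (\<sigma> - 1)"
            unfolding E_def by (intro mult_right_mono mangoldt_error_large) auto
          also have "\<dots> = g2 t" using True by (simp add: g2_def mult_ac)
          finally show ?thesis using nonneg True by simp
        qed
      qed (use nonneg in auto)
      then show "norm (indicator {0<..} t * ?e t * t powr (\<sigma> - 1)) \<le> norm (g1 t + g2 t)"
        using nonneg by (simp add: abs_mult)
    qed
  qed auto
qed

text \<open>Termwise integration, each term being a scaled Gamma integral. Real \<open>s\<close> are
  enough, since the identity theorem carries the resulting equation to the half plane.\<close>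

lemma Mellin_mangoldt_error:
  assumes s: "s > (1::real)"
  shows "(LINT t|lborel. of_real (indicator {0<..} t * mangoldt_error t) * of_real t powr (of_real s - 1 :: complex))
    = Gamma (of_real s) * (mangoldt_series (of_real s) - zeta (of_real s))"
proof -
  let ?p = "\<lambda>n. real (Suc n) powr (-s)"
  let ?Q = "\<lambda>n. of_nat (Suc n) powr (- of_real s) :: complex"
  let ?e = "\<lambda>t. indicator {0<..} t * mangoldt_error t"
  define f where "f n t = indicator {0<..} t * (t powr (s - 1) * exp (- (real (Suc n) * t)))" for n and t :: real
  define c where "c n = (mangoldt (Suc n) - 1 :: real)" for n
  have nn: "(\<integral>\<^sup>+t. ennreal (f n t) \<partial>lborel) = ennreal (Gamma s * ?p n)" for n
    unfolding f_def using s by (intro nn_integral_Gamma_scaled) auto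
  have f0: "f n t \<ge> 0" for n t by (auto simp: f_def)
  have [measurable]: "f n \<in> borel_measurable borel" for n unfolding f_def by measurable
  have fint: "integrable lborel (f n)" for n
    using nn[of n] f0 by (intro integrableI_nonneg) auto
  have fval: "(LINT t|lborel. f n t) = Gamma s * ?p n" for n
    using nn[of n] f0 s by (subst integral_eq_nn_integral) auto
  have cpow: "summable (\<lambda>n. mangoldt (Suc n) * ?p n)" "summable (\<lambda>n. ?p n)"
  proof -
    show "summable (\<lambda>n. mangoldt (Suc n) * ?p n)"
      using summable_norm_mangoldt[OF s] by (subst summable_Suc_iff)
    show "summable (\<lambda>n. ?p n)"
      using s by (intro summable_Suc_powr) simp
  qed
  have "(\<lambda>n. LINT t|lborel. c n * f n t) sums (LINT t|lborel. (\<Sum>n. c n * f n t))"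
  proof (rule sums_integral)
    show "AE t in lborel. summable (\<lambda>n. norm (c n * f n t))"
    proof (rule AE_I2)
      fix t
      show "summable (\<lambda>n. norm (c n * f n t))"
      proof (cases "t > 0")
        case True
        have "summable (\<lambda>n. t powr (s - 1) * (real (Suc n) * exp (-t) ^ Suc n))"
          using True by (intro summable_mult summable_Suc_power) auto
        then show ?thesis
        proof (rule summable_comparison_test'[of _ 0])
          fix n
          have "norm (c n * f n t) = \<bar>c n\<bar> * (t powr (s - 1) * exp (-t) ^ Suc n)"
            using True exp_of_nat_mult[of "Suc n" "-t"] by (simp add: f_def abs_mult del: of_nat_Suc power_Suc)
          also have "\<dots> \<le> real (Suc n) * (t powr (s - 1) * exp (-t) ^ Suc n)"
            unfolding c_def by (intro mult_right_mono abs_mangoldt_minus_1_le) auto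
          finally show "norm (norm (c n * f n t)) \<le> t powr (s - 1) * (real (Suc n) * exp (-t) ^ Suc n)"
            by (simp only: real_norm_def abs_abs abs_idempotent mult_ac)
        qed
      qed (simp add: f_def)
    qed
    have "(LINT t|lborel. norm (c n * f n t)) = \<bar>c n\<bar> * (Gamma s * ?p n)" for n
      using f0 by (simp add: abs_mult fval)
    moreover have "summable (\<lambda>n. \<bar>c n\<bar> * (Gamma s * ?p n))"
    proof (rule summable_comparison_test'[of _ 0])
      show "summable (\<lambda>n. Gamma s * (mangoldt (Suc n) * ?p n + ?p n))"
        by (intro summable_mult summable_add cpow)
      fix n
      have "\<bar>c n\<bar> \<le> mangoldt (Suc n) + 1" using mangoldt_nonneg[of "Suc n"] by (simp add: c_def)
      then have "\<bar>c n\<bar> * (Gamma s * ?p n) \<le> (mangoldt (Suc n) + 1) * (Gamma s * ?p n)"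
        using s by (intro mult_right_mono) auto
      then show "norm (\<bar>c n\<bar> * (Gamma s * ?p n)) \<le> Gamma s * (mangoldt (Suc n) * ?p n + ?p n)"
        using s by (simp add: abs_mult algebra_simps)
    qed
    ultimately show "summable (\<lambda>n. LINT t|lborel. norm (c n * f n t))" by simp
  qed (use fint in auto)
  moreover have "(\<lambda>n. LINT t|lborel. c n * f n t) = (\<lambda>n. Gamma s * (mangoldt (Suc n) * ?p n - ?p n))"
  proof
    fix n
    have "(LINT t|lborel. c n * f n t) = c n * (Gamma s * ?p n)"
      by (simp only: integral_mult_right_zero fval)
    then show "(LINT t|lborel. c n * f n t) = Gamma s * (mangoldt (Suc n) * ?p n - ?p n)"
      by (simp only: c_def) (simp add: algebra_simps)
  qed
  moreover have "(\<lambda>t. \<Sum>n. c n * f n t) = (\<lambda>t. ?e t * t powr (s - 1))"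
  proof
    fix t :: real
    show "(\<Sum>n. c n * f n t) = ?e t * t powr (s - 1)"
    proof (cases "t > 0")
      case True
      have "(\<Sum>n. c n * f n t) = (\<Sum>n. ((mangoldt (Suc n) - 1) * exp (-t) ^ Suc n) * t powr (s - 1))"
        using True exp_of_nat_mult[of "Suc n" "-t" for n]
        by (intro suminf_cong) (simp add: f_def c_def mult_ac del: of_nat_Suc power_Suc)
      also have "\<dots> = mangoldt_error t * t powr (s - 1)"
        unfolding mangoldt_error_def by (rule suminf_mult2[OF summable_mangoldt_error[OF True], symmetric])
      finally show ?thesis using True by simp
    qed (simp add: f_def)
  qed
  ultimately have 1: "(\<lambda>n. Gamma s * (mangoldt (Suc n) * ?p n - ?p n))
      sums (LINT t|lborel. ?e t * t powr (s - 1))"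
    by simp
  have pow: "?Q n = (of_real (?p n) :: complex)" for n
    using powr_of_real[of "real (Suc n)" "-s"] by (simp del: of_nat_Suc)
  have "(\<lambda>n. mangoldt (Suc n) * ?Q n - ?Q n) sums (mangoldt_series (of_real s) - zeta (of_real s))"
  proof (rule sums_diff)
    show "(\<lambda>n. mangoldt (Suc n) * ?Q n) sums mangoldt_series (of_real s)"
      using mangoldt_series_sums[of "of_real s"] s by (subst sums_Suc_iff) auto
    show "(\<lambda>n. ?Q n) sums zeta (of_real s)"
      using zeta_Dirichlet[of "of_real s"] s by (simp add: powr_minus inverse_eq_divide del: of_nat_Suc)
  qed
  then have 2: "(\<lambda>n. Gamma (of_real s) * (mangoldt (Suc n) * ?Q n - ?Q n)) sums (Gamma (of_real s) * (mangoldt_series (of_real s) - zeta (of_real s)))"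
    by (rule sums_mult)
  have 3: "(\<lambda>n. Gamma (of_real s) * (mangoldt (Suc n) * ?Q n - ?Q n))
    = (\<lambda>n. of_real (Gamma s * (mangoldt (Suc n) * ?p n - ?p n)) :: complex)"
    unfolding pow by (simp add: Gamma_complex_of_real del: of_nat_Suc)
  have "Gamma (of_real s) * (mangoldt_series (of_real s) - zeta (of_real s)) = of_real (LINT t|lborel. ?e t * t powr (s - 1))"
    using 2 sums_of_real[OF 1, where ?'a = complex] unfolding 3 by (rule sums_unique2)
  also have "\<dots> = (LINT t|lborel. of_real (?e t * t powr (s - 1)))"
    by (rule integral_complex_of_real[symmetric])
  also have "\<dots> = (LINT t|lborel. of_real (?e t) * of_real t powr (of_real s - 1 :: complex))"
  proof (intro Bochner_Integration.integral_cong refl)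
    fix t :: real
    show "of_real (?e t * t powr (s - 1)) = of_real (?e t) * of_real t powr (of_real s - 1 :: complex)"
      using powr_of_real[of t "s - 1"] by (cases "t > 0") auto
  qed
  finally show ?thesis by simp
qed

lemma islimpt_of_real_greaterThan: "of_real (a + 1) islimpt (of_real ` {a<..} :: complex set)"
  unfolding islimpt_approachable
proof (intro allI impI)
  fix e :: real assume "e > 0"
  have "dist (of_real (a + 1 + e / 2) :: complex) (of_real (a + 1)) < e"
    unfolding dist_of_real using \<open>e > 0\<close> by (simp add: dist_real_def)
  moreover have "of_real (a + 1 + e / 2) \<in> (of_real ` {a<..} :: complex set)" using \<open>e > 0\<close> by (intro imageI) auto
  moreover have "of_real (a + 1 + e / 2) \<noteq> (of_real (a + 1) :: complex)" using \<open>e > 0\<close> by (simp only: of_real_eq_iff)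
  ultimately show "\<exists>x'\<in>of_real ` {a<..}. x' \<noteq> of_real (a + 1) \<and> dist x' (of_real (a + 1) :: complex) < e" by blast
qed

text \<open>The terms after the first sum to at most \<open>1 / 4 + 1 / 2\<close>: the term 2 is
  kept exactly and the telescoping bound \<open>1 / (m - 1) - 1 / m\<close> is used from 3 on.
  Telescoping from 2 would give 1 and hence nothing. The conditional terms exchange the first
  telescoping difference for \<open>1 / 4\<close>.\<close>

lemma zeta_Re_2_lower_bound:
  assumes "Re s = 2"
  shows "norm (zeta s) \<ge> 1 / 4"
proof -
  have sums: "(\<lambda>n. 1 / of_nat (Suc (Suc n)) powr s) sums (zeta s - 1)"
    using zeta_Dirichlet[of s] assms sums_Suc_iff[of "\<lambda>n. 1 / of_nat (Suc n) powr s :: complex" "zeta s - 1"] by simp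
  have le: "norm (1 / of_nat (Suc (Suc n)) powr s) \<le> (if n = 0 then 1 / 4 else 0) + (1 / real (Suc n) - 1 / real (Suc (Suc n))) - (if n = 0 then 1 / 2 else 0)" for n
  proof -
    have "norm (1 / of_nat (Suc (Suc n)) powr s) = 1 / (real (Suc (Suc n)))\<^sup>2"
      using norm_of_nat_powr[of "Suc (Suc n)" s] assms by (simp add: norm_divide del: of_nat_Suc)
    also have "\<dots> \<le> (if n = 0 then 1 / 4 else 0) + (1 / real (Suc n) - 1 / real (Suc (Suc n))) - (if n = 0 then 1 / 2 else 0)"
    proof (cases "n = 0")
      case False
      have "1 / (real (Suc (Suc n)))\<^sup>2 \<le> 1 / (real (Suc n) * real (Suc (Suc n)))"
        unfolding power2_eq_square by (intro divide_left_mono mult_right_mono mult_pos_pos) auto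
      also have "\<dots> = 1 / real (Suc n) - 1 / real (Suc (Suc n))"
        by (simp add: divide_simps)
      finally show ?thesis using False by simp
    qed auto
    finally show ?thesis .
  qed
  have lim: "(\<lambda>n. 1 / real (Suc n)) \<longlonglongrightarrow> 0" by real_asymp
  have "(\<lambda>n. (if n = 0 then 1 / 4 else 0) + (1 / real (Suc n) - 1 / real (Suc (Suc n))) - (if n = 0 then 1 / 2 else 0)) sums (1 / 4 + (1 / real (Suc 0) - 0) - 1 / 2)"
    by (intro sums_diff sums_add sums_single telescope_sums' lim)
  then have rhs: "(\<lambda>n. (if n = 0 then 1 / 4 else 0) + (1 / real (Suc n) - 1 / real (Suc (Suc n))) - (if n = 0 then 1 / 2 else 0)) sums (3 / 4)"
    by simp
  have "norm (zeta s - 1) \<le> 3 / 4"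
    using norm_suminf_le[OF le sums_summable[OF rhs]] sums_unique[OF sums] sums_unique[OF rhs] by simp
  then show ?thesis using norm_triangle_ineq2[of 1 "1 - zeta s"] by (simp add: norm_minus_commute)
qed

theorem zeta_nonzero_of_laplace_bound:
  assumes a: "0 < a" and K: "\<And>d. 0 < d \<Longrightarrow> d \<le> 1 \<Longrightarrow> \<bar>mangoldt_laplace d - 1 / (1 - exp (-d))\<bar> \<le> K * d powr (-a)"
    and a2: "a < 2" and s: "Re s > a" "s \<noteq> 1"
  shows "zeta s \<noteq> 0"
proof
  assume zero: "zeta s = 0"
  let ?A = "{s. Re s > a} - {1 :: complex}"
  have op: "open ?A" by (intro open_delete open_halfspace_Re_gt)
  have conn: "connected ?A"
    by (intro connected_open_delete open_halfspace_Re_gt convex_connected convex_halfspace_Re_gt) auto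
  define M where "M s = (LINT t|lborel. of_real (indicator {0<..} t * mangoldt_error t) * of_real t powr (s - 1 :: complex))" for s
  have M: "M holomorphic_on ?A"
    unfolding M_def
    by (rule holomorphic_on_subset[OF holomorphic_Mellin]) (use integrable_mangoldt_error[OF a K] in auto)
  have hz: "zeta holomorphic_on ?A" by (rule holomorphic_on_subset[OF holomorphic_zeta]) auto
  \<comment> \<open>The differential equation cleared of denominators, so that \<open>P\<close> is
    holomorphic whether or not \<open>zeta\<close> has zeros; \<open>rGamma\<close> likewise avoids
    a quotient by \<open>Gamma\<close>. The identity theorem then needs \<open>P = 0\<close> only on
    a real half line.\<close>
  define P where "P s = (M s * rGamma s + zeta s) * zeta s + deriv zeta s" for s
  have P: "P holomorphic_on ?A"
    unfolding P_def[abs_def] by (intro holomorphic_intros M hz holomorphic_deriv op)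
  define b where "b = max 1 a"
  have P0: "P w = 0" if w: "w \<in> ?A" for w
  proof (rule analytic_continuation[OF P op conn _ _ islimpt_of_real_greaterThan[of b]])
    show "of_real ` {b<..} \<subseteq> ?A" by (auto simp: b_def)
    show "of_real (b + 1) \<in> ?A" by (auto simp: b_def complex_eq_iff)
    fix z :: complex assume "z \<in> of_real ` {b<..}"
    then obtain x where x: "z = of_real x" "x > 1" by (auto simp: b_def)
    have "z \<notin> \<int>\<^sub>\<le>\<^sub>0"
    proof
      assume "z \<in> \<int>\<^sub>\<le>\<^sub>0"
      then obtain n :: int where "z = of_int n" "n \<le> 0" by (elim nonpos_Ints_cases)
      then have "Re z \<le> 0" by simp
      then show False using x by simp
    qed
    then have "Gamma z \<noteq> 0" by (simp add: Gamma_eq_zero_iff)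
    then have "M z * rGamma z = mangoldt_series z - zeta z"
      using Mellin_mangoldt_error[of x] x by (simp add: M_def rGamma_inverse_Gamma field_simps)
    moreover have "deriv zeta z = - (mangoldt_series z * zeta z)"
      using x by (intro DERIV_imp_deriv Dirichlet_logderiv zeta_Dirichlet) auto
    ultimately show "P z = 0" by (simp add: P_def)
  qed (use w in auto)
  \<comment> \<open>As \<open>a < 2\<close>, the point 2 belongs to the region, and there
    \<open>zeta\<close> is bounded away from 0.\<close>
  have "zeta 2 = 0"
  proof (rule linear_ode_eq_0[OF op conn hz])
    show "(\<lambda>s. - (M s * rGamma s + zeta s)) holomorphic_on ?A"
      by (intro holomorphic_intros M hz)
    show "deriv zeta z = - (M z * rGamma z + zeta z) * zeta z" if "z \<in> ?A" for z
      using P0[OF that] unfolding P_def by (metis add_eq_0_iff mult_minus_left)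
  qed (use s a2 zero in auto)
  moreover have "norm (zeta 2) \<ge> 1 / 4" by (rule zeta_Re_2_lower_bound) simp
  ultimately show False by simp
qed

section \<open>The logarithmic derivative of zeta in a zero-free half plane\<close>

text \<open>The Borel-Caratheodory inequality for a logarithm \<open>G\<close> of
  \<open>f / f c\<close>, whose real part stays below \<open>A\<close>, followed by Cauchy's
  estimate for its derivative.\<close>

lemma logderiv_bound:
  fixes f :: "complex \<Rightarrow> complex"
  assumes hol: "f holomorphic_on ball c R" and nz: "\<And>z. z \<in> ball c R \<Longrightarrow> f z \<noteq> 0"
    and A: "A > 0" and bound: "\<And>z. z \<in> ball c R \<Longrightarrow> norm (f z) < exp A * norm (f c)"
    and r: "0 \<le> r" "r < R" and z: "norm (z - c) \<le> r"
  shows "norm (deriv f z / f z) \<le> 4 * A * (R + r) / (R - r)\<^sup>2"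
proof -
  have R: "R > 0" using r by linarith
  have c: "c \<in> ball c R" using R by simp
  obtain g where g: "g holomorphic_on ball c R" "\<And>x. x \<in> ball c R \<Longrightarrow> exp (g x) = f x"
    using holomorphic_logarithm_exists[OF convex_ball open_ball hol nz c] by blast
  define G where "G x = g x - g c" for x
  have G: "G holomorphic_on ball c R" unfolding G_def by (intro holomorphic_intros g)
  have ReG: "Re (G x) < A" if "x \<in> ball c R" for x
  proof -
    have "exp (Re (G x)) = norm (exp (G x))" by simp
    also have "\<dots> = norm (f x) / norm (f c)"
      using g(2)[OF that] g(2)[OF c] by (simp only: G_def exp_diff norm_divide)
    also have "\<dots> < exp A" using bound[OF that] nz[OF c] by (simp add: divide_simps)
    finally show ?thesis by simp
  qed
  have lt: "norm (G x) < norm (2 * of_real A - G x)" if "x \<in> ball c R" for x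
  proof -
    have "(Re (G x))\<^sup>2 < (2 * A - Re (G x))\<^sup>2"
      using ReG[OF that] A mult_pos_pos[of A "A - Re (G x)"] by (simp add: power2_eq_square algebra_simps)
    then have "(norm (G x))\<^sup>2 < (norm (2 * of_real A - G x))\<^sup>2"
      by (simp add: cmod_power2)
    then show ?thesis by (rule power2_less_imp_less) simp
  qed
  \<comment> \<open>The map sending \<open>w\<close> to \<open>w / (2 * A - w)\<close> takes the
    half plane \<open>Re w < A\<close> into the unit disc and fixes 0, so that the Schwarz lemma
    applies.\<close>
  define F where "F u = G (c + of_real R * u) / (2 * of_real A - G (c + of_real R * u))" for u
  have inball: "c + of_real R * u \<in> ball c R" if "norm u < 1" for u
    using that R by (simp add: dist_norm norm_mult)
  have F_le: "norm (F u) \<le> norm u" if u: "norm u < 1" for u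
  proof (rule Schwarz_Lemma(1)[OF _ _ _ u])
    have GC: "(\<lambda>u. G (c + of_real R * u)) holomorphic_on ball 0 1"
    proof -
      have "G \<circ> (\<lambda>u. c + of_real R * u) holomorphic_on ball 0 1"
        by (rule holomorphic_on_compose_gen[OF _ G]) (use inball in \<open>auto intro!: holomorphic_intros\<close>)
      then show ?thesis by (simp add: o_def)
    qed
    show "F holomorphic_on ball 0 1"
      unfolding F_def[abs_def]
    proof (intro holomorphic_on_divide holomorphic_on_diff GC holomorphic_on_const)
      show "2 * of_real A - G (c + of_real R * u) \<noteq> 0" if "u \<in> ball 0 1" for u
        using lt[OF inball[of u]] that by auto
    qed
    show "F 0 = 0" by (simp add: F_def G_def)
    show "norm (F z) < 1" if "norm z < 1" for z
      using lt[OF inball[OF that]] by (auto simp: F_def norm_divide divide_simps)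
  qed
  \<comment> \<open>The middle radius: \<open>G\<close> is bounded up to \<open>\<rho>\<close>,
    which leaves the room \<open>\<delta> = (R - r) / 2\<close> for Cauchy's estimate around
    \<open>z\<close>.\<close>
  define \<rho> where "\<rho> = (R + r) / 2"
  have \<rho>: "\<rho> < R" "\<rho> \<ge> 0" using r by (auto simp: \<rho>_def)
  have G_le: "norm (G x) \<le> 2 * A * (R + r) / (R - r)" if x: "norm (x - c) \<le> \<rho>" for x
  proof -
    define u where "u = (x - c) / of_real R"
    have nu: "norm u = norm (x - c) / R" using R by (simp add: u_def norm_divide)
    have u: "norm u < 1" "norm u \<le> \<rho> / R"
      using x \<rho> R unfolding nu by (auto simp: divide_simps)
    have xu: "x = c + of_real R * u" using R by (simp add: u_def)
    have xb: "x \<in> ball c R" using inball[OF u(1)] xu by simp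
    have "norm (G x) / norm (2 * of_real A - G x) \<le> \<rho> / R"
      using F_le[OF u(1)] u(2) xu by (simp add: F_def norm_divide)
    then have "norm (G x) * R \<le> \<rho> * norm (2 * of_real A - G x)"
      using lt[OF xb] R by (auto simp: divide_simps split: if_splits)
    also have "\<dots> \<le> \<rho> * (2 * A + norm (G x))"
      using \<rho> A norm_triangle_ineq4[of "2 * of_real A" "G x"] by (intro mult_left_mono) (auto simp: norm_mult)
    finally have "norm (G x) * (R - \<rho>) \<le> 2 * A * \<rho>" by (simp add: algebra_simps)
    then have "norm (G x) * (R - r) \<le> 2 * A * (R + r)" by (simp add: \<rho>_def algebra_simps add_divide_distrib)
    then show ?thesis using r by (simp add: field_simps)
  qed
  define \<delta> where "\<delta> = (R - r) / 2"
  have \<delta>: "\<delta> > 0" using r by (simp add: \<delta>_def)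
  have near: "norm (x - c) \<le> \<rho>" if "norm (z - x) \<le> \<delta>" for x
    using norm_triangle_ineq4[of "z - c" "z - x"] that z by (simp add: \<rho>_def \<delta>_def field_simps)
  have sub: "cball z \<delta> \<subseteq> ball c R"
  proof
    fix x assume "x \<in> cball z \<delta>"
    then have "norm (x - c) \<le> \<rho>" by (intro near) (simp add: dist_norm)
    then show "x \<in> ball c R" using \<rho> by (simp add: dist_norm norm_minus_commute)
  qed
  have "norm ((deriv ^^ 1) G z) \<le> fact 1 * (2 * A * (R + r) / (R - r)) / \<delta> ^ 1"
  proof (rule Cauchy_inequality)
    show "G holomorphic_on ball z \<delta>" using G sub by (meson ball_subset_cball holomorphic_on_subset subset_trans)
    show "continuous_on (cball z \<delta>) G" using G sub holomorphic_on_imp_continuous_on continuous_on_subset by blast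
    show "norm (G x) \<le> 2 * A * (R + r) / (R - r)" if "norm (z - x) = \<delta>" for x
      using that by (intro G_le near) simp
  qed fact
  moreover have "deriv G z = deriv f z / f z"
  proof -
    have zb: "z \<in> ball c R" using sub \<delta> by (auto simp: subset_iff)
    have dg: "(g has_field_derivative deriv g z) (at z)"
      by (rule holomorphic_derivI[OF g(1) open_ball zb])
    have "((\<lambda>x. exp (g x)) has_field_derivative exp (g z) * deriv g z) (at z)"
      by (rule DERIV_fun_exp[OF dg])
    then have "(f has_field_derivative exp (g z) * deriv g z) (at z)"
      by (rule has_field_derivative_transform_within_open[OF _ open_ball zb]) (use g(2) in auto)
    then have "deriv f z = f z * deriv g z" using g(2)[OF zb] by (simp add: DERIV_imp_deriv)
    moreover have "deriv G z = deriv g z"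
      unfolding G_def[abs_def] using DERIV_imp_deriv[OF DERIV_diff[OF dg DERIV_const]] by simp
    ultimately show ?thesis using nz[OF zb] by simp
  qed
  moreover have "(2 * A * (R + r) / (R - r)) / \<delta> = 4 * A * (R + r) / (R - r)\<^sup>2"
    by (simp add: \<delta>_def power2_eq_square)
  ultimately show ?thesis by simp
qed

section \<open>Growth of zeta without its pole, and of its logarithmic derivative\<close>

definition zeta_entire :: "complex \<Rightarrow> complex" where
  "zeta_entire s = (if s = 1 then 1 else (s - 1) * zeta s)"

definition zeta_growth_const :: real where
  "zeta_growth_const = (\<Sum>n. real (Suc n) powr (-2))"

text \<open>Bounding the difference from 1 serves two purposes: it shows continuity at the removed
  pole, and it gives polynomial growth. The constant is the value of zeta at 2, from the trapezoidal
  errors with \<open>r = 0\<close>.\<close>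

lemma zeta_entire_growth:
  assumes "Re s \<ge> 0"
  shows "norm (zeta_entire s - 1) \<le> norm (s - 1) * (1 / 2 + norm s * norm (s + 1) * zeta_growth_const)"
proof (cases "s = 1")
  case False
  have "norm (\<Sum>n. em_term (Suc n) s) \<le> (\<Sum>n. norm s * norm (s + 1) * real (Suc n) powr (-2))"
    using norm_em_term_le[of "Suc n" s 0 for n] assms False
    by (intro norm_suminf_le summable_mult summable_Suc_powr) auto
  also have "\<dots> = norm s * norm (s + 1) * zeta_growth_const"
    unfolding zeta_growth_const_def by (intro suminf_mult summable_Suc_powr) auto
  finally have 1: "norm (\<Sum>n. em_term (Suc n) s) \<le> norm s * norm (s + 1) * zeta_growth_const" .
  have "zeta_entire s - 1 = (s - 1) * (1 / 2 + (\<Sum>n. em_term (Suc n) s))"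
    using assms False zeta_eq_zeta1[of s] by (simp add: zeta_entire_def zeta1_def algebra_simps diff_divide_distrib[symmetric])
  also have "norm \<dots> = norm (s - 1) * norm (1 / 2 + (\<Sum>n. em_term (Suc n) s))"
    by (rule norm_mult)
  also have "\<dots> \<le> norm (s - 1) * (1 / 2 + norm s * norm (s + 1) * zeta_growth_const)"
    using 1 norm_triangle_ineq[of "1 / 2" "\<Sum>n. em_term (Suc n) s"] by (intro mult_left_mono) auto
  finally show ?thesis .
qed (simp add: zeta_entire_def)

lemma holomorphic_zeta_entire: "zeta_entire holomorphic_on {s. Re s > 0}"
proof (rule no_isolated_singularity[where K = "{1}"])
  let ?A = "{s::complex. Re s > 0}"
  show op: "open ?A" by (rule open_halfspace_Re_gt)
  have "(\<lambda>s. (s - 1) * zeta s) holomorphic_on ?A - {1}"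
    by (intro holomorphic_intros holomorphic_on_subset[OF holomorphic_zeta]) auto
  then show hol: "zeta_entire holomorphic_on ?A - {1}"
    by (rule holomorphic_transform) (auto simp: zeta_entire_def)
  have lim: "((\<lambda>s. norm (s - 1) * (1 / 2 + norm s * norm (s + 1) * zeta_growth_const)) \<longlongrightarrow> norm (1 - 1 :: complex) * (1 / 2 + norm (1 :: complex) * norm (1 + 1 :: complex) * zeta_growth_const)) (at (1 :: complex))"
    by (intro tendsto_intros)
  have "((\<lambda>s. zeta_entire s - 1) \<longlongrightarrow> 0) (at 1)"
  proof (rule Lim_null_comparison)
    have "\<forall>\<^sub>F s in at 1. s \<in> ?A"
      by (rule eventually_at_in_open') (auto simp: op)
    then show "\<forall>\<^sub>F s in at 1. norm (zeta_entire s - 1) \<le> norm (s - 1) * (1 / 2 + norm s * norm (s + 1) * zeta_growth_const)"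
      by eventually_elim (rule zeta_entire_growth, simp)
    show "((\<lambda>s. norm (s - 1) * (1 / 2 + norm s * norm (s + 1) * zeta_growth_const)) \<longlongrightarrow> 0) (at (1 :: complex))"
      using lim by simp
  qed
  then have "isCont zeta_entire 1"
    unfolding isCont_def using Lim_null[of zeta_entire 1 "at 1"] by (simp add: zeta_entire_def)
  moreover have "isCont zeta_entire s" if "s \<in> ?A - {1}" for s
    using holomorphic_on_imp_continuous_on[OF hol] that op
    by (metis continuous_on_eq_continuous_at open_delete)
  ultimately show "continuous_on ?A zeta_entire"
    by (metis DiffI continuous_at_imp_continuous_on empty_iff insert_iff)
qed auto

text \<open>The disc of radius \<open>3 / 2\<close> around \<open>2 + \<i> * t\<close> touches the
  line \<open>Re s = 1 / 2\<close>, and its part of radius \<open>r\<close> reaches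
  \<open>1 / 2 + \<eta>\<close>. At the centre the function is bounded below, on the disc it grows
  polynomially, so \<open>A\<close> is logarithmic in \<open>t\<close> and thus below a multiple of
  any positive power.\<close>

lemma zeta_entire_logderiv_bound:
  assumes nz: "\<And>s. Re s > 1 / 2 \<Longrightarrow> s \<noteq> 1 \<Longrightarrow> zeta s \<noteq> 0" and \<eta>: "0 < \<eta>" "\<eta> < 1"
  shows "\<exists>C>0. \<forall>s. 1 / 2 + \<eta> \<le> Re s \<longrightarrow> Re s \<le> 2 \<longrightarrow>
    norm (deriv zeta_entire s / zeta_entire s) \<le> C * (1 + \<bar>Im s\<bar>) powr \<eta>"
proof -
  define K where "K = zeta_growth_const"
  have K: "K \<ge> 0" unfolding K_def zeta_growth_const_def
    by (intro suminf_nonneg summable_Suc_powr) auto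
  define r where "r = 3 / 2 - \<eta>"
  have r: "0 \<le> r" "r < 3 / 2" using \<eta> by (auto simp: r_def)
  define B where "B = 4 * (3 / 2 + r) / (3 / 2 - r)\<^sup>2"
  have B: "B > 0" using r by (auto simp: B_def)
  define C where "C = B * ((ln (8 * (K + 2)) + 3 / \<eta>) * 5 powr \<eta>)"
  have "ln (8 * (K + 2)) > 0" using K by simp
  then have C: "C > 0" unfolding C_def using B \<eta> by (intro mult_pos_pos add_pos_pos) auto
  show ?thesis
  proof (intro exI[of _ C] conjI C allI impI)
    fix s assume s: "1 / 2 + \<eta> \<le> Re s" "Re s \<le> 2"
    define t where "t = Im s"
    define c where "c = Complex 2 t"
    \<comment> \<open>On the disc \<open>norm z \<le> \<bar>t\<bar> + 7 / 2\<close>, so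
      \<open>x\<close> also dominates \<open>norm (z + 1)\<close> and
      \<open>norm (z - 1)\<close>.\<close>
    define x where "x = \<bar>t\<bar> + 5"
    have x: "x \<ge> 5" by (simp add: x_def)
    define A where "A = ln (8 * (K + 2) * x ^ 3)"
    have A: "A > 0"
    proof -
      have "1 * 1 < (8 * (K + 2)) * x ^ 3" using K x by (intro mult_strict_mono one_less_power) auto
      then show ?thesis unfolding A_def using ln_gt_zero by simp
    qed
    have ball: "Re z > 1 / 2" "norm z \<le> x" "norm (z + 1) \<le> x" "norm (z - 1) \<le> x" if "z \<in> ball c (3/2)" for z
    proof -
      have d: "norm (c - z) < 3 / 2" using that by (simp add: dist_norm)
      show "Re z > 1 / 2" using d abs_Re_le_cmod[of "c - z"] by (simp add: c_def)
      have cb: "norm c \<le> 2 + \<bar>t\<bar>" using cmod_le[of c] by (simp add: c_def)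
      then have nz: "norm z \<le> 2 + \<bar>t\<bar> + 3 / 2" using d norm_triangle_ineq2[of z c] by (simp add: norm_minus_commute)
      then show "norm z \<le> x" by (simp add: x_def)
      show "norm (z + 1) \<le> x" using nz norm_triangle_ineq[of z 1] by (simp add: x_def)
      show "norm (z - 1) \<le> x" using nz norm_triangle_ineq4[of z 1] by (simp add: x_def)
    qed
    have "norm (deriv zeta_entire s / zeta_entire s) \<le> 4 * A * (3 / 2 + r) / (3 / 2 - r)\<^sup>2"
    proof (rule logderiv_bound[OF _ _ A _ r])
      show "zeta_entire holomorphic_on ball c (3 / 2)"
        by (rule holomorphic_on_subset[OF holomorphic_zeta_entire]) (use ball(1) in fastforce)
      show "zeta_entire z \<noteq> 0" if "z \<in> ball c (3 / 2)" for z
        using nz[OF ball(1)[OF that]] by (auto simp: zeta_entire_def)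
      show "norm (zeta_entire z) < exp A * norm (zeta_entire c)" if z: "z \<in> ball c (3 / 2)" for z
      proof -
        have "norm (zeta_entire z) \<le> 1 + norm (zeta_entire z - 1)"
          using norm_triangle_ineq[of 1 "zeta_entire z - 1"] by simp
        also have "\<dots> \<le> 1 + norm (z - 1) * (1 / 2 + norm z * norm (z + 1) * K)"
          unfolding K_def using ball(1)[OF z] by (intro add_left_mono zeta_entire_growth) auto
        also have "\<dots> \<le> 1 + x * (1 / 2 + x * x * K)"
          using ball[OF z] K x by (intro add_mono mult_mono) auto
        also have "\<dots> < (K + 2) * x ^ 3"
        proof -
          have "1 \<le> x * x" using x mult_mono[of 1 x 1 x] by simp
          then have "x * 1 \<le> x * (x * x)" using x by (intro mult_left_mono) auto
          then have "x \<le> x ^ 3" by (simp add: power3_eq_cube)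
          then have "1 + x / 2 < 2 * x ^ 3" using x by linarith
          then show ?thesis by (simp add: algebra_simps power3_eq_cube)
        qed
        also have "\<dots> = (8 * (K + 2) * x ^ 3) * (1 / 8)" by simp
        also have "\<dots> \<le> exp A * norm (zeta_entire c)"
        proof (rule mult_mono)
          have "8 * (K + 2) * x ^ 3 > 0" using K x by (intro mult_pos_pos) auto
          then show "8 * (K + 2) * x ^ 3 \<le> exp A" by (simp add: A_def)
          have "norm (zeta_entire c) = norm (c - 1) * norm (zeta c)"
            by (simp add: zeta_entire_def norm_mult c_def complex_eq_iff)
          moreover have "norm (c - 1) \<ge> 1" using abs_Re_le_cmod[of "c - 1"] by (simp add: c_def)
          moreover have "norm (zeta c) \<ge> 1 / 4" by (rule zeta_Re_2_lower_bound) (simp add: c_def)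
          ultimately show "1 / 8 \<le> norm (zeta_entire c)"
            using mult_mono[of 1 "norm (c - 1)" "1 / 4" "norm (zeta c)"] by simp
        qed (use K x in auto)
        finally show ?thesis .
      qed
      show "norm (s - c) \<le> r"
      proof -
        have "s - c = of_real (Re s - 2)" by (simp add: c_def t_def complex_eq_iff)
        then have "norm (s - c) = \<bar>Re s - 2\<bar>" by (simp only: norm_of_real)
        then show ?thesis using s by (simp add: r_def)
      qed
    qed
    also have "\<dots> = B * A" by (simp add: B_def)
    also have "A = ln (8 * (K + 2)) + 3 * ln x"
      unfolding A_def using K x by (subst ln_mult_pos) (auto simp: ln_realpow)
    also have "B * \<dots> \<le> B * ((ln (8 * (K + 2)) + 3 / \<eta>) * x powr \<eta>)"
    proof (intro mult_left_mono)
      have "1 \<le> x powr \<eta>" using x \<eta> by (intro ge_one_powr_ge_zero) auto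
      then have "ln (8 * (K + 2)) * 1 \<le> ln (8 * (K + 2)) * x powr \<eta>"
        using K by (intro mult_left_mono) auto
      moreover have "ln x \<le> x powr \<eta> / \<eta>" using x \<eta> by (intro ln_powr_bound) auto
      ultimately show "ln (8 * (K + 2)) + 3 * ln x \<le> (ln (8 * (K + 2)) + 3 / \<eta>) * x powr \<eta>"
        by (simp add: distrib_right)
    qed (use B in auto)
    also have "\<dots> \<le> B * ((ln (8 * (K + 2)) + 3 / \<eta>) * (5 * (1 + \<bar>t\<bar>)) powr \<eta>)"
      using B K \<eta> x by (intro mult_left_mono powr_mono2 mult_nonneg_nonneg add_nonneg_nonneg) (auto simp: x_def)
    also have "\<dots> = C * (1 + \<bar>Im s\<bar>) powr \<eta>"
    proof -
      have "(5 * (1 + \<bar>t\<bar>)) powr \<eta> = 5 powr \<eta> * (1 + \<bar>t\<bar>) powr \<eta>"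
        by (rule powr_mult)
      then show ?thesis by (simp add: C_def t_def)
    qed
    finally show "norm (deriv zeta_entire s / zeta_entire s) \<le> C * (1 + \<bar>Im s\<bar>) powr \<eta>" .
  qed
qed

section \<open>Perron's formula\<close>

lemma contour_integral_rectpath:
  assumes "continuous_on (closed_segment a (Complex (Re b) (Im a))) f"
    "continuous_on (closed_segment (Complex (Re b) (Im a)) b) f"
    "continuous_on (closed_segment b (Complex (Re a) (Im b))) f"
    "continuous_on (closed_segment (Complex (Re a) (Im b)) a) f"
  shows "contour_integral (rectpath a b) f =
    contour_integral (linepath a (Complex (Re b) (Im a))) f + contour_integral (linepath (Complex (Re b) (Im a)) b) f
    + contour_integral (linepath b (Complex (Re a) (Im b))) f + contour_integral (linepath (Complex (Re a) (Im b)) a) f"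
  unfolding rectpath_def Let_def
  using assms[THEN contour_integrable_continuous_linepath]
  by (simp add: contour_integrable_joinI)

lemma in_horizontal_segment:
  assumes "x \<in> closed_segment (Complex a t) (Complex b t)"
  shows "Im x = t" "Re x \<in> closed_segment a b"
  using assms closed_segment_same_Im[of "Complex a t" "Complex b t"] by auto

lemma in_vertical_segment:
  assumes "x \<in> closed_segment (Complex a t) (Complex a u)"
  shows "Re x = a" "Im x \<in> closed_segment t u"
  using assms closed_segment_same_Re[of "Complex a t" "Complex a u"] by auto

lemma norm_perron_integrand:
  assumes "y > (0::real)" "d > 0" "e > 0" "norm s \<ge> d" "norm (s + 1) \<ge> e" "y powr (Re s + 1) \<le> B"
  shows "norm (of_real y powr (s + 1) / (s * (s + 1))) \<le> B / (d * e)"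
proof -
  have "norm (of_real y powr (s + 1) / (s * (s + 1))) = y powr (Re s + 1) / (norm s * norm (s + 1))"
    using assms(1) by (simp add: norm_divide norm_mult norm_powr_real_powr)
  also have "\<dots> \<le> B / (d * e)"
    using assms by (intro frac_le mult_mono mult_pos_pos) (auto intro: order.trans[OF powr_ge_zero])
  finally show ?thesis .
qed

text \<open>For \<open>y \<le> 1\<close> the contour is closed to the right, where the power of
  \<open>y\<close> does not grow and no pole lies. The rectangle widens with \<open>T\<close>, so
  that its far side is small as well. The constant is enlarged to that of the case
  \<open>y \<ge> 1\<close>.\<close>

lemma perron_kernel_small:
  assumes y: "0 < y" "y \<le> 1" and T: "T \<ge> (2::real)"
  shows "norm (contour_integral (linepath (Complex 2 (-T)) (Complex 2 T)) (\<lambda>s. of_real y powr (s + 1) / (s * (s + 1)))) \<le> 12 * y ^ 3 / T"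
proof -
  let ?I = "\<lambda>a b. contour_integral (linepath a b)"
  define f where "f s = of_real y powr (s + 1) / (s * (s + 1))" for s :: complex
  let ?a = "Complex 2 (-T)" and ?b = "Complex (T + 2) T"
  have hol: "f holomorphic_on {s. Re s > 0}"
    unfolding f_def
  proof (rule holomorphic_on_divide)
    show "s * (s + 1) \<noteq> 0" if "s \<in> {s. Re s > 0}" for s
      using that by (auto simp: add_eq_0_iff2)
  qed (use y in \<open>auto intro!: holomorphic_intros\<close>)
  have cont: "continuous_on A f" if "A \<subseteq> {s. Re s > 0}" for A
    using hol that by (meson holomorphic_on_imp_continuous_on holomorphic_on_subset)
  have seg: "closed_segment u v \<subseteq> {s. Re s > 0}" if "Re u > 0" "Re v > 0" for u v
    using that by (intro closed_segment_subset convex_halfspace_Re_gt) auto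
  have cont_seg: "continuous_on (closed_segment u v) f" if "Re u > 0" "Re v > 0" for u v
    using that by (intro cont seg)
  have bd: "norm (?I u v f) \<le> y ^ 3 / T\<^sup>2 * norm (v - u)"
    if uv: "Re u \<ge> 2" "Re v \<ge> 2" and big: "\<And>x. x \<in> closed_segment u v \<Longrightarrow> norm x \<ge> T \<and> norm (x + 1) \<ge> T" for u v
  proof (rule contour_integral_bound_linepath)
    show "f contour_integrable_on linepath u v"
      using uv by (intro contour_integrable_continuous_linepath cont seg) auto
    fix x assume x: "x \<in> closed_segment u v"
    then have "x \<in> {s. Re s \<ge> 2}"
      using closed_segment_subset[of u "{s. Re s \<ge> 2}" v] uv convex_halfspace_Re_ge by auto
    then have "y powr (Re x + 1) \<le> y powr 3" using y by (intro powr_mono') auto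
    then have "y powr (Re x + 1) \<le> y ^ 3" using y by simp
    then have "norm (f x) \<le> y ^ 3 / (T * T)"
      unfolding f_def using big[OF x] y T by (intro norm_perron_integrand) auto
    then show "norm (f x) \<le> y ^ 3 / T\<^sup>2" by (simp add: power2_eq_square)
  qed (use y in auto)
  have "contour_integral (rectpath ?a ?b) f = 0"
  proof (rule contour_integral_unique, rule Cauchy_theorem_convex_simple[OF hol convex_halfspace_Re_gt])
    show "path_image (rectpath ?a ?b) \<subseteq> {s. Re s > 0}"
      using T by (auto simp: path_image_rectpath)
  qed auto
  moreover have "contour_integral (rectpath ?a ?b) f = ?I ?a (Complex (T + 2) (-T)) f
      + ?I (Complex (T + 2) (-T)) ?b f + ?I ?b (Complex 2 T) f
      + ?I (Complex 2 T) ?a f"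
    using T by (subst contour_integral_rectpath) (auto intro!: cont_seg)
  moreover have "?I (Complex 2 T) ?a f = - ?I ?a (Complex 2 T) f"
    using T by (intro contour_integral_reverse_linepath cont seg) auto
  ultimately have eq: "?I ?a (Complex 2 T) f = ?I ?a (Complex (T + 2) (-T)) f
      + ?I (Complex (T + 2) (-T)) ?b f + ?I ?b (Complex 2 T) f"
    by (simp add: algebra_simps)
  have 1: "norm (?I ?a (Complex (T + 2) (-T)) f) \<le> y ^ 3 / T\<^sup>2 * norm (Complex (T + 2) (-T) - ?a)"
  proof (rule bd)
    fix x assume "x \<in> closed_segment ?a (Complex (T + 2) (-T))"
    then have "Im x = -T" by (rule in_horizontal_segment)
    then show "norm x \<ge> T \<and> norm (x + 1) \<ge> T" using abs_Im_le_cmod[of x] abs_Im_le_cmod[of "x + 1"] by auto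
  qed (use T in auto)
  have 2: "norm (?I (Complex (T + 2) (-T)) ?b f) \<le> y ^ 3 / T\<^sup>2 * norm (?b - Complex (T + 2) (-T))"
  proof (rule bd)
    fix x assume "x \<in> closed_segment (Complex (T + 2) (-T)) ?b"
    then have "Re x = T + 2" by (rule in_vertical_segment)
    then show "norm x \<ge> T \<and> norm (x + 1) \<ge> T" using abs_Re_le_cmod[of x] abs_Re_le_cmod[of "x + 1"] by auto
  qed (use T in auto)
  have 3: "norm (?I ?b (Complex 2 T) f) \<le> y ^ 3 / T\<^sup>2 * norm (Complex 2 T - ?b)"
  proof (rule bd)
    fix x assume "x \<in> closed_segment ?b (Complex 2 T)"
    then have "Im x = T" by (rule in_horizontal_segment)
    then show "norm x \<ge> T \<and> norm (x + 1) \<ge> T" using abs_Im_le_cmod[of x] abs_Im_le_cmod[of "x + 1"] by auto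
  qed (use T in auto)
  have "norm (Complex (T + 2) (-T) - ?a) = T" "norm (?b - Complex (T + 2) (-T)) = 2 * T" "norm (Complex 2 T - ?b) = T"
    using T by (simp_all add: cmod_def real_sqrt_mult)
  then have "norm (?I ?a (Complex 2 T) f) \<le> y ^ 3 / T\<^sup>2 * T + y ^ 3 / T\<^sup>2 * (2 * T) + y ^ 3 / T\<^sup>2 * T"
    unfolding eq using 1 2 3 by (intro norm_triangle_mono norm_triangle_le) (auto intro!: add_mono)
  also have "\<dots> = 4 * y ^ 3 / T" using T by (simp add: power2_eq_square field_simps)
  also have "\<dots> \<le> 12 * y ^ 3 / T" using y T by (intro divide_right_mono) auto
  finally show ?thesis by (simp add: f_def[abs_def])
qed

text \<open>For \<open>y \<ge> 1\<close> the contour is closed to the left. Splitting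
  \<open>1 / (s * (s + 1))\<close> into \<open>1 / s - 1 / (s + 1)\<close> reduces the poles at 0
  and -1 to two Cauchy formulas, with values \<open>y\<close> and 1. The far side is at distance
  \<open>T - 1 \<ge> T / 2\<close> from -1, and \<open>T \<ge> 2\<close> also yields the constant
  12.\<close>

lemma perron_kernel_large:
  assumes y: "y \<ge> 1" and T: "T \<ge> (2::real)"
  shows "norm (contour_integral (linepath (Complex 2 (-T)) (Complex 2 T)) (\<lambda>s. of_real y powr (s + 1) / (s * (s + 1)))
     - 2 * of_real pi * \<i> * of_real (y - 1)) \<le> 12 * y ^ 3 / T"
proof -
  let ?I = "\<lambda>a b. contour_integral (linepath a b)"
  let ?c = "2 * of_real pi * \<i> :: complex"
  define f where "f s = of_real y powr (s + 1) / (s * (s + 1))" for s :: complex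
  let ?a = "Complex (-T) (-T)" and ?b = "Complex 2 T"
  let ?h = "\<lambda>s. of_real y powr (s + 1) :: complex"
  have hol: "f holomorphic_on - {0, -1}"
    unfolding f_def
  proof (rule holomorphic_on_divide)
    show "s * (s + 1) \<noteq> 0" if "s \<in> - {0, -1}" for s :: complex
      using that by (auto simp: add_eq_0_iff2)
  qed (use y in \<open>auto intro!: holomorphic_intros\<close>)
  have cont: "continuous_on A f" if "A \<subseteq> - {0, -1}" for A
    using hol that by (meson holomorphic_on_imp_continuous_on holomorphic_on_subset)
  have segI: "x \<in> - {0, -1}" if "norm x \<ge> T \<and> norm (x + 1) \<ge> T / 2" for x
    using that T by auto
  have bd: "norm (?I u v f) \<le> y ^ 3 / (T * (T / 2)) * norm (v - u)"
    if uv: "Re u \<le> 2" "Re v \<le> 2" and big: "\<And>x. x \<in> closed_segment u v \<Longrightarrow> norm x \<ge> T \<and> norm (x + 1) \<ge> T / 2" for u v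
  proof (rule contour_integral_bound_linepath)
    show "f contour_integrable_on linepath u v"
      using big by (intro contour_integrable_continuous_linepath cont subsetI segI) auto
    fix x assume x: "x \<in> closed_segment u v"
    then have "x \<in> {s. Re s \<le> 2}"
      using closed_segment_subset[of u "{s. Re s \<le> 2}" v] uv convex_halfspace_Re_le by auto
    then have "y powr (Re x + 1) \<le> y powr 3" using y by (intro powr_mono) auto
    then have "y powr (Re x + 1) \<le> y ^ 3" using y by simp
    then show "norm (f x) \<le> y ^ 3 / (T * (T / 2))"
      unfolding f_def using big[OF x] y T by (intro norm_perron_integrand) auto
  qed (use y T in auto)
  have bigB: "norm x \<ge> T \<and> norm (x + 1) \<ge> T / 2" if "x \<in> closed_segment ?a (Complex 2 (-T))" for x
    using in_horizontal_segment(1)[OF that] abs_Im_le_cmod[of x] abs_Im_le_cmod[of "x + 1"] T by auto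
  have bigT: "norm x \<ge> T \<and> norm (x + 1) \<ge> T / 2" if "x \<in> closed_segment ?b (Complex (-T) T)" for x
    using in_horizontal_segment(1)[OF that] abs_Im_le_cmod[of x] abs_Im_le_cmod[of "x + 1"] T by auto
  have bigL: "norm x \<ge> T \<and> norm (x + 1) \<ge> T / 2" if "x \<in> closed_segment (Complex (-T) T) ?a" for x
    using in_vertical_segment(1)[OF that] abs_Re_le_cmod[of x] abs_Re_le_cmod[of "x + 1"] T by auto
  have contR: "closed_segment (Complex 2 (-T)) ?b \<subseteq> - {0, -1}"
    using in_vertical_segment(1)[of _ 2 "-T" T] by fastforce
  have pth: "path_image (rectpath ?a ?b) \<subseteq> UNIV - {z}" if "z \<in> box ?a ?b" for z
    using path_image_rectpath_inter_box[of ?a ?b] that T by auto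
  have hh: "?h holomorphic_on UNIV" using y by (auto intro!: holomorphic_intros)
  have box: "0 \<in> box ?a ?b" "-1 \<in> box ?a ?b" using T by (auto simp: in_box_complex_iff)
  have "((\<lambda>w. ?h w / (w - 0)) has_contour_integral (of_real (2 * pi) * \<i> * winding_number (rectpath ?a ?b) 0 * ?h 0)) (rectpath ?a ?b)"
    using box(1) by (intro Cauchy_integral_formula_convex_simple[OF convex_UNIV hh] pth) auto
  moreover have "((\<lambda>w. ?h w / (w - (-1))) has_contour_integral (of_real (2 * pi) * \<i> * winding_number (rectpath ?a ?b) (-1) * ?h (-1))) (rectpath ?a ?b)"
    using box(2) by (intro Cauchy_integral_formula_convex_simple[OF convex_UNIV hh] pth) auto
  ultimately have "((\<lambda>w. ?h w / (w - 0) - ?h w / (w - (-1))) has_contour_integral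
      (of_real (2 * pi) * \<i> * winding_number (rectpath ?a ?b) 0 * ?h 0 - of_real (2 * pi) * \<i> * winding_number (rectpath ?a ?b) (-1) * ?h (-1))) (rectpath ?a ?b)"
    by (rule has_contour_integral_diff)
  also have "of_real (2 * pi) * \<i> * winding_number (rectpath ?a ?b) 0 * ?h 0 - of_real (2 * pi) * \<i> * winding_number (rectpath ?a ?b) (-1) * ?h (-1) = ?c * of_real (y - 1)"
    using box y by (simp add: winding_number_rectpath algebra_simps)
  finally have "(f has_contour_integral ?c * of_real (y - 1)) (rectpath ?a ?b)"
  proof (rule has_contour_integral_eq)
    fix w assume "w \<in> path_image (rectpath ?a ?b)"
    then have "w \<noteq> 0" "w + 1 \<noteq> 0" using pth[OF box(1)] pth[OF box(2)] by (auto simp: add_eq_0_iff2)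
    then show "?h w / (w - 0) - ?h w / (w - (-1)) = f w"
      by (simp add: f_def field_simps)
  qed
  then have "contour_integral (rectpath ?a ?b) f = ?c * of_real (y - 1)"
    by (rule contour_integral_unique)
  moreover have "contour_integral (rectpath ?a ?b) f = ?I ?a (Complex 2 (-T)) f
      + ?I (Complex 2 (-T)) ?b f + ?I ?b (Complex (-T) T) f
      + ?I (Complex (-T) T) ?a f"
  proof -
    have "closed_segment ?a (Complex 2 (-T)) \<subseteq> - {0, -1}" "closed_segment ?b (Complex (-T) T) \<subseteq> - {0, -1}"
      "closed_segment (Complex (-T) T) ?a \<subseteq> - {0, -1}"
      by (meson bigB segI subsetI, meson bigT segI subsetI, meson bigL segI subsetI)
    then show ?thesis using contR by (subst contour_integral_rectpath) (auto intro!: cont)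
  qed
  ultimately have eq: "?I (Complex 2 (-T)) ?b f - ?c * of_real (y - 1) =
      - (?I ?a (Complex 2 (-T)) f + ?I ?b (Complex (-T) T) f
      + ?I (Complex (-T) T) ?a f)"
    by (simp add: algebra_simps)
  have "norm (Complex 2 (-T) - ?a) = T + 2" "norm (Complex (-T) T - ?b) = T + 2" "norm (?a - Complex (-T) T) = 2 * T"
    using T by (simp_all add: cmod_def real_sqrt_mult)
  then have "norm (?I (Complex 2 (-T)) ?b f - ?c * of_real (y - 1)) \<le>
     y ^ 3 / (T * (T / 2)) * (T + 2) + y ^ 3 / (T * (T / 2)) * (T + 2) + y ^ 3 / (T * (T / 2)) * (2 * T)"
    unfolding eq norm_minus_cancel
    using bd[of ?a "Complex 2 (-T)", OF _ _ bigB] bd[of ?b "Complex (-T) T", OF _ _ bigT] bd[of "Complex (-T) T" ?a, OF _ _ bigL] T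
    by (intro norm_triangle_mono norm_triangle_le) (auto intro!: add_mono)
  also have "\<dots> = y ^ 3 * (4 * (2 * T + 2)) / T\<^sup>2" using T by (simp add: power2_eq_square field_simps)
  also have "\<dots> \<le> y ^ 3 * (12 * T) / T\<^sup>2" using T y by (intro divide_right_mono mult_left_mono) auto
  also have "\<dots> = 12 * y ^ 3 / T" using T by (simp add: power2_eq_square field_simps)
  finally show ?thesis by (simp add: f_def[abs_def])
qed

text \<open>
  The kernel is the integral of \<open>x powr s / s\<close> over \<open>{N..N + 1}\<close>. As \<open>\<psi>\<close> is constant on
  \<open>{N..<N + 1}\<close>, the averaged Perron formula still gives \<open>\<psi>(N)\<close> exactly, and it converges absolutely.
\<close>

definition perron_kernel :: "nat \<Rightarrow> complex \<Rightarrow> complex" where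
  "perron_kernel N s = (of_nat (Suc N) powr (s + 1) - of_nat N powr (s + 1)) / (s * (s + 1))"

lemma perron_kernel_estimate:
  assumes y: "y > 0" and T: "T \<ge> (2::real)"
  shows "norm (contour_integral (linepath (Complex 2 (-T)) (Complex 2 T)) (\<lambda>s. of_real y powr (s + 1) / (s * (s + 1)))
     - 2 * of_real pi * \<i> * of_real (max (y - 1) 0)) \<le> 12 * y ^ 3 / T"
  using perron_kernel_small[of y T] perron_kernel_large[of y T] assms by (cases "y \<le> 1") auto

lemma contour_integrable_perron_integrand:
  assumes "y > (0::real)"
  shows "(\<lambda>s. of_real y powr (s + 1) / (s * (s + 1))) contour_integrable_on (linepath (Complex 2 a) (Complex 2 b))"
proof (intro contour_integrable_continuous_linepath continuous_on_divide ballI)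
  fix s assume "s \<in> closed_segment (Complex 2 a) (Complex 2 b)"
  then have "Re s = 2" by (rule in_vertical_segment)
  then show "s * (s + 1) \<noteq> 0" by (auto simp: add_eq_0_iff2)
qed (use assms in \<open>auto intro!: continuous_intros\<close>)

text \<open>\<open>n\<close> times the difference of the ramps \<open>max (y - 1) 0\<close> at
  \<open>(N + 1) / n\<close> and \<open>N / n\<close> rises from 0 to 1 as \<open>n\<close>
  decreases from \<open>N + 1\<close> to \<open>N\<close>. No integer lies in between, so the
  averaged step is the exact one.\<close>

lemma perron_term:
  assumes n: "n \<ge> 1" and N: "N \<ge> 1" and T: "T \<ge> 2"
  shows "norm (contour_integral (linepath (Complex 2 (-T)) (Complex 2 T)) (\<lambda>s. of_nat n powr (-s) * perron_kernel N s)
     - 2 * of_real pi * \<i> * (if n \<le> N then 1 else 0)) \<le> 24 * real (Suc N) ^ 3 / T * real n powr (-2)"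
proof -
  let ?J = "contour_integral (linepath (Complex 2 (-T)) (Complex 2 T))"
  let ?c = "2 * of_real pi * \<i> :: complex"
  let ?L = "linepath (Complex 2 (-T)) (Complex 2 T)"
  define w where "w y s = of_real y powr (s + 1) / (s * (s + 1))" for y :: real and s :: complex
  have split: "of_nat m powr (s + 1) * of_nat n powr (-s) = (of_nat n * of_real (real m / real n) powr (s + 1) :: complex)" for m s
  proof -
    have "of_nat m powr (s + 1) = (of_real (real n) * of_real (real m / real n)) powr (s + 1)"
      using n by simp
    also have "\<dots> = of_real (real n) powr (s + 1) * of_real (real m / real n) powr (s + 1)"
      by (rule powr_times_real) auto
    finally have "of_nat m powr (s + 1) = of_nat n powr (s + 1) * of_real (real m / real n) powr (s + 1)"
      by simp
    moreover have "of_nat n powr (s + 1) * of_nat n powr (-s) = (of_nat n :: complex)"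
      using n by (simp flip: powr_add)
    ultimately show ?thesis by (metis mult.assoc mult.commute)
  qed
  have "of_nat n powr (-s) * perron_kernel N s = of_nat n * (w (real (Suc N) / real n) s - w (real N / real n) s)" for s
    unfolding perron_kernel_def w_def
    using split[of "Suc N" s] split[of N s] by (simp add: algebra_simps diff_divide_distrib del: of_nat_Suc)
  then have eq: "(\<lambda>s. of_nat n powr (-s) * perron_kernel N s) = (\<lambda>s. of_nat n * (w (real (Suc N) / real n) s - w (real N / real n) s))"
    by (rule ext)
  have int: "w y contour_integrable_on ?L" if "y > 0" for y
    unfolding w_def using that by (rule contour_integrable_perron_integrand)
  define y1 y2 where "y1 = real (Suc N) / real n" and "y2 = real N / real n"
  have y: "y1 > 0" "y2 > 0" "y2 \<le> y1" using n N by (auto simp: y1_def y2_def divide_right_mono)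
  have ci: "?J (\<lambda>s. of_nat n * (w y1 s - w y2 s)) = of_nat n * (?J (w y1) - ?J (w y2))"
    using int y by (simp add: contour_integral_lmul contour_integral_diff contour_integrable_diff)
  have mx: "real n * (max (y1 - 1) 0 - max (y2 - 1) 0) = (if n \<le> N then 1 else 0)"
  proof (cases "n \<le> N")
    case True
    then have "y1 \<ge> 1" "y2 \<ge> 1" using n by (auto simp: y1_def y2_def)
    moreover have "real n * y1 = real (Suc N)" "real n * y2 = real N" using n by (auto simp: y1_def y2_def)
    ultimately show ?thesis using True by (simp add: right_diff_distrib)
  next
    case False
    then have "y1 \<le> 1" "y2 \<le> 1" using n by (auto simp: y1_def y2_def)
    then show ?thesis using False by simp
  qed
  have Xeq: "?c * (if n \<le> N then 1 else 0) = of_nat n * (?c * of_real (max (y1 - 1) 0) - ?c * of_real (max (y2 - 1) 0))"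
  proof -
    have "(if n \<le> N then 1 else 0 :: complex) = of_real (real n * (max (y1 - 1) 0 - max (y2 - 1) 0))"
      unfolding mx by simp
    then show ?thesis by (simp only: of_real_mult of_real_diff of_real_of_nat_eq) (simp only: algebra_simps)
  qed
  have "?J (\<lambda>s. of_nat n powr (-s) * perron_kernel N s) - ?c * (if n \<le> N then 1 else 0)
    = of_nat n * ((?J (w y1) - ?c * of_real (max (y1 - 1) 0)) - (?J (w y2) - ?c * of_real (max (y2 - 1) 0)))"
    unfolding eq y1_def[symmetric] y2_def[symmetric] ci Xeq by (simp add: algebra_simps)
  also have "norm \<dots> \<le> real n * (12 * y1 ^ 3 / T + 12 * y2 ^ 3 / T)"
  proof -
    have e: "norm (?J (w y) - ?c * of_real (max (y - 1) 0)) \<le> 12 * y ^ 3 / T" if "y > 0" for y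
      unfolding w_def by (rule perron_kernel_estimate[OF that T])
    show ?thesis
      unfolding norm_mult norm_of_nat
      by (intro mult_left_mono order.trans[OF norm_triangle_ineq4 add_mono[OF e e]] y) auto
  qed
  also have "\<dots> \<le> real n * (12 * y1 ^ 3 / T + 12 * y1 ^ 3 / T)"
    using y T by (intro mult_left_mono add_left_mono divide_right_mono power_mono) auto
  also have "\<dots> = 24 * real (Suc N) ^ 3 / T * (real n / real n ^ 3)"
    by (simp add: y1_def power_divide del: of_nat_Suc)
  \<comment> \<open>The cubes in the kernel estimate leave \<open>n powr (-2)\<close>, which is
    summable against \<open>mangoldt n\<close>.\<close>
  also have "real n / real n ^ 3 = real n powr (-2)"
    using n by (simp add: powr_minus power3_eq_cube power2_eq_square field_simps)
  finally show ?thesis .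
qed

lemma continuous_on_perron_kernel:
  assumes "\<And>s. s \<in> A \<Longrightarrow> Re s > 0"  "N \<ge> 1"
  shows "continuous_on A (perron_kernel N)"
  unfolding perron_kernel_def[abs_def]
proof (intro continuous_on_divide ballI)
  show "s * (s + 1) \<noteq> 0" if "s \<in> A" for s using assms(1)[OF that] by (auto simp: add_eq_0_iff2)
qed (use assms in \<open>auto intro!: continuous_intros simp del: of_nat_Suc\<close>)

text \<open>On the segment \<open>Re s = 2\<close> the series converges uniformly, so it may be
  integrated term by term, and the errors of \<open>perron_term\<close> add up to a finite multiple
  of \<open>1 / T\<close>.\<close>

lemma perron_formula:
  assumes N: "N \<ge> 1" and T: "T \<ge> 2"
  shows "norm (contour_integral (linepath (Complex 2 (-T)) (Complex 2 T)) (\<lambda>s. mangoldt_series s * perron_kernel N s)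
     - 2 * of_real pi * \<i> * of_real (chebyshev_psi N)) \<le> 24 * real (Suc N) ^ 3 / T * (\<Sum>n. mangoldt n * real n powr (-2))"
proof -
  let ?m = "\<lambda>n. mangoldt n * real n powr (-2)"
  let ?c = "2 * of_real pi * \<i> :: complex"
  let ?L = "linepath (Complex 2 (-T)) (Complex 2 T)"
  let ?S = "closed_segment (Complex 2 (-T)) (Complex 2 T)"
  have Re: "Re s = 2" if "s \<in> ?S" for s using that by (rule in_vertical_segment)
  have kc: "continuous_on ?S (perron_kernel N)" using Re N by (intro continuous_on_perron_kernel) auto
  have "compact (perron_kernel N ` ?S)" by (intro compact_continuous_image kc) auto
  then obtain B where B: "\<And>s. s \<in> ?S \<Longrightarrow> norm (perron_kernel N s) \<le> B"
    by (metis bounded_iff compact_imp_bounded imageI)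
  define f where "f n s = mangoldt n * (of_nat n powr (-s) * perron_kernel N s)" for n s
  have sm: "summable (\<lambda>n. mangoldt n * real n powr (-2))" by (rule summable_norm_mangoldt) simp
  have "uniform_limit ?S (\<lambda>N w. \<Sum>n<N. f n w) (\<lambda>w. \<Sum>n. f n w) sequentially"
  proof (rule Weierstrass_m_test)
    show "summable (\<lambda>n. ?m n * B)" by (intro summable_mult2 sm)
    fix n s assume s: "s \<in> ?S"
    have "norm (f n s) = ?m n * norm (perron_kernel N s)"
      by (simp add: f_def norm_mult norm_of_nat_powr Re[OF s] mult.assoc)
    also have "\<dots> \<le> ?m n * B"
      using B[OF s] mangoldt_nonneg[of n] by (intro mult_left_mono) auto
    finally show "norm (f n s) \<le> ?m n * B" .
  qed
  moreover have "(\<Sum>n. f n s) = mangoldt_series s * perron_kernel N s" if "s \<in> ?S" for s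
  proof -
    have "(\<lambda>n. mangoldt n * of_nat n powr (-s) * perron_kernel N s) sums (mangoldt_series s * perron_kernel N s)"
      using Re[OF that] by (intro sums_mult2 mangoldt_series_sums) auto
    then show ?thesis by (simp add: f_def sums_iff mult.assoc)
  qed
  ultimately have ul: "uniform_limit ?S (\<lambda>N w. \<Sum>n<N. f n w) (\<lambda>s. mangoldt_series s * perron_kernel N s) sequentially"
    unfolding uniform_limit_iff by (simp cong: ball_cong)
  have fc: "continuous_on ?S (f n)" for n
  proof (cases "n = 0")
    case False
    then show ?thesis unfolding f_def by (intro continuous_intros kc) auto
  qed (simp add: f_def)
  obtain J where J: "((\<lambda>s. mangoldt_series s * perron_kernel N s) has_contour_integral J) ?L"
    "(\<lambda>n. contour_integral ?L (f n)) sums J"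
    using contour_integral_sums_linepath[OF ul fc] by blast
  define e where "e n = contour_integral ?L (f n) - ?c * (if n \<le> N then mangoldt n else 0)" for n
  have "(\<lambda>n. ?c * (if n \<le> N then mangoldt n else 0)) sums (?c * of_real (chebyshev_psi N))"
  proof (intro sums_mult)
    have "(\<lambda>n. if n \<in> {..N} then mangoldt n else 0 :: complex) sums (\<Sum>n\<le>N. mangoldt n)"
      by (rule sums_If_finite_set) simp
    then show "(\<lambda>n. if n \<le> N then mangoldt n else 0 :: complex) sums of_real (chebyshev_psi N)"
      by (simp add: chebyshev_psi_def)
  qed
  then have es: "e sums (J - ?c * of_real (chebyshev_psi N))"
    unfolding e_def by (intro sums_diff J)
  have e_le: "norm (e n) \<le> 24 * real (Suc N) ^ 3 / T * ?m n" for n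
  proof (cases "n = 0")
    case False
    have "contour_integral ?L (f n) = mangoldt n * contour_integral ?L (\<lambda>s. of_nat n powr (-s) * perron_kernel N s)"
      unfolding f_def using False by (intro contour_integral_lmul contour_integrable_continuous_linepath continuous_intros kc) auto
    then have "e n = mangoldt n * (contour_integral ?L (\<lambda>s. of_nat n powr (-s) * perron_kernel N s) - ?c * (if n \<le> N then 1 else 0))"
      by (simp add: e_def right_diff_distrib mult_ac)
    also have "norm \<dots> \<le> mangoldt n * (24 * real (Suc N) ^ 3 / T * real n powr (-2))"
      unfolding norm_mult norm_mangoldt using False perron_term[of n N T] N T mangoldt_nonneg[of n]
      by (intro mult_left_mono) auto
    finally show ?thesis by (simp add: mult_ac)
  next
    case True
    have "f 0 = (\<lambda>_. 0)" by (simp add: f_def fun_eq_iff)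
    then show ?thesis using True by (simp add: e_def)
  qed
  have "norm (suminf e) \<le> (\<Sum>n. 24 * real (Suc N) ^ 3 / T * ?m n)"
    by (intro norm_suminf_le e_le summable_mult sm)
  also have "\<dots> = 24 * real (Suc N) ^ 3 / T * (\<Sum>n. mangoldt n * real n powr (-2))"
    by (intro suminf_mult sm)
  finally show ?thesis using es J(1) by (simp add: sums_iff contour_integral_unique)
qed

text \<open>The bound does not depend on the length of the segment: the integral of
  \<open>(1 + u) powr (-1 - \<eta>)\<close> over \<open>u \<ge> 0\<close> is
  \<open>1 / \<eta>\<close>.\<close>

lemma contour_integral_bound_decay:
  assumes f: "continuous_on (closed_segment a b) f" and \<eta>: "\<eta> > 0" and B: "B \<ge> 0"
    and le: "\<And>x. 0 \<le> x \<Longrightarrow> x \<le> 1 \<Longrightarrow> norm (f (linepath a b x)) \<le> B * (1 + x * norm (b - a)) powr (-1 - \<eta>)"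
  shows "norm (contour_integral (linepath a b) f) \<le> B / \<eta>"
proof -
  define T where "T = norm (b - a)"
  have T: "T \<ge> 0" by (simp add: T_def)
  have hi: "((\<lambda>x. f (linepath a b x) * (b - a)) has_integral contour_integral (linepath a b) f) {0..1}"
    using contour_integrable_continuous_linepath[OF f] has_contour_integral_integral
    by (auto simp flip: has_contour_integral_linepath)
  define g where "g x = B * T * (1 + x * T) powr (-1 - \<eta>)" for x
  have hg: "(g has_integral (- (B / \<eta>) * (1 + 1 * T) powr (-\<eta>) - (- (B / \<eta>) * (1 + 0 * T) powr (-\<eta>)))) {0..1}"
  proof (rule fundamental_theorem_of_calculus)
    fix x :: real assume x: "x \<in> {0..1}"
    then have pos: "1 + x * T > 0" using T by (simp add: add_pos_nonneg)
    have "((\<lambda>x. - (B / \<eta>) * (1 + x * T) powr (-\<eta>)) has_field_derivative - (B / \<eta>) * ((-\<eta>) * (1 + x * T) powr (-\<eta> - 1) * T)) (at x)"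
    proof (rule DERIV_cmult)
      have "((\<lambda>x. 1 + x * T) has_field_derivative T) (at x)" by (auto intro!: derivative_eq_intros)
      then show "((\<lambda>x. (1 + x * T) powr (-\<eta>)) has_field_derivative (-\<eta>) * (1 + x * T) powr (-\<eta> - 1) * T) (at x)"
        by (rule DERIV_chain2[of "\<lambda>z. z powr (-\<eta>)" _ "\<lambda>x. 1 + x * T", OF has_real_derivative_powr[OF pos]])
    qed
    moreover have "- (B / \<eta>) * ((-\<eta>) * (1 + x * T) powr (-\<eta> - 1) * T) = g x"
      using \<eta> by (simp add: g_def minus_diff_commute)
    ultimately show "((\<lambda>x. - (B / \<eta>) * (1 + x * T) powr (-\<eta>)) has_vector_derivative g x) (at x within {0..1})"
      by (metis has_real_derivative_iff_has_vector_derivative has_vector_derivative_at_within)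
  qed auto
  have "norm (integral {0..1} (\<lambda>x. f (linepath a b x) * (b - a))) \<le> integral {0..1} g"
  proof (rule integral_norm_bound_integral)
    show "norm (f (linepath a b x) * (b - a)) \<le> g x" if "x \<in> {0..1}" for x
      using mult_right_mono[OF le[of x], of T] that T by (simp add: norm_mult g_def T_def mult_ac)
  qed (use hi hg in auto)
  also have "integral {0..1} g = - (B / \<eta>) * (1 + 1 * T) powr (-\<eta>) - (- (B / \<eta>) * (1 + 0 * T) powr (-\<eta>))"
    using hg by (rule integral_unique)
  also have "\<dots> \<le> B / \<eta>" using B \<eta> by simp
  finally show ?thesis by (simp only: integral_unique[OF hi])
qed

text \<open>The first bound uses the derivative of \<open>z powr (s + 1)\<close> on the unit segment
  from \<open>N\<close> to \<open>N + 1\<close>, whose factor \<open>s + 1\<close> cancels one in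
  the denominator. The second gives up the cancellation between the two powers and gains decay in
  \<open>s\<close>.\<close>

lemma norm_perron_kernel_le:
  assumes N: "N \<ge> 1" and s: "Re s > 0"
  shows "norm (perron_kernel N s) \<le> real (Suc N) powr Re s / norm s"
    and "norm (perron_kernel N s) \<le> 2 * real (Suc N) powr (Re s + 1) / (norm s)\<^sup>2"
proof -
  let ?N = "real (Suc N)"
  have s0: "s \<noteq> 0" "s + 1 \<noteq> 0" using s by (auto simp: add_eq_0_iff2)
  have ns: "norm s \<le> norm (s + 1)"
  proof (rule power2_le_imp_le)
    have "(Re s)\<^sup>2 \<le> (Re s + 1)\<^sup>2" using s by (intro power_mono) auto
    then show "(norm s)\<^sup>2 \<le> (norm (s + 1))\<^sup>2" by (simp add: cmod_power2)
  qed simp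
  let ?S = "closed_segment (of_real (real N)) (of_real (?N)) :: complex set"
  have S: "\<exists>x. z = of_real x \<and> real N \<le> x \<and> x \<le> ?N" if "z \<in> ?S" for z
    using that unfolding closed_segment_of_real by (auto simp: closed_segment_eq_real_ivl split: if_splits)
  have "norm (of_real (?N) powr (s + 1) - of_real (real N) powr (s + 1) :: complex) \<le>
      (norm (s + 1) * ?N powr Re s) * norm (of_real (?N) - of_real (real N) :: complex)"
  proof (rule field_differentiable_bound[where S = ?S and f = "\<lambda>z. z powr (s + 1)" and f' = "\<lambda>z. (s + 1) * z powr (s + 1 - 1)"
        and x = "of_real (?N)" and y = "of_real (real N)" and B = "norm (s + 1) * ?N powr Re s"])
    fix z assume "z \<in> ?S"
    then obtain x where x: "z = of_real x" "real N \<le> x" "x \<le> ?N" using S by blast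
    have "Re z > 0" using x N by simp
    then have "z \<notin> \<real>\<^sub>\<le>\<^sub>0" by (simp add: complex_nonpos_Reals_iff)
    then show "((\<lambda>z. z powr (s + 1)) has_field_derivative (s + 1) * z powr (s + 1 - 1)) (at z within ?S)"
      by (rule has_field_derivative_at_within[OF has_field_derivative_powr])
    have "norm (z powr s) \<le> ?N powr Re s"
      using x N s by (simp add: norm_powr_real_powr powr_mono2)
    then show "norm ((s + 1) * z powr (s + 1 - 1)) \<le> norm (s + 1) * ?N powr Re s"
      by (simp add: norm_mult mult_left_mono)
  qed (rule convex_closed_segment ends_in_segment)+
  then have 1: "norm (of_nat (Suc N) powr (s + 1) - of_nat N powr (s + 1) :: complex) \<le> norm (s + 1) * ?N powr Re s"
    by (simp add: norm_of_real)
  then show "norm (perron_kernel N s) \<le> ?N powr Re s / norm s"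
    using s0 by (simp add: perron_kernel_def norm_divide norm_mult divide_simps mult_ac del: of_nat_Suc)
  have "norm (of_nat (Suc N) powr (s + 1) - of_nat N powr (s + 1) :: complex) \<le> ?N powr (Re s + 1) + real N powr (Re s + 1)"
    using norm_triangle_ineq4[of "of_nat (Suc N) powr (s + 1) :: complex" "of_nat N powr (s + 1)"]
    by (simp add: norm_of_nat_powr del: of_nat_Suc)
  also have "real N powr (Re s + 1) \<le> ?N powr (Re s + 1)"
    using s by (intro powr_mono2) auto
  finally have "norm (of_nat (Suc N) powr (s + 1) - of_nat N powr (s + 1) :: complex) \<le> 2 * ?N powr (Re s + 1)"
    by simp
  then have "norm (perron_kernel N s) \<le> 2 * ?N powr (Re s + 1) / (norm s * norm (s + 1))"
    unfolding perron_kernel_def norm_divide norm_mult by (intro divide_right_mono) auto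
  also have "\<dots> \<le> 2 * ?N powr (Re s + 1) / (norm s)\<^sup>2"
    unfolding power2_eq_square using ns s0 by (intro divide_left_mono mult_left_mono mult_pos_pos) auto
  finally show "norm (perron_kernel N s) \<le> 2 * ?N powr (Re s + 1) / (norm s)\<^sup>2" .
qed

text \<open>The first bound is used while \<open>norm s \<le> N + 1\<close>, the second beyond. In
  either range the additional decay \<open>norm s powr (- \<theta>)\<close> costs at most
  \<open>(N + 1) powr \<theta>\<close>.\<close>

lemma norm_perron_kernel_interpolated:
  assumes N: "N \<ge> 1" and s: "Re s > 0" and \<theta>: "0 \<le> \<theta>" "\<theta> \<le> 1"
  shows "norm (perron_kernel N s) \<le> 2 * real (Suc N) powr (Re s + \<theta>) * norm s powr (-1 - \<theta>)"
proof -
  let ?N = "real (Suc N)"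
  let ?s = "norm s"
  define P where "P = ?N powr Re s"
  have P: "P \<ge> 0" by (simp add: P_def)
  have ns: "?s > 0" using s by auto
  have inv: "1 / ?s = ?s powr \<theta> * ?s powr (-1 - \<theta>)"
    using ns powr_add[of "?s" \<theta> "-1 - \<theta>"] by (simp add: powr_minus inverse_eq_divide)
  show ?thesis
  proof (cases "?s \<le> ?N")
    case True
    have "norm (perron_kernel N s) \<le> P * (1 / ?s)"
      using norm_perron_kernel_le(1)[OF N s] by (simp add: P_def)
    also have "\<dots> = P * (?s powr \<theta> * ?s powr (-1 - \<theta>))" by (simp only: inv)
    also have "\<dots> \<le> (2 * P) * (?N powr \<theta> * ?s powr (-1 - \<theta>))"
      using True \<theta> P by (intro mult_mono[OF _ mult_right_mono[OF powr_mono2]]) auto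
    finally show ?thesis by (simp add: P_def powr_add mult_ac)
  next
    case False
    have e1: "?N powr (Re s + 1) = P * ?N powr \<theta> * ?N powr (1 - \<theta>)"
      by (simp add: P_def flip: powr_add)
    have e2: "1 / (?s)\<^sup>2 = ?s powr (-2)"
      using ns by (simp add: powr_minus inverse_eq_divide)
    have "norm (perron_kernel N s) \<le> 2 * ?N powr (Re s + 1) * (1 / (?s)\<^sup>2)"
      using norm_perron_kernel_le(2)[OF N s] by simp
    also have "\<dots> = 2 * (P * ?N powr \<theta>) * (?N powr (1 - \<theta>) * ?s powr (-2))"
      unfolding e1 e2 by (simp add: mult_ac)
    also have "\<dots> \<le> 2 * (P * ?N powr \<theta>) * (?s powr (1 - \<theta>) * ?s powr (-2))"
      using False \<theta> P by (intro mult_left_mono mult_right_mono powr_mono2) auto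
    also have "?s powr (1 - \<theta>) * ?s powr (-2) = ?s powr (-1 - \<theta>)"
      by (simp flip: powr_add)
    finally show ?thesis by (simp add: P_def powr_add mult_ac)
  qed
qed

section \<open>Shifting the contour and the asymptotics of the Chebyshev function\<close>

definition zeta_logderiv_reg :: "complex \<Rightarrow> complex" where
  "zeta_logderiv_reg s = 1 - (s - 1) * (deriv zeta_entire s / zeta_entire s)"

lemma holomorphic_zeta_logderiv_reg:
  assumes nz: "\<And>s. Re s > 1 / 2 \<Longrightarrow> s \<noteq> 1 \<Longrightarrow> zeta s \<noteq> 0"
  shows "zeta_logderiv_reg holomorphic_on {s. Re s > 1 / 2}"
proof -
  have h: "zeta_entire holomorphic_on {s. Re s > 1 / 2}"
    by (rule holomorphic_on_subset[OF holomorphic_zeta_entire]) auto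
  have nz': "zeta_entire s \<noteq> 0" if "s \<in> {s. Re s > 1 / 2}" for s
    using nz[of s] that by (cases "s = 1") (simp_all add: zeta_entire_def)
  have q: "(\<lambda>s. deriv zeta_entire s / zeta_entire s) holomorphic_on {s. Re s > 1 / 2}"
    by (rule holomorphic_on_divide[OF holomorphic_deriv[OF h open_halfspace_Re_gt] h nz'])
  show ?thesis
    unfolding zeta_logderiv_reg_def[abs_def]
    by (rule holomorphic_on_diff[OF holomorphic_on_const holomorphic_on_mult[OF holomorphic_on_diff[OF holomorphic_on_ident holomorphic_on_const] q]])
qed

text \<open>\<open>zeta_logderiv_reg\<close> is \<open>(s - 1) * (- zeta' s / zeta s)\<close> with
  the singularity at 1 filled in by the value 1. Displaying the pole as the factor
  \<open>1 / (s - 1)\<close> lets Cauchy's formula supply the residue.\<close>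

lemma mangoldt_series_eq_logderiv:
  assumes nz: "\<And>s. Re s > 1 / 2 \<Longrightarrow> s \<noteq> 1 \<Longrightarrow> zeta s \<noteq> 0" and s: "Re s > 1"
  shows "mangoldt_series s = zeta_logderiv_reg s / (s - 1)"
proof -
  have s1: "s \<noteq> 1" using s by auto
  have z0: "zeta s \<noteq> 0" using s s1 by (intro nz) auto
  have "(zeta has_field_derivative - (mangoldt_series s * zeta s)) (at s)"
    using s by (intro Dirichlet_logderiv zeta_Dirichlet)
  then have "((\<lambda>s. (s - 1) * zeta s) has_field_derivative zeta s - (s - 1) * (mangoldt_series s * zeta s)) (at s)"
    by (auto intro!: derivative_eq_intros)
  then have "(zeta_entire has_field_derivative zeta s - (s - 1) * (mangoldt_series s * zeta s)) (at s)"
    by (rule has_field_derivative_transform_within_open[where S = "- {1}"]) (use s1 in \<open>auto simp: zeta_entire_def\<close>)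
  then have d: "deriv zeta_entire s = zeta s - (s - 1) * (mangoldt_series s * zeta s)"
    by (rule DERIV_imp_deriv)
  have ze: "zeta_entire s = (s - 1) * zeta s" using s1 by (simp add: zeta_entire_def)
  have "(s - 1) * (deriv zeta_entire s / zeta_entire s) = 1 - (s - 1) * mangoldt_series s"
  proof -
    have "u * ((z - u * (m * z)) / (u * z)) = 1 - u * m" if "u \<noteq> 0" "z \<noteq> 0" for u z m :: complex
    proof -
      have "z - u * (m * z) = (1 - u * m) * z" by (simp add: algebra_simps)
      then show ?thesis using that by simp
    qed
    then show ?thesis unfolding d ze using s1 z0 by simp
  qed
  then show ?thesis using s1 by (simp add: zeta_logderiv_reg_def)
qed

lemma le_of_forall_le_add_div:
  fixes x y c :: real
  assumes "\<And>T. T \<ge> 2 \<Longrightarrow> x \<le> y + c / T"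
  shows "x \<le> y"
proof (rule tendsto_lowerbound[where F = at_top])
  show "((\<lambda>T. y + c / T) \<longlongrightarrow> y) at_top" by real_asymp
  show "\<forall>\<^sub>F T in at_top. x \<le> y + c / T"
    using eventually_ge_at_top[of 2] by eventually_elim (rule assms)
qed auto

text \<open>The rectangle between the lines \<open>Re s = 1 / 2 + \<eta>\<close> and
  \<open>Re s = 2\<close> contains only the pole at 1, which gives the main term. The left side is
  bounded uniformly in \<open>T\<close>, the horizontal sides by \<open>O(1 / T)\<close> for fixed
  \<open>N\<close>.\<close>

lemma perron_shifted_integral:
  assumes nz: "\<And>s. Re s > 1 / 2 \<Longrightarrow> s \<noteq> 1 \<Longrightarrow> zeta s \<noteq> 0" and \<eta>: "0 < \<eta>" "\<eta> \<le> 1 / 6"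
    and C: "C > 0" and bound: "\<And>s. 1 / 2 + \<eta> \<le> Re s \<Longrightarrow> Re s \<le> 2 \<Longrightarrow>
      norm (deriv zeta_entire s / zeta_entire s) \<le> C * (1 + \<bar>Im s\<bar>) powr \<eta>"
    and N: "N \<ge> 1" and T: "T \<ge> 2"
  shows "norm (contour_integral (linepath (Complex 2 (-T)) (Complex 2 T)) (\<lambda>s. mangoldt_series s * perron_kernel N s)
     - 2 * of_real pi * \<i> * of_real (real N + 1 / 2))
    \<le> 256 * (C + 4) / \<eta> * real (Suc N) powr (1 / 2 + 3 * \<eta>) + 16 * (C + 1) * real (Suc N) ^ 3 / T"
proof -
  let ?q = "\<lambda>s. 1 + \<bar>Im s\<bar>"
  let ?N = "real (Suc N)"
  let ?L = "\<lambda>s. deriv zeta_entire s / zeta_entire s"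
  let ?I = "\<lambda>a b. contour_integral (linepath a b)"
  let ?c = "2 * of_real pi * \<i> :: complex"
  define \<sigma> where "\<sigma> = 1 / 2 + \<eta>"
  have \<sigma>: "1 / 2 < \<sigma>" "\<sigma> < 1" using \<eta> by (auto simp: \<sigma>_def)
  let ?a = "Complex \<sigma> (-T)" and ?b = "Complex 2 T"
  let ?A = "{s. Re s > 1 / 2}"
  define h where "h s = zeta_logderiv_reg s * perron_kernel N s" for s
  define f where "f s = h s / (s - 1)" for s
  have hol_k: "perron_kernel N holomorphic_on ?A"
    unfolding perron_kernel_def[abs_def]
  proof (rule holomorphic_on_divide)
    show "s * (s + 1) \<noteq> 0" if "s \<in> ?A" for s using that by (auto simp: add_eq_0_iff2)
  qed (use N in \<open>auto intro!: holomorphic_intros simp del: of_nat_Suc\<close>)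
  have hol_h: "h holomorphic_on ?A"
    unfolding h_def[abs_def] by (intro holomorphic_on_mult hol_k holomorphic_zeta_logderiv_reg nz)
  have hol_f: "f holomorphic_on ?A - {1}"
    unfolding f_def[abs_def] by (intro holomorphic_on_divide holomorphic_on_subset[OF hol_h] holomorphic_intros) auto
  have cont: "continuous_on B f" if "B \<subseteq> ?A - {1}" for B
    using hol_f that by (meson holomorphic_on_imp_continuous_on holomorphic_on_subset)
  have box: "1 \<in> box ?a ?b" using \<sigma> T by (auto simp: in_box_complex_iff)
  have pth: "path_image (rectpath ?a ?b) \<subseteq> ?A - {1}"
  proof -
    have "path_image (rectpath ?a ?b) \<subseteq> ?A"
      using \<sigma> T by (auto simp: path_image_rectpath)
    moreover have "1 \<notin> path_image (rectpath ?a ?b)"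
      using path_image_rectpath_inter_box[of ?a ?b] box \<sigma> T by auto
    ultimately show ?thesis by auto
  qed
  have "((\<lambda>w. h w / (w - 1)) has_contour_integral (of_real (2 * pi) * \<i> * winding_number (rectpath ?a ?b) 1 * h 1)) (rectpath ?a ?b)"
  proof (rule Cauchy_integral_formula_convex_simple[OF convex_halfspace_Re_gt hol_h])
    show "1 \<in> interior ?A" unfolding interior_open[OF open_halfspace_Re_gt] by simp
  qed (use pth in auto)
  then have "contour_integral (rectpath ?a ?b) f = of_real (2 * pi) * \<i> * h 1"
    using box by (simp add: f_def[abs_def] contour_integral_unique winding_number_rectpath)
  \<comment> \<open>\<open>perron_kernel N 1\<close> is \<open>((N + 1) ^ 2 - N ^ 2) / 2\<close>,
    the mean of \<open>x\<close> over \<open>{N..N + 1}\<close>; this is the origin of the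
    \<open>1 / 2\<close>.\<close>
  also have "h 1 = of_real (real N + 1 / 2)"
    by (simp add: h_def zeta_logderiv_reg_def perron_kernel_def power2_eq_square field_simps)
  finally have rect: "contour_integral (rectpath ?a ?b) f = ?c * of_real (real N + 1 / 2)"
    by simp
  have segB: "s \<in> ?A - {1}" if "s \<in> closed_segment ?a (Complex 2 (-T))" for s
    using in_horizontal_segment[OF that] \<sigma> T by (auto simp: closed_segment_eq_real_ivl)
  have segT: "s \<in> ?A - {1}" if "s \<in> closed_segment ?b (Complex \<sigma> T)" for s
    using in_horizontal_segment[OF that] \<sigma> T by (auto simp: closed_segment_eq_real_ivl)
  have segL: "s \<in> ?A - {1}" if "s \<in> closed_segment (Complex \<sigma> t) (Complex \<sigma> u)" for s t u
    using in_vertical_segment[OF that] \<sigma> by auto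
  have segR: "s \<in> ?A - {1}" if "s \<in> closed_segment (Complex 2 (-T)) ?b" for s
    using in_vertical_segment[OF that] by auto
  have split: "contour_integral (rectpath ?a ?b) f = ?I ?a (Complex 2 (-T)) f
      + ?I (Complex 2 (-T)) ?b f + ?I ?b (Complex \<sigma> T) f
      + ?I (Complex \<sigma> T) ?a f"
  proof -
    have "continuous_on (closed_segment ?a (Complex 2 (-T))) f" by (intro cont subsetI segB)
    moreover have "continuous_on (closed_segment (Complex 2 (-T)) ?b) f" by (intro cont subsetI segR)
    moreover have "continuous_on (closed_segment ?b (Complex \<sigma> T)) f" by (intro cont subsetI segT)
    moreover have "continuous_on (closed_segment (Complex \<sigma> T) ?a) f" by (intro cont subsetI segL)
    ultimately show ?thesis by (subst contour_integral_rectpath) simp_all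
  qed
  \<comment> \<open>The side is cut at the real axis because the decay lemma measures from the
    starting point of a segment.\<close>
  have "?I (Complex \<sigma> T) ?a f = ?I (Complex \<sigma> T) (Complex \<sigma> 0) f + ?I (Complex \<sigma> 0) ?a f"
  proof (rule contour_integral_split_linepath)
    show "continuous_on (closed_segment (Complex \<sigma> T) ?a) f" by (intro cont subsetI segL)
    show "Complex \<sigma> 0 \<in> closed_segment (Complex \<sigma> T) ?a"
      using closed_segment_same_Re[of "Complex \<sigma> T" ?a] T by (auto simp: closed_segment_eq_real_ivl)
  qed
  also have "?I (Complex \<sigma> T) (Complex \<sigma> 0) f = - ?I (Complex \<sigma> 0) (Complex \<sigma> T) f"
    by (intro contour_integral_reverse_linepath cont subsetI segL)
  finally have left: "?I (Complex \<sigma> T) ?a f = - ?I (Complex \<sigma> 0) (Complex \<sigma> T) f + ?I (Complex \<sigma> 0) ?a f" .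
  have right: "?I (Complex 2 (-T)) ?b (\<lambda>s. mangoldt_series s * perron_kernel N s) = ?I (Complex 2 (-T)) ?b f"
  proof (rule contour_integral_eq)
    fix s assume "s \<in> path_image (linepath (Complex 2 (-T)) ?b)"
    then have "Re s = 2" by (simp add: in_vertical_segment)
    then show "mangoldt_series s * perron_kernel N s = f s"
      using mangoldt_series_eq_logderiv[OF nz, of s] by (simp add: f_def h_def)
  qed
  have f_eq: "f s = (1 / (s - 1) - ?L s) * perron_kernel N s" if "s \<noteq> 1" for s
    using that by (simp add: f_def h_def zeta_logderiv_reg_def field_simps)
  have one_le: "1 \<le> ?q s powr \<eta>" for s
    using \<eta> by (intro ge_one_powr_ge_zero) auto
  \<comment> \<open>A crude power of \<open>N\<close> suffices here, since \<open>T\<close> will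
    tend to infinity with \<open>N\<close> fixed.\<close>
  have horiz: "norm (f s) \<le> 4 * (C + 1) * ?N ^ 3 / T"
    if s: "\<sigma> \<le> Re s" "Re s \<le> 2" "\<bar>Im s\<bar> = T" for s
  proof -
    have s1: "s \<noteq> 1" using s T by auto
    have nT: "norm s \<ge> T" "norm (s - 1) \<ge> T" using abs_Im_le_cmod[of s] abs_Im_le_cmod[of "s - 1"] s by auto
    have "norm (s - 1) \<ge> 1" using nT T by linarith
    then have "norm (1 / (s - 1)) \<le> 1" by (auto simp: norm_divide divide_le_eq_1)
    then have "norm (1 / (s - 1) - ?L s) \<le> ?q s powr \<eta> + C * ?q s powr \<eta>"
      using bound[of s] s one_le[of s] by (intro order.trans[OF norm_triangle_ineq4] add_mono) (auto simp: \<sigma>_def)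
    also have "\<dots> = (C + 1) * (1 + T) powr \<eta>" by (simp add: s distrib_right)
    also have "\<dots> \<le> (C + 1) * (1 + T) powr 1"
      using C T \<eta> by (intro mult_left_mono powr_mono) auto
    also have "\<dots> \<le> (C + 1) * (2 * T)" using C T by (intro mult_left_mono) auto
    finally have 1: "norm (1 / (s - 1) - ?L s) \<le> (C + 1) * (2 * T)" .
    have "norm (perron_kernel N s) \<le> 2 * ?N powr (Re s + 1) / (norm s)\<^sup>2"
      using s \<sigma> by (intro norm_perron_kernel_le N) auto
    also have "\<dots> \<le> 2 * ?N powr 3 / T\<^sup>2"
      using s T nT by (intro frac_le mult_left_mono powr_mono power_mono) auto
    finally have 2: "norm (perron_kernel N s) \<le> 2 * ?N ^ 3 / T\<^sup>2"
      by (simp add: powr_numeral)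
    have "norm (f s) \<le> ((C + 1) * (2 * T)) * (2 * ?N ^ 3 / T\<^sup>2)"
      unfolding f_eq[OF s1] norm_mult using 1 2 C T by (intro mult_mono) auto
    also have "\<dots> = 4 * (C + 1) * ?N ^ 3 / T" using T by (simp add: power2_eq_square field_simps)
    finally show ?thesis .
  qed
  have horiz_int: "norm (?I u v f) \<le> 8 * (C + 1) * ?N ^ 3 / T"
    if uv: "u = ?a \<and> v = Complex 2 (-T) \<or> u = ?b \<and> v = Complex \<sigma> T" for u v
  proof -
    have on: "\<sigma> \<le> Re s \<and> Re s \<le> 2 \<and> \<bar>Im s\<bar> = T" if "s \<in> closed_segment u v" for s
      using uv that in_horizontal_segment[of s \<sigma> "-T" 2] in_horizontal_segment[of s 2 T \<sigma>] \<sigma> T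
      by (auto simp: closed_segment_eq_real_ivl)
    have nuv: "norm (v - u) \<le> 1 + 1 / 2"
      using uv \<sigma> by (auto simp: cmod_def)
    have "norm (?I u v f) \<le> (4 * (C + 1) * ?N ^ 3 / T) * norm (v - u)"
    proof (rule contour_integral_bound_linepath)
      show "f contour_integrable_on linepath u v"
        using uv segB segT by (intro contour_integrable_continuous_linepath cont) blast
      show "norm (f s) \<le> 4 * (C + 1) * ?N ^ 3 / T" if "s \<in> closed_segment u v" for s
        using on[OF that] by (intro horiz) simp_all
    qed (use C T in simp)
    also have "\<dots> \<le> (4 * (C + 1) * ?N ^ 3 / T) * 2"
      using nuv C T by (intro mult_left_mono) auto
    also have "\<dots> = 8 * (C + 1) * ?N ^ 3 / T" using T by (simp add: field_simps)
    finally show ?thesis .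
  qed
  have vert: "norm (f s) \<le> 128 * (C + 4) * ?N powr (1 / 2 + 3 * \<eta>) * ?q s powr (-1 - \<eta>)"
    if s: "Re s = \<sigma>" for s
  proof -
    have s1: "s \<noteq> 1" using s \<sigma> by auto
    \<comment> \<open>By \<open>\<eta> \<le> 1 / 6\<close> the line stays at distance at least
      \<open>1 / 3\<close> from the pole.\<close>
    have "norm (s - 1) \<ge> 1 / 4" using abs_Re_le_cmod[of "s - 1"] s \<eta> by (auto simp: \<sigma>_def)
    then have "norm (1 / (s - 1)) \<le> 4 * 1" using s1 by (simp add: norm_divide field_simps)
    also have "\<dots> \<le> 4 * ?q s powr \<eta>" using one_le[of s] by (intro mult_left_mono) auto
    finally have "norm (1 / (s - 1) - ?L s) \<le> 4 * ?q s powr \<eta> + C * ?q s powr \<eta>"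
      using bound[of s] s \<sigma> by (intro order.trans[OF norm_triangle_ineq4] add_mono) (auto simp: \<sigma>_def)
    then have 1: "norm (1 / (s - 1) - ?L s) \<le> (C + 4) * ?q s powr \<eta>"
      by (simp add: distrib_right)
    have "1 + \<bar>Im s\<bar> \<le> 4 * norm s"
      using abs_Re_le_cmod[of s] abs_Im_le_cmod[of s] s \<sigma> by auto
    then have "norm s powr (-1 - 2 * \<eta>) \<le> (?q s / 4) powr (-1 - 2 * \<eta>)"
      using \<eta> by (intro powr_mono2') auto
    also have "\<dots> = ?q s powr (-1 - 2 * \<eta>) * 4 powr (1 + 2 * \<eta>)"
    proof -
      have "4 powr (-1 - 2 * \<eta>) * 4 powr (1 + 2 * \<eta>) = (1 :: real)" by (simp flip: powr_add)
      then show ?thesis by (simp add: powr_divide field_simps)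
    qed
    also have "\<dots> \<le> ?q s powr (-1 - 2 * \<eta>) * 4 powr 3"
      using \<eta> by (intro mult_left_mono powr_mono) auto
    finally have "norm s powr (-1 - 2 * \<eta>) \<le> 64 * ?q s powr (-1 - 2 * \<eta>)" by (simp add: powr_numeral)
    then have k1: "2 * ?N powr (Re s + 2 * \<eta>) * norm s powr (-1 - 2 * \<eta>) \<le> 2 * ?N powr (Re s + 2 * \<eta>) * (64 * ?q s powr (-1 - 2 * \<eta>))"
      by (intro mult_left_mono) auto
    \<comment> \<open>Interpolation with \<open>\<theta> = 2 * \<eta>\<close>: one
      \<open>\<eta>\<close> compensates the growth of the logarithmic derivative, the other makes
      the integral converge.\<close>
    have k2: "norm (perron_kernel N s) \<le> 2 * ?N powr (Re s + 2 * \<eta>) * norm s powr (-1 - 2 * \<eta>)"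
      using s \<sigma> \<eta> by (intro norm_perron_kernel_interpolated N) auto
    have "Re s + 2 * \<eta> = 1 / 2 + 3 * \<eta>" by (simp add: s \<sigma>_def)
    then have "norm (perron_kernel N s) \<le> 2 * ?N powr (1 / 2 + 3 * \<eta>) * (64 * ?q s powr (-1 - 2 * \<eta>))"
      using order.trans[OF k2 k1] by (simp only:)
    then have 2: "norm (perron_kernel N s) \<le> 128 * ?N powr (1 / 2 + 3 * \<eta>) * ?q s powr (-1 - 2 * \<eta>)"
      by simp
    have "norm (f s) \<le> ((C + 4) * ?q s powr \<eta>) * (128 * ?N powr (1 / 2 + 3 * \<eta>) * ?q s powr (-1 - 2 * \<eta>))"
      unfolding f_eq[OF s1] norm_mult using 1 2 C by (intro mult_mono) auto
    also have "\<dots> = 128 * (C + 4) * ?N powr (1 / 2 + 3 * \<eta>) * (?q s powr \<eta> * ?q s powr (-1 - 2 * \<eta>))"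
      by (simp only: mult_ac)
    also have "?q s powr \<eta> * ?q s powr (-1 - 2 * \<eta>) = ?q s powr (\<eta> + (-1 - 2 * \<eta>))"
      by (rule powr_add[symmetric])
    also have "\<eta> + (-1 - 2 * \<eta>) = -1 - \<eta>" by simp
    finally show ?thesis .
  qed
  have vert_int: "norm (?I (Complex \<sigma> 0) (Complex \<sigma> t) f) \<le> 128 * (C + 4) * ?N powr (1 / 2 + 3 * \<eta>) / \<eta>" for t
  proof (rule contour_integral_bound_decay)
    show "continuous_on (closed_segment (Complex \<sigma> 0) (Complex \<sigma> t)) f" by (intro cont subsetI segL)
    fix x :: real assume x: "0 \<le> x" "x \<le> 1"
    have lp: "linepath (Complex \<sigma> 0) (Complex \<sigma> t) x = Complex \<sigma> (x * t)"
      by (simp add: linepath_def complex_eq_iff algebra_simps)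
    have "norm (Complex \<sigma> t - Complex \<sigma> 0) = \<bar>t\<bar>" by (simp add: cmod_def)
    then show "norm (f (linepath (Complex \<sigma> 0) (Complex \<sigma> t) x)) \<le> 128 * (C + 4) * ?N powr (1 / 2 + 3 * \<eta>) *
        (1 + x * norm (Complex \<sigma> t - Complex \<sigma> 0)) powr (-1 - \<eta>)"
      using vert[of "Complex \<sigma> (x * t)"] x unfolding lp by (simp add: abs_mult)
  qed (use \<eta> C in auto)
  have "?I (Complex 2 (-T)) ?b f - ?c * of_real (real N + 1 / 2)
    = (?I (Complex \<sigma> 0) (Complex \<sigma> T) f - ?I (Complex \<sigma> 0) ?a f)
      - (?I ?a (Complex 2 (-T)) f + ?I ?b (Complex \<sigma> T) f)"
    unfolding rect[symmetric] split left by (simp add: algebra_simps)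
  also have "norm \<dots> \<le> (128 * (C + 4) * ?N powr (1 / 2 + 3 * \<eta>) / \<eta> + 128 * (C + 4) * ?N powr (1 / 2 + 3 * \<eta>) / \<eta>)
    + (8 * (C + 1) * ?N ^ 3 / T + 8 * (C + 1) * ?N ^ 3 / T)"
    by (intro order.trans[OF norm_triangle_ineq4 add_mono[OF order.trans[OF norm_triangle_ineq4 add_mono[OF vert_int vert_int]]
        order.trans[OF norm_triangle_ineq add_mono[OF horiz_int horiz_int]]]]) auto
  also have "\<dots> = 256 * (C + 4) / \<eta> * ?N powr (1 / 2 + 3 * \<eta>) + 16 * (C + 1) * ?N ^ 3 / T"
    by (simp add: field_simps)
  finally show ?thesis unfolding right .
qed

text \<open>For fixed \<open>N\<close> both evaluations of the same integral are compared as
  \<open>T\<close> tends to infinity, which removes all terms \<open>N ^ 3 / T\<close>. The shift by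
  \<open>1 / 2\<close> is absorbed by the error term.\<close>

theorem chebyshev_psi_asymp:
  assumes nz: "\<And>s. Re s > 1 / 2 \<Longrightarrow> s \<noteq> 1 \<Longrightarrow> zeta s \<noteq> 0" and \<eta>: "0 < \<eta>" "\<eta> \<le> 1 / 6"
  shows "\<exists>B. \<forall>N\<ge>1. \<bar>chebyshev_psi N - real N\<bar> \<le> B * real N powr (1 / 2 + 3 * \<eta>)"
proof -
  let ?c = "2 * of_real pi * \<i> :: complex"
  obtain C where C: "C > 0" and bound: "\<And>s. 1 / 2 + \<eta> \<le> Re s \<Longrightarrow> Re s \<le> 2 \<Longrightarrow>
      norm (deriv zeta_entire s / zeta_entire s) \<le> C * (1 + \<bar>Im s\<bar>) powr \<eta>"
    using zeta_entire_logderiv_bound[OF nz, of \<eta>] \<eta> by auto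
  define a where "a = 1 / 2 + 3 * \<eta>"
  have a: "0 \<le> a" "a \<le> 1" using \<eta> by (auto simp: a_def)
  define K where "K = 256 * (C + 4) / \<eta>"
  have K: "K \<ge> 0" using C \<eta> by (simp add: K_def)
  define D where "D = (\<Sum>n. mangoldt n * real n powr (-2))"
  have "\<bar>chebyshev_psi N - real N\<bar> \<le> (1 / 2 + 2 * K) * real N powr a" if N: "N \<ge> 1" for N
  proof -
    have "2 * pi * \<bar>chebyshev_psi N - (real N + 1 / 2)\<bar> \<le> K * real (Suc N) powr a"
    proof (rule le_of_forall_le_add_div)
      fix T :: real assume T: "T \<ge> 2"
      let ?J = "contour_integral (linepath (Complex 2 (-T)) (Complex 2 T)) (\<lambda>s. mangoldt_series s * perron_kernel N s)"
      have 1: "norm (?J - ?c * of_real (chebyshev_psi N)) \<le> 24 * real (Suc N) ^ 3 / T * D"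
        unfolding D_def by (rule perron_formula[OF N T])
      have 2: "norm (?J - ?c * of_real (real N + 1 / 2)) \<le> K * real (Suc N) powr a + 16 * (C + 1) * real (Suc N) ^ 3 / T"
        unfolding K_def a_def by (rule perron_shifted_integral[OF nz \<eta> C bound N T])
      have eq: "?c * of_real (chebyshev_psi N - (real N + 1 / 2)) = (?J - ?c * of_real (real N + 1 / 2)) - (?J - ?c * of_real (chebyshev_psi N))"
        by (simp add: algebra_simps)
      have "norm (?c * of_real (chebyshev_psi N - (real N + 1 / 2)) :: complex) \<le> (K * real (Suc N) powr a + 16 * (C + 1) * real (Suc N) ^ 3 / T) + 24 * real (Suc N) ^ 3 / T * D"
        unfolding eq by (rule order.trans[OF norm_triangle_ineq4 add_mono[OF 2 1]])
      also have "norm (?c * of_real (chebyshev_psi N - (real N + 1 / 2)) :: complex) = 2 * pi * \<bar>chebyshev_psi N - (real N + 1 / 2)\<bar>"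
        unfolding norm_mult norm_of_real by simp
      also have "(K * real (Suc N) powr a + 16 * (C + 1) * real (Suc N) ^ 3 / T) + 24 * real (Suc N) ^ 3 / T * D
        = K * real (Suc N) powr a + (16 * (C + 1) * real (Suc N) ^ 3 + 24 * real (Suc N) ^ 3 * D) / T"
        by (simp add: add_divide_distrib)
      finally show "2 * pi * \<bar>chebyshev_psi N - (real N + 1 / 2)\<bar> \<le> K * real (Suc N) powr a + (16 * (C + 1) * real (Suc N) ^ 3 + 24 * real (Suc N) ^ 3 * D) / T" .
    qed
    moreover have "\<bar>chebyshev_psi N - (real N + 1 / 2)\<bar> \<le> 2 * pi * \<bar>chebyshev_psi N - (real N + 1 / 2)\<bar>"
      using mult_right_mono[of 1 "2 * pi" "\<bar>chebyshev_psi N - (real N + 1 / 2)\<bar>"] pi_ge_two by simp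
    ultimately have "\<bar>chebyshev_psi N - (real N + 1 / 2)\<bar> \<le> K * real (Suc N) powr a"
      by (rule order.trans[rotated])
    also have "\<dots> \<le> K * (2 * real N powr a)"
    proof (intro mult_left_mono K)
      have "real (Suc N) powr a \<le> (2 * real N) powr a" using N a by (intro powr_mono2) auto
      also have "\<dots> = 2 powr a * real N powr a" by (rule powr_mult)
      also have "\<dots> \<le> 2 powr 1 * real N powr a" using a by (intro mult_right_mono powr_mono) auto
      finally show "real (Suc N) powr a \<le> 2 * real N powr a" by simp
    qed
    finally have "\<bar>chebyshev_psi N - real N\<bar> \<le> 1 / 2 * 1 + 2 * K * real N powr a"
      by (simp add: abs_le_iff)
    also have "\<dots> \<le> 1 / 2 * real N powr a + 2 * K * real N powr a"
      using N a by (intro add_right_mono mult_left_mono ge_one_powr_ge_zero) auto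
    finally show ?thesis by (simp add: distrib_right)
  qed
  then show ?thesis unfolding a_def by blast
qed

section \<open>The two implications\<close>

lemma zeta_nonzero_right_of_S_bound:
  assumes k: "k \<ge> 1" and bound: "\<And>\<epsilon>::real. \<epsilon> > 0 \<Longrightarrow>
      \<exists>C. \<forall>X. X \<ge> real k \<longrightarrow> \<bar>S k X - X ^ k / fact k\<bar> \<le> C * X powr (real k - 1 / 2 + \<epsilon>)"
    and s: "Re s > 1 / 2" "s \<noteq> 1"
  shows "zeta s \<noteq> 0"
proof -
  \<comment> \<open>Half of the distance from \<open>s\<close> to the critical line keeps
    \<open>a\<close> below \<open>Re s\<close>; the cap \<open>1 / 2\<close> keeps it below
    2.\<close>
  define \<epsilon> where "\<epsilon> = min ((Re s - 1 / 2) / 2) (1 / 2)"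
  define a where "a = 1 / 2 + \<epsilon>"
  have \<epsilon>: "\<epsilon> > 0" "\<epsilon> \<le> (Re s - 1 / 2) / 2" "\<epsilon> \<le> 1 / 2" using s by (auto simp: \<epsilon>_def min_def)
  have a: "0 < a" "a < Re s" "a < 2" using \<epsilon> s by (simp_all add: a_def)
  obtain C where C: "\<And>X. X \<ge> real k \<Longrightarrow> \<bar>S k X - X ^ k / fact k\<bar> \<le> C * X powr (real k - 1 / 2 + \<epsilon>)"
    using bound[OF \<epsilon>(1)] by auto
  have exponent: "real k - 1 / 2 + \<epsilon> = real k - 1 + a" by (simp add: a_def)
  have "\<bar>G_sum k N - real N ^ k / fact k\<bar> \<le> C * real N powr (real k - 1 + a)" if "N \<ge> k" for N
    using C[of "real N"] that k unfolding exponent by (simp add: S_eq_G_sum)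
  then obtain K where "\<And>d. 0 < d \<Longrightarrow> d \<le> 1 \<Longrightarrow> \<bar>mangoldt_laplace d - 1 / (1 - exp (-d))\<bar> \<le> K * d powr (-a)"
    using mangoldt_laplace_asymp[OF k a(1)] by blast
  then show ?thesis using a s by (intro zeta_nonzero_of_laplace_bound[of a K])
qed

lemma S_asymp_of_zeta_nonzero_right:
  assumes k: "k \<ge> 1" and nz: "\<And>s. Re s > 1 / 2 \<Longrightarrow> s \<noteq> 1 \<Longrightarrow> zeta s \<noteq> 0" and \<epsilon>: "\<epsilon> > (0::real)"
  shows "\<exists>C. \<forall>X. X \<ge> real k \<longrightarrow> \<bar>S k X - X ^ k / fact k\<bar> \<le> C * X powr (real k - 1 / 2 + \<epsilon>)"
proof -
  let ?X = "\<lambda>X. X powr (real k - 1 / 2 + \<epsilon>)"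
  \<comment> \<open>\<open>3 * \<eta> \<le> \<epsilon>\<close> yields the required exponent, and
    \<open>\<eta> \<le> 1 / 6\<close> keeps \<open>a \<le> 1\<close>.\<close>
  define \<eta> where "\<eta> = min (1 / 6) (\<epsilon> / 3)"
  have \<eta>: "0 < \<eta>" "\<eta> \<le> 1 / 6" "3 * \<eta> \<le> \<epsilon>" using \<epsilon> by (auto simp: \<eta>_def min_def)
  define a where "a = 1 / 2 + 3 * \<eta>"
  have a: "0 \<le> a" "a \<le> 1" "a \<le> 1 / 2 + \<epsilon>" using \<eta> by (auto simp: a_def)
  obtain B where B: "\<And>N. N \<ge> 1 \<Longrightarrow> \<bar>chebyshev_psi N - real N\<bar> \<le> B * real N powr a"
    using chebyshev_psi_asymp[OF nz \<eta>(1,2)] unfolding a_def by blast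
  obtain C where C: "\<And>N. N \<ge> 1 \<Longrightarrow> \<bar>G_sum k N - real N ^ k / fact k\<bar> \<le> C * real N powr (real k - 1 + a)"
    using G_sum_asymp_of_psi[OF a(1,2) B k] by blast
  obtain m where m: "k = Suc m" using k by (cases k) auto
  have "\<bar>S k X - X ^ k / fact k\<bar> \<le> (\<bar>C\<bar> + real k) * ?X X" if X: "X \<ge> real k" for X
  proof -
    define N where "N = nat \<lfloor>X\<rfloor>"
    have X1: "X \<ge> 1" using X k by linarith
    have N: "N \<ge> 1" "real N \<le> X" "X - real N \<le> 1" using X1 by (auto simp: N_def le_nat_iff) linarith+
    have "\<bar>S k X - real N ^ k / fact k\<bar> \<le> C * real N powr (real k - 1 + a)"
      using C[OF N(1)] k X1 by (simp add: S_eq_G_sum N_def)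
    also have "\<dots> \<le> \<bar>C\<bar> * X powr (real k - 1 + a)"
      using N a k by (intro mult_mono powr_mono2) auto
    also have "\<dots> \<le> \<bar>C\<bar> * ?X X"
      using X1 a by (intro mult_left_mono powr_mono) auto
    finally have 1: "\<bar>S k X - real N ^ k / fact k\<bar> \<le> \<bar>C\<bar> * ?X X" .
    \<comment> \<open>Rounding \<open>X\<close> down to an integer changes the main term by
      \<open>O(X ^ (k - 1))\<close>, which is below the error term.\<close>
    have "X ^ k - real N ^ k \<le> real k * X ^ m * (X - real N)"
      unfolding m using N by (intro power_Suc_diff_bounds) auto
    also have "\<dots> \<le> real k * X ^ m * 1" using N X1 by (intro mult_left_mono) auto
    also have "X ^ m = X powr (real k - 1)" using X1 by (simp add: m powr_realpow)
    also have "real k * X powr (real k - 1) * 1 \<le> real k * ?X X"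
      using X1 \<epsilon> by (simp add: mult_left_mono powr_mono)
    finally have "X ^ k - real N ^ k \<le> real k * ?X X" .
    moreover have "real N ^ k \<le> X ^ k" using N by (intro power_mono) auto
    ultimately have "\<bar>real N ^ k - X ^ k\<bar> \<le> real k * ?X X" by simp
    then have "\<bar>real N ^ k - X ^ k\<bar> / fact k \<le> real k * ?X X / 1"
      by (intro frac_le) (auto simp: fact_ge_1)
    then have "\<bar>real N ^ k / fact k - X ^ k / fact k\<bar> \<le> real k * ?X X"
      by (simp flip: diff_divide_distrib add: abs_divide)
    then show ?thesis using 1 unfolding distrib_right by linarith
  qed
  then show ?thesis by blast
qed

theorem theorem1p4:
  fixes k :: nat
  assumes "k \<ge> 2"
  shows "Riemann_Hypothesis \<longleftrightarrow>
    (\<forall>\<epsilon>::real. \<epsilon> > 0 \<longrightarrow>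
      (\<exists>C::real. \<forall>X::real. X \<ge> real k \<longrightarrow>
        \<bar>S k X - X ^ k / fact k\<bar> \<le> C * X powr (real k - 1 / 2 + \<epsilon>)))"
proof -
  have k: "k \<ge> 1" using assms by simp
  show ?thesis
    unfolding Riemann_Hypothesis_iff_no_zeros_right
  proof (intro iffI allI impI)
    fix \<epsilon> :: real assume "\<forall>s. Re s > 1 / 2 \<longrightarrow> s \<noteq> 1 \<longrightarrow> zeta s \<noteq> 0" "\<epsilon> > 0"
    then show "\<exists>C::real. \<forall>X::real. X \<ge> real k \<longrightarrow> \<bar>S k X - X ^ k / fact k\<bar> \<le> C * X powr (real k - 1 / 2 + \<epsilon>)"
      using S_asymp_of_zeta_nonzero_right[OF k] by blast
  next
    fix s assume "\<forall>\<epsilon>::real. \<epsilon> > 0 \<longrightarrow> (\<exists>C::real. \<forall>X::real. X \<ge> real k \<longrightarrow>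
        \<bar>S k X - X ^ k / fact k\<bar> \<le> C * X powr (real k - 1 / 2 + \<epsilon>))" "Re s > 1 / 2" "s \<noteq> 1"
    then show "zeta s \<noteq> 0" using zeta_nonzero_right_of_S_bound[OF k] by blast
  qed
qed

end
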